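(* Let $L\colon\mathbb{R}^d\to[0,\infty]$ be a function satisfying - $\min_{\lambda\in\mathbb{R}^d}L(\lambda)=0$, - $\lim_{|\lambda|\to\infty}L(\lambda)/|\lambda|=\infty$, - $\sup_{\lambda\in B(0,r)\cap\{L<\infty\}}L(\lambda)<\infty$ for all $r>0$, - there exists $\varepsilon>0$ with $\sup_{\{|\lambda|=\varepsilon\}}L(\lambda)<\infty$. Let $(W_t)_{t\ge0}$ be a $d$-dimensional Brownian motion on a probability space $(\Omega,\mathcal{F},\mathbb{P})$, and for $t\ge0$, $f\in C_0=C_0(\mathbb{R}^d;\mathbb{R})$ and $x\in\mathbb{R}^d$ define $$(I(t)f)(x):=\sup_{\lambda\in\mathbb{R}^d}\big(\mathbb{E}[f(x+W_t+\lambda t)]-L(\lambda)t\big).$$ Let $(S(t))_{t\ge0}$ be a semigroup on $C_0$ associated to $(I(t))_{t\ge0}$ (see context). Then $S(t)\colon\mathcal{L}^S_{\mathrm{sym}}\to\mathcal{L}^S_{\mathrm{sym}}$ for all $t\ge0$, and $$\mathcal{L}^S_{\mathrm{sym}}=\mathcal{L}^I_{\mathrm{sym}}=\{f\in W^{1,\infty}\cap C_0:\ \Delta f\text{ exists in }L^\infty\}.$$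
   Context: $C_0$ is the space of continuous functions $\mathbb{R}^d\to\mathbb{R}$ vanishing at infinity, with the supremum norm $\|\cdot\|_\infty$. $B(0,r)$ is the closed ball. $L^\infty$ is the space of bounded Borel functions $\mathbb{R}^d\to\mathbb{R}$ modulo equality Lebesgue-a.e., and $W^{1,\infty}$ is the corresponding first-order Sobolev space. For $f\in W^{1,\infty}$, "$\Delta f$ exists in $L^\infty$" means that there is $g\in L^\infty$ with $\int_{\mathbb{R}^d}g\phi\,dx=-\int_{\mathbb{R}^d}\langle\nabla f,\nabla\phi\rangle\,dx$ for all $\phi\in C_c^\infty(\mathbb{R}^d)$; then $\Delta f:=g$. For a family $(J(t))_{t\ge0}$ of maps $J(t)\colon C_0\to C_0$, the Lipschitz set $\mathcal{L}^J$ is the set of all $f\in C_0$ for which there exist $t_0>0$, $c\ge0$ with $\|J(t)f-f\|_\infty\le ct$ for all $t\in[0,t_0]$, and the symmetric Lipschitz set is $\mathcal{L}^J_{\mathrm{sym}}:=\{f\in\mathcal{L}^J:-f\in\mathcal{L}^J\}$. The operators $I(t)$ map $C_0$ into $C_0$, are contractions for $\|\cdot\|_\infty$, and satisfy $\|I(t)f\|_\infty\le\|f\|_\infty$. Let $\mathcal{T}=\{k2^{-n}:k,n\in\mathbb{N}_0\}$ and, for $t\in\mathcal{T}$ and $n\in\mathbb{N}$ with $2^nt\in\mathbb{N}_0$, $I(\pi_n^t):=I(2^{-n})^{2^nt}$. A semigroup associated to $(I(t))_{t\ge0}$ is a family $(S(t))_{t\ge0}$ of maps $S(t)\colon C_0\to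 C_0$ such that: there is a subsequence $(n_l)_{l\in\mathbb{N}}\subset\mathbb{N}$ with $S(t)f=\lim_{l\to\infty}I(\pi_{n_l}^t)f$ in $C_0$ for all $(f,t)\in C_0\times\mathcal{T}$; $S(0)=\mathrm{id}$ and $S(s+t)=S(s)S(t)$ for all $s,t\ge0$; $\|S(t)f\|_\infty\le\|f\|_\infty$ and $\|S(t)f-S(t)g\|_\infty\le\|f-g\|_\infty$ for all $t\ge0$ and $f,g\in C_0$; $t\mapsto S(t)f$ is continuous for every $f\in C_0$; and for every $f\in\mathcal{L}^I$ there is $c\ge0$ with $\|S(s)f-S(t)f\|_\infty\le c|s-t|$ for all $s,t\ge0$. (Such a semigroup exists.) *)

theory Defs
  imports "HOL-Probability.Probability"
begin

text \<open>
  The space \<open>\<real>\<^sup>d\<close> is an arbitrary type of class \<open>euclidean_space\<close>, with \<open>d = DIM('a)\<close>;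
  this includes \<open>real ^ 'n\<close>.
\<close>

definition C0 :: "('a::euclidean_space \<Rightarrow> real) set" where
  "C0 = {f. continuous_on UNIV f \<and> (f \<longlongrightarrow> 0) at_infinity}"

text \<open>Meaningful for bounded functions only, in particular for differences of elements of \<^term>\<open>C0\<close>.\<close>

definition supnorm :: "('a \<Rightarrow> real) \<Rightarrow> real" where
  "supnorm f = (SUP x. \<bar>f x\<bar>)"

definition lip_set :: "(real \<Rightarrow> ('a::euclidean_space \<Rightarrow> real) \<Rightarrow> ('a \<Rightarrow> real)) \<Rightarrow> ('a \<Rightarrow> real) set" where
  "lip_set J = {f \<in> C0. \<exists>t0>0. \<exists>c\<ge>0. \<forall>t\<in>{0..t0}. supnorm (\<lambda>x. J t f x - f x) \<le> c * t}"

definition lip_set_sym :: "(real \<Rightarrow> ('a::euclidean_space \<Rightarrow> real) \<Rightarrow> ('a \<Rightarrow> real)) \<Rightarrow> ('a \<Rightarrow> real) set" where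
  "lip_set_sym J = {f \<in> lip_set J. (\<lambda>x. - f x) \<in> lip_set J}"

definition dyadics :: "real set" where
  "dyadics = {real k / 2 ^ n | k n :: nat. True}"

text \<open>
  Used for dyadic \<open>t\<close> and those \<open>n\<close> for which \<open>2\<^sup>n t\<close> is a natural number, where the rounding
  has no effect; this is the case for all sufficiently large \<open>n\<close>.
\<close>

definition dyadic_iterate :: "(real \<Rightarrow> 'b \<Rightarrow> 'b) \<Rightarrow> nat \<Rightarrow> real \<Rightarrow> 'b \<Rightarrow> 'b" where
  "dyadic_iterate J n t = (J (1 / 2 ^ n)) ^^ nat \<lfloor>2 ^ n * t\<rfloor>"

definition associated_semigroup ::
  "(real \<Rightarrow> ('a::euclidean_space \<Rightarrow> real) \<Rightarrow> ('a \<Rightarrow> real)) \<Rightarrow>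
   (real \<Rightarrow> ('a \<Rightarrow> real) \<Rightarrow> ('a \<Rightarrow> real)) \<Rightarrow> bool" where
  "associated_semigroup J S \<longleftrightarrow>
     (\<forall>t\<ge>0. \<forall>f\<in>C0. S t f \<in> C0) \<and>
     (\<exists>n :: nat \<Rightarrow> nat. strict_mono n \<and> (\<forall>l. 1 \<le> n l) \<and>
        (\<forall>f\<in>C0. \<forall>t\<in>dyadics.
           (\<lambda>l. supnorm (\<lambda>x. dyadic_iterate J (n l) t f x - S t f x)) \<longlonglongrightarrow> 0)) \<and>
     (\<forall>f\<in>C0. S 0 f = f) \<and>
     (\<forall>s\<ge>0. \<forall>t\<ge>0. \<forall>f\<in>C0. S (s + t) f = S s (S t f)) \<and>
     (\<forall>t\<ge>0. \<forall>f\<in>C0. supnorm (S t f) \<le> supnorm f) \<and>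
     (\<forall>t\<ge>0. \<forall>f\<in>C0. \<forall>g\<in>C0.
        supnorm (\<lambda>x. S t f x - S t g x) \<le> supnorm (\<lambda>x. f x - g x)) \<and>
     (\<forall>f\<in>C0. \<forall>t\<ge>0.
        ((\<lambda>s. supnorm (\<lambda>x. S s f x - S t f x)) \<longlongrightarrow> 0) (at t within {0..})) \<and>
     (\<forall>f\<in>lip_set J. \<exists>c\<ge>0. \<forall>s\<ge>0. \<forall>t\<ge>0.
        supnorm (\<lambda>x. S s f x - S t f x) \<le> c * \<bar>s - t\<bar>)"

text \<open>
  Standard Brownian motion started at the origin. The increments over \<open>[s, t]\<close> have the centred
  normal distribution with covariance matrix \<open>(t - s) Id\<close>, whose density is the product of the
  one-dimensional densities of the coordinates; the second parameter of \<^const>\<open>normal_density\<close>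
  is the standard deviation.
\<close>

definition brownian_motion ::
  "'w measure \<Rightarrow> (real \<Rightarrow> 'w \<Rightarrow> 'a::euclidean_space) \<Rightarrow> bool" where
  "brownian_motion M W \<longleftrightarrow>
     prob_space M \<and>
     (\<forall>t\<ge>0. W t \<in> borel_measurable M) \<and>
     (AE \<omega> in M. W 0 \<omega> = 0) \<and>
     (\<forall>(m::nat) (\<tau>::nat \<Rightarrow> real). 0 \<le> \<tau> 0 \<and> (\<forall>i<m. \<tau> i \<le> \<tau> (Suc i)) \<longrightarrow>
        prob_space.indep_vars M (\<lambda>_. borel) (\<lambda>i \<omega>. W (\<tau> (Suc i)) \<omega> - W (\<tau> i) \<omega>) {..<m}) \<and>
     (\<forall>s t. 0 \<le> s \<and> s < t \<longrightarrow>
        distributed M lborel (\<lambda>\<omega>. W t \<omega> - W s \<omega>)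
          (\<lambda>x. ennreal (\<Prod>b\<in>Basis. normal_density 0 (sqrt (t - s)) (x \<bullet> b)))) \<and>
     (AE \<omega> in M. continuous_on {0..} (\<lambda>t. W t \<omega>))"

text \<open>
  The supremum is taken in the extended reals, since the cost may be infinite (and \<open>\<infinity> * 0 = 0\<close>
  there). For \<open>f\<close> in \<^term>\<open>C0\<close> and a cost function attaining the value \<open>0\<close> it is finite.
\<close>

definition control_op ::
  "'w measure \<Rightarrow> (real \<Rightarrow> 'w \<Rightarrow> 'a::euclidean_space) \<Rightarrow> ('a \<Rightarrow> ennreal) \<Rightarrow>
   real \<Rightarrow> ('a \<Rightarrow> real) \<Rightarrow> ('a \<Rightarrow> real)" where
  "control_op M W L t f x =
     real_of_ereal
       (SUP l. ereal (\<integral>\<omega>. f (x + W t \<omega> + t *\<^sub>R l) \<partial>M) - enn2ereal (L l) * ereal t)"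

text \<open>Elements of \<open>L\<^sup>\<infinity>\<close> are given by bounded Borel representatives.\<close>

definition Linf :: "('a::euclidean_space \<Rightarrow> 'b::euclidean_space) set" where
  "Linf = {g. g \<in> borel_measurable borel \<and> bounded (range g)}"

primrec Ck :: "nat \<Rightarrow> ('a::euclidean_space \<Rightarrow> real) \<Rightarrow> bool" where
  "Ck 0 f \<longleftrightarrow> continuous_on UNIV f"
| "Ck (Suc k) f \<longleftrightarrow>
     (\<forall>x. f differentiable at x) \<and> (\<forall>v. Ck k (\<lambda>x. frechet_derivative f (at x) v))"

definition test_functions :: "('a::euclidean_space \<Rightarrow> real) set" where
  "test_functions = {\<phi>. (\<forall>k. Ck k \<phi>) \<and> compact (closure {x. \<phi> x \<noteq> 0})}"

definition grad :: "('a::euclidean_space \<Rightarrow> real) \<Rightarrow> 'a \<Rightarrow> 'a" where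
  "grad \<phi> x = (\<Sum>b\<in>Basis. frechet_derivative \<phi> (at x) b *\<^sub>R b)"

definition weak_gradient :: "('a::euclidean_space \<Rightarrow> real) \<Rightarrow> ('a \<Rightarrow> 'a) \<Rightarrow> bool" where
  "weak_gradient f G \<longleftrightarrow>
     (\<forall>\<phi>\<in>test_functions. \<forall>b\<in>Basis.
        (\<integral>x. f x * (grad \<phi> x \<bullet> b) \<partial>lborel) = - (\<integral>x. (G x \<bullet> b) * \<phi> x \<partial>lborel))"

definition W1inf :: "('a::euclidean_space \<Rightarrow> real) set" where
  "W1inf = {f \<in> Linf. \<exists>G\<in>Linf. weak_gradient f G}"

text \<open>
  The function \<open>g\<close> represents the Laplacian of \<open>f\<close>. The weak gradient is unique almost everywhere,
  so the choice of \<open>G\<close> does not matter.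
\<close>

definition weak_laplacian :: "('a::euclidean_space \<Rightarrow> real) \<Rightarrow> ('a \<Rightarrow> real) \<Rightarrow> bool" where
  "weak_laplacian f g \<longleftrightarrow>
     (\<exists>G\<in>Linf. weak_gradient f G \<and>
        (\<forall>\<phi>\<in>test_functions.
           (\<integral>x. g x * \<phi> x \<partial>lborel) = - (\<integral>x. G x \<bullet> grad \<phi> x \<partial>lborel)))"

end

theory Submission imports Defs begin

text \<open>
  Let \<open>heat t f x\<close> be the expectation of \<open>f (x + W t)\<close>. All three sets are identified with the set of
  those \<open>f\<close> in \<^const>\<open>C0\<close> that are Lipschitz continuous and satisfy \<open>\<bar>heat t f x - f x\<bar> \<le> c * t\<close> for small \<open>t\<close>
  (\<open>heat_lip_set\<close>).

  Write \<open>I\<close> for the control operators. A fixed control \<open>l\<close> of finite cost gives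
  \<open>I t f x \<ge> heat t f (x + t *\<^sub>R l) - t * L l\<close>. If \<open>f\<close> is \<open>B\<close>-Lipschitz, a drift \<open>l\<close> gains at most
  \<open>B * norm l\<close> per unit of time, and superlinear growth of \<open>L\<close> yields \<open>I t f x \<le> heat t f x + t * K\<close>. Both
  bounds survive iteration, hence hold for \<open>S\<close>, and the symmetric Lipschitz sets of \<open>I\<close> and \<open>S\<close> are
  computed from these bounds (\<open>sandwiched\<close>). On Lipschitz functions, \<open>I\<close>, \<open>S\<close> and the
  heat semigroup thus agree up to terms linear in time. It remains to see that a function in
  a symmetric Lipschitz set is Lipschitz: the lower bounds for \<open>f\<close> and \<open>-f\<close> show that \<open>f x\<close> and
  \<open>heat t f (x + t *\<^sub>R l)\<close> differ by a multiple of \<open>t\<close> for all \<open>l\<close> on a sphere, and two points at distance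
  \<open>2 * t * norm l\<close> are compared through their midpoint (\<open>lip_set_sym_lipschitz\<close>). Invariance under \<open>S\<close>
  follows, as \<open>S t f\<close> stays Lipschitz and in the one-sided Lipschitz set.

  The identification of \<open>heat_lip_set\<close> with a Sobolev space works through the smooth functions
  \<open>corr f \<phi>\<close>, the correlations of \<open>f\<close> with test functions. On them the generator of the heat semigroup is
  half the Laplacian, with a uniform error of order \<open>t\<close> to the power \<open>3/2\<close> (\<open>generator_estimate\<close>, by Taylor
  expansion and Gaussian moments). If \<open>f\<close> is in \<open>heat_lip_set\<close>, its difference quotients in space and
  time are bounded and converge as distributions, and a bounded sequence of functions that converges
  weakly has a bounded function as its limit (\<open>weak_limit_of_bounded_sequence\<close>). Conversely, bounded weak
  derivatives of \<open>f\<close> bound the derivatives of \<open>corr f \<phi>\<close> by multiples of \<open>\<integral> \<bar>\<phi>\<bar>\<close>, hence its displacement under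
  translations and under the heat semigroup; bump functions \<open>\<phi>\<close> transfer these bounds to \<open>f\<close>
  (\<open>pointwise_bound_of_weak_bound\<close>).
\<close>

section \<open>Test functions\<close>

text \<open>
  The direction comes first, so that \<open>dirderiv v\<close> is an operator on functions that can be iterated.
\<close>

definition dirderiv :: "'a::euclidean_space \<Rightarrow> ('a \<Rightarrow> real) \<Rightarrow> 'a \<Rightarrow> real" where
  "dirderiv v f = (\<lambda>x. frechet_derivative f (at x) v)"

lemma dirderiv_eq: "(f has_derivative D) (at x) \<Longrightarrow> dirderiv v f x = D v"
  unfolding dirderiv_def using frechet_derivative_at by metis

text \<open>
  The definition of \<^const>\<open>Ck\<close> speaks of the chosen Frechet derivative; this form accepts any
  derivative, as the rules for sums, products and chains provide it.
\<close>

lemma Ck_SucI: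
  assumes "\<And>x. (f has_derivative D x) (at x)" "\<And>v. Ck k (\<lambda>x. D x v)"
  shows "Ck (Suc k) f"
proof -
  have "frechet_derivative f (at x) = D x" for x
    using frechet_derivative_at[OF assms(1)[of x]] by simp
  then show ?thesis using assms by (auto simp: differentiable_def)
qed

lemma Ck_SucD: "Ck (Suc k) f \<Longrightarrow> Ck k f"
proof (induction k arbitrary: f)
  case 0
  then show ?case by (auto intro!: differentiable_imp_continuous_on simp: differentiable_on_def differentiable_at_withinI)
next
  case (Suc k)
  then show ?case by (metis Ck.simps(2))
qed

lemma Ck_const: "Ck k (\<lambda>_. c)"
proof (induction k arbitrary: c)
  case (Suc k)
  show ?case by (rule Ck_SucI[where D="\<lambda>_ _. 0"]) (use Suc in auto)
qed auto

lemma Ck_inner: "Ck k (\<lambda>x. (x - a) \<bullet> v)"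
proof (cases k)
  case (Suc j)
  show ?thesis unfolding Suc
    by (rule Ck_SucI[where D="\<lambda>x h. h \<bullet> v"]) (auto intro!: derivative_eq_intros Ck_const)
qed (auto intro!: continuous_intros)

lemma Ck_add: "Ck k f \<Longrightarrow> Ck k g \<Longrightarrow> Ck k (\<lambda>x. f x + g x)"
proof (induction k arbitrary: f g)
  case (Suc k)
  show ?case
    by (rule Ck_SucI[where D="\<lambda>x v. frechet_derivative f (at x) v + frechet_derivative g (at x) v"])
      (use Suc in \<open>auto intro!: has_derivative_add simp: frechet_derivative_works\<close>)
qed (auto intro!: continuous_intros)

lemma Ck_mult: "Ck k f \<Longrightarrow> Ck k g \<Longrightarrow> Ck k (\<lambda>x. f x * g x)"
proof (induction k arbitrary: f g)
  case (Suc k)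
  have "Ck k f" "Ck k g" using Suc.prems Ck_SucD by auto
  then show ?case
    by (intro Ck_SucI[where D="\<lambda>x v. f x * frechet_derivative g (at x) v + frechet_derivative f (at x) v * g x"])
      (use Suc in \<open>auto intro!: has_derivative_mult Ck_add simp: frechet_derivative_works\<close>)
qed (auto intro!: continuous_intros)

lemma Ck_translation: "Ck k f \<Longrightarrow> Ck k (\<lambda>x. f (x - a))"
proof (induction k arbitrary: f)
  case 0
  then show ?case by (auto intro!: continuous_intros continuous_on_compose2[of UNIV f])
next
  case (Suc k)
  have "((\<lambda>x. f (x - a)) has_derivative frechet_derivative f (at (x - a))) (at x)" for x
  proof -
    have "((\<lambda>x. x - a) has_derivative (\<lambda>x. x)) (at x)" by (auto intro!: derivative_eq_intros)
    from diff_chain_at[OF this, of f "frechet_derivative f (at (x - a))"] Suc.prems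
    show ?thesis by (simp add: o_def frechet_derivative_works)
  qed
  then show ?case by (rule Ck_SucI) (use Suc in auto)
qed

lemma test_functions_dirderiv:
  assumes "\<phi> \<in> test_functions" shows "dirderiv v \<phi> \<in> test_functions"
proof -
  let ?S = "closure {x. \<phi> x \<noteq> 0}"
  have "dirderiv v \<phi> x = 0" if "x \<notin> ?S" for x
  proof -
    have "(\<phi> has_derivative (\<lambda>_. 0)) (at x)"
      by (rule has_derivative_transform_within_open[where s="- ?S" and f="\<lambda>_. 0"])
        (use that closure_subset[of "{x. \<phi> x \<noteq> 0}"] in auto)
    then show ?thesis using dirderiv_eq by metis
  qed
  then have "{x. dirderiv v \<phi> x \<noteq> 0} \<subseteq> ?S" by auto
  then have sub: "closure {x. dirderiv v \<phi> x \<noteq> 0} \<subseteq> ?S" by (simp add: closure_minimal)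
  have "compact ?S" using assms by (simp add: test_functions_def)
  then have "compact (closure {x. dirderiv v \<phi> x \<noteq> 0})"
    using sub by (metis closed_closure compact_Int_closed inf.absorb_iff2)
  moreover have "Ck k (dirderiv v \<phi>)" for k
    using assms Ck.simps(2)[of k \<phi>] by (auto simp: test_functions_def dirderiv_def)
  ultimately show ?thesis by (simp add: test_functions_def)
qed

lemma test_functions_translation:
  assumes "\<phi> \<in> test_functions" shows "(\<lambda>x. \<phi> (x - a)) \<in> test_functions"
proof -
  have "{x. \<phi> (x - a) \<noteq> 0} = (+) a ` {x. \<phi> x \<noteq> 0}"
    by (auto simp: image_iff) (metis add.commute diff_add_cancel)
  then have "closure {x. \<phi> (x - a) \<noteq> 0} = (+) a ` closure {x. \<phi> x \<noteq> 0}"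
    by (simp add: closure_translation)
  then show ?thesis
    using assms compact_translation by (auto simp: test_functions_def Ck_translation simp del: compact_closure)
qed

lemma test_functions_has_derivative:
  assumes "\<phi> \<in> test_functions" shows "(\<phi> has_derivative (\<lambda>v. dirderiv v \<phi> x)) (at x)"
proof -
  have "Ck (Suc 0) \<phi>" using assms unfolding test_functions_def by blast
  then show ?thesis by (simp add: dirderiv_def frechet_derivative_works)
qed

lemma test_functions_continuous:
  assumes "\<phi> \<in> test_functions" shows "continuous_on UNIV \<phi>"
  using assms Ck.simps(1) unfolding test_functions_def by blast

text \<open>
  One bound that carries both the size and the support of a test function: it serves as the
  dominating function for convergence theorems.
\<close>

lemma test_functions_bounded_support:
  assumes "\<phi> \<in> test_functions"
  obtains N R where "N \<ge> 0" "R > 0" "\<And>x. \<bar>\<phi> x\<bar> \<le> N * indicator (cball 0 R) x"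
proof -
  have c: "compact (closure {x. \<phi> x \<noteq> 0})" using assms by (simp add: test_functions_def)
  then obtain R where R: "R > 0" "closure {x. \<phi> x \<noteq> 0} \<subseteq> cball 0 R"
    using bounded_subset_ballD[OF compact_imp_bounded[OF c], of 0] ball_subset_cball by (metis subset_trans)
  have "compact (\<phi> ` cball 0 R)"
    by (intro compact_continuous_image continuous_on_subset[OF test_functions_continuous[OF assms]]) auto
  then obtain N where N: "N > 0" "\<And>x. x \<in> cball 0 R \<Longrightarrow> \<bar>\<phi> x\<bar> \<le> N"
    by (metis bounded_pos compact_imp_bounded imageI real_norm_def)
  have "\<bar>\<phi> x\<bar> \<le> N * indicator (cball 0 R) x" for x
    using N R closure_subset[of "{x. \<phi> x \<noteq> 0}"] by (cases "x \<in> cball 0 R") auto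
  then show ?thesis using that[of N R] N R by auto
qed

lemma test_functions_measurable:
  "\<phi> \<in> test_functions \<Longrightarrow> \<phi> \<in> borel_measurable borel"
  using test_functions_continuous borel_measurable_continuous_onI by auto

lemma integrable_indicator_cball: "integrable lborel (\<lambda>x. c * indicator (cball (0::'a::euclidean_space) R) x :: real)"
proof -
  have "emeasure lborel (cball (0::'a) R) < \<infinity>"
    by (rule emeasure_bounded_finite) auto
  then show ?thesis by (auto intro!: integrable_mult_right simp: integrable_indicator_iff)
qed

lemma test_functions_integrable:
  assumes "\<phi> \<in> test_functions" shows "integrable lborel \<phi>"
proof -
  note [measurable] = test_functions_measurable[OF assms]
  obtain N R where "\<And>x. \<bar>\<phi> x\<bar> \<le> N * indicator (cball 0 R) x"
    using test_functions_bounded_support[OF assms] by metis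
  then show ?thesis
    by (intro Bochner_Integration.integrable_bound[OF integrable_indicator_cball[of N R]])
     (auto intro!: always_eventually intro: order_trans[OF _ abs_ge_self])
qed

lemma integrable_bounded_mult_test:
  assumes "\<phi> \<in> test_functions" "f \<in> borel_measurable borel" "\<And>x. \<bar>f x\<bar> \<le> N"
  shows "integrable lborel (\<lambda>x. f x * \<phi> x)"
proof (rule Bochner_Integration.integrable_bound)
  show "integrable lborel (\<lambda>x. N * \<phi> x)" using test_functions_integrable[OF assms(1)] by auto
  show "(\<lambda>x. f x * \<phi> x) \<in> borel_measurable lborel"
    using assms(1,2) test_functions_measurable[OF assms(1)] by measurable
  show "AE x in lborel. norm (f x * \<phi> x) \<le> norm (N * \<phi> x)"
    using assms(3) abs_ge_self[of N] by (auto simp: abs_mult intro!: mult_right_mono order_trans[OF assms(3)])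
qed

lemma integral_bounded_mult_test_le:
  assumes "\<phi> \<in> test_functions" "f \<in> borel_measurable borel" "\<And>x. \<bar>f x\<bar> \<le> N"
  shows "\<bar>\<integral>x. f x * \<phi> x \<partial>lborel\<bar> \<le> N * (\<integral>x. \<bar>\<phi> x\<bar> \<partial>lborel)"
proof -
  have i: "integrable lborel (\<lambda>x. N * \<bar>\<phi> x\<bar>)" using test_functions_integrable[OF assms(1)] by auto
  have "\<bar>\<integral>x. f x * \<phi> x \<partial>lborel\<bar> \<le> (\<integral>x. N * \<bar>\<phi> x\<bar> \<partial>lborel)"
    using Bochner_Integration.integral_norm_bound_integral[OF integrable_bounded_mult_test[OF assms] i] assms(3)
    by (auto simp: abs_mult mult_right_mono)
  then show ?thesis by simp
qed

subsection \<open>Bump functions\<close>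

text \<open>
  \<open>flat_exp 0\<close> is the classical flat function \<open>exp (-1/s)\<close>. The powers of \<open>1/s\<close> are included because
  the resulting family is closed under differentiation, so that one induction over all \<open>m\<close> yields
  smoothness of every order.
\<close>

definition flat_exp :: "nat \<Rightarrow> real \<Rightarrow> real" where
  "flat_exp m s = (if s > 0 then exp (- (1 / s)) / s ^ m else 0)"

lemma flat_exp_tendsto_0: "(flat_exp m \<longlongrightarrow> 0) (at 0)"
proof -
  have "((\<lambda>s::real. inverse s ^ m / exp (inverse s)) \<longlongrightarrow> 0) (at_right 0)"
    by (rule filterlim_compose[OF tendsto_power_div_exp_0 filterlim_inverse_at_top_right])
  moreover have "eventually (\<lambda>s::real. inverse s ^ m / exp (inverse s) = flat_exp m s) (at_right 0)"
    by (auto simp: eventually_at_filter flat_exp_def exp_minus field_simps intro!: always_eventually)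
  ultimately have "(flat_exp m \<longlongrightarrow> 0) (at_right 0)" by (rule Lim_transform_eventually)
  moreover have "(flat_exp m \<longlongrightarrow> 0) (at_left 0)"
    by (rule tendsto_eventually) (auto simp: eventually_at_filter flat_exp_def)
  ultimately show ?thesis by (simp add: filterlim_at_split)
qed

text \<open>
  At the origin the difference quotient of \<open>flat_exp m\<close> is \<open>flat_exp (m + 1)\<close>, which tends to \<open>0\<close>.
\<close>

lemma flat_exp_DERIV:
  "(flat_exp m has_real_derivative (flat_exp (m + 2) s - real m * flat_exp (m + 1) s)) (at s)"
proof -
  consider "s > 0" | "s < 0" | "s = 0" by linarith
  then show ?thesis
  proof cases
    case 1
    have "((\<lambda>s. exp (- (1 / s)) / s ^ m) has_real_derivative (flat_exp (m + 2) s - real m * flat_exp (m + 1) s)) (at s)"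
      using 1 
      apply (auto intro!: derivative_eq_intros simp: flat_exp_def field_simps power2_eq_square)
      apply (cases m; simp add: field_simps)
      done
    then show ?thesis
      by (rule has_field_derivative_transform_within_open[where S="{0<..}"])
       (use 1 in \<open>auto simp: flat_exp_def\<close>)
  next
    case 2
    have "((\<lambda>s. 0) has_real_derivative (flat_exp (m + 2) s - real m * flat_exp (m + 1) s)) (at s)"
      using 2 by (auto simp: flat_exp_def)
    then show ?thesis
      by (rule has_field_derivative_transform_within_open[where S="{..<0}"])
       (use 2 in \<open>auto simp: flat_exp_def\<close>)
  next
    case 3
    have "eventually (\<lambda>h. flat_exp (Suc m) h = (flat_exp m (0 + h) - flat_exp m 0) / h) (at 0)"
      by (auto simp: eventually_at_filter flat_exp_def intro!: always_eventually)
    then have "((\<lambda>h. (flat_exp m (0 + h) - flat_exp m 0) / h) \<longlongrightarrow> 0) (at 0)"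
      by (rule Lim_transform_eventually[OF flat_exp_tendsto_0[of "Suc m"]])
    then show ?thesis using 3 by (simp add: DERIV_def flat_exp_def)
  qed
qed

lemma Ck_flat_exp: "Ck k (\<lambda>x. flat_exp m (c - (x - a) \<bullet> (x - a)))"
proof (induction k arbitrary: m)
  case 0
  have "continuous_on UNIV (flat_exp m)"
    by (rule DERIV_continuous_on[OF has_field_derivative_at_within[OF flat_exp_DERIV]])
  moreover have "continuous_on UNIV (\<lambda>x. c - (x - a) \<bullet> (x - a))" by (intro continuous_intros)
  ultimately show ?case unfolding Ck.simps by (rule continuous_on_compose2) simp
next
  case (Suc k)
  let ?q = "\<lambda>x. c - (x - a) \<bullet> (x - a)"
  let ?e = "\<lambda>x. flat_exp (m + 2) (?q x) + (- real m) * flat_exp (m + 1) (?q x)"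
  have d: "((\<lambda>x. flat_exp m (?q x)) has_derivative (\<lambda>v. ?e x * ((-2) * ((x - a) \<bullet> v)))) (at x)" for x
  proof -
    have "(?q has_derivative (\<lambda>v. - ((x - a) \<bullet> v + v \<bullet> (x - a)))) (at x)"
      by (auto intro!: derivative_eq_intros)
    from DERIV_compose_FDERIV[OF flat_exp_DERIV this, of m] show ?thesis
      by (rule has_derivative_eq_rhs) (auto simp: fun_eq_iff inner_commute algebra_simps)
  qed
  show ?case
    by (rule Ck_SucI[OF d]) (intro Ck_mult Ck_add Ck_const Ck_inner Suc.IH)
qed

lemma bump_exists:
  fixes a :: "'a::euclidean_space"
  assumes "r > 0"
  obtains \<phi> :: "'a \<Rightarrow> real" where "\<phi> \<in> test_functions" "\<And>x. 0 \<le> \<phi> x" "\<And>x. x \<notin> ball a r \<Longrightarrow> \<phi> x = 0" "0 < (\<integral>x. \<phi> x \<partial>lborel)"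
proof -
  define \<phi> :: "'a \<Rightarrow> real" where "\<phi> = (\<lambda>x. flat_exp 0 (r\<^sup>2 - (x - a) \<bullet> (x - a)))"
  have pos: "\<phi> x > 0 \<longleftrightarrow> x \<in> ball a r" for x
  proof -
    have "\<phi> x > 0 \<longleftrightarrow> (norm (x - a))\<^sup>2 < r\<^sup>2" 
      unfolding power2_norm_eq_inner by (auto simp: \<phi>_def flat_exp_def)
    also have "\<dots> \<longleftrightarrow> norm (x - a) < r" using assms
      by (metis abs_of_pos abs_norm_cancel abs_le_square_iff linorder_not_le)
    finally show ?thesis by (auto simp: dist_norm norm_minus_commute)
  qed
  have nn: "0 \<le> \<phi> x" for x by (auto simp: \<phi>_def flat_exp_def)
  have z: "\<phi> x = 0" if "x \<notin> ball a r" for x using pos[of x] nn[of x] that by linarith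
  have "closure {x. \<phi> x \<noteq> 0} \<subseteq> cball a r" using z ball_subset_cball by (intro closure_minimal) blast+
  then have "compact (closure {x. \<phi> x \<noteq> 0})"
    by (metis closed_closure compact_Int_closed compact_cball inf.absorb_iff2)
  then have T: "\<phi> \<in> test_functions" by (simp add: test_functions_def \<phi>_def Ck_flat_exp)
  have "0 \<noteq> (\<integral>x. \<phi> x \<partial>lborel)"
  proof
    assume "0 = (\<integral>x. \<phi> x \<partial>lborel)"
    then have "AE x in lborel. \<phi> x = 0"
      using integral_nonneg_eq_0_iff_AE[OF test_functions_integrable[OF T]] nn by simp
    then have "AE x in lborel. x \<notin> ball a r"
      by eventually_elim (metis pos less_irrefl)
    then have "ball a r \<in> null_sets lborel" 
      by (subst (asm) AE_iff_null_sets[symmetric]) auto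
    then have "negligible (ball a r)" by (simp add: negligible_iff_null_sets null_sets_completionI)
    then show False using assms negligible_iff_emeasure0 open_not_negligible[of "ball a r"] by auto
  qed
  moreover have "0 \<le> (\<integral>x. \<phi> x \<partial>lborel)" using nn by simp
  ultimately show ?thesis using that[OF T nn z] by linarith
qed

text \<open>
  If \<open>\<bar>u\<bar>\<close> exceeded \<open>c\<close> at a point, it would do so with a fixed sign and a margin on a small ball, and
  a bump supported there would violate the weak bound. This lemma turns estimates that are obtained
  after testing with \<open>\<phi>\<close> back into estimates of continuous functions.
\<close>

lemma pointwise_bound_of_weak_bound:
  fixes u :: "'a::euclidean_space \<Rightarrow> real"
  assumes u: "continuous_on UNIV u" and N: "\<And>x. \<bar>u x\<bar> \<le> N"
    and weak: "\<And>\<phi>. \<phi> \<in> test_functions \<Longrightarrow> \<bar>\<integral>x. u x * \<phi> x \<partial>lborel\<bar> \<le> c * (\<integral>x. \<bar>\<phi> x\<bar> \<partial>lborel)"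
  shows "\<bar>u a\<bar> \<le> c"
proof (rule ccontr)
  assume "\<not> \<bar>u a\<bar> \<le> c"
  define s where "s = sgn (u a)"
  define e where "e = (\<bar>u a\<bar> - c) / 2"
  have e: "e > 0" using \<open>\<not> \<bar>u a\<bar> \<le> c\<close> by (simp add: e_def)
  have su: "s * u a = \<bar>u a\<bar>" by (simp add: s_def sgn_if)
  have s1: "\<bar>s\<bar> \<le> 1" by (simp add: s_def sgn_if)
  obtain r where r: "r > 0" "\<And>x. dist x a < r \<Longrightarrow> \<bar>u x - u a\<bar> < e"
    using u e unfolding continuous_on_iff by (metis UNIV_I dist_real_def)
  obtain \<phi> :: "'a \<Rightarrow> real" where \<phi>: "\<phi> \<in> test_functions" "\<And>x. 0 \<le> \<phi> x" "\<And>x. x \<notin> ball a r \<Longrightarrow> \<phi> x = 0" "0 < (\<integral>x. \<phi> x \<partial>lborel)"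
    using bump_exists[OF r(1), of a] by metis
  have m: "u \<in> borel_measurable borel" using u borel_measurable_continuous_onI by auto
  have i: "integrable lborel (\<lambda>x. u x * \<phi> x)" by (rule integrable_bounded_mult_test[OF \<phi>(1) m N])
  have le: "(c + e) * \<phi> x \<le> s * (u x * \<phi> x)" for x
  proof (cases "x \<in> ball a r")
    case True
    then have "\<bar>u x - u a\<bar> < e" using r(2)[of x] by (simp add: dist_commute)
    moreover have "\<bar>s * u x - s * u a\<bar> \<le> \<bar>u x - u a\<bar>"
      using s1 mult_left_le_one_le[of "\<bar>u x - u a\<bar>" "\<bar>s\<bar>"] by (simp add: abs_mult flip: right_diff_distrib)
    moreover have "\<bar>u a\<bar> = c + 2 * e" by (simp add: e_def field_simps)
    ultimately have "c + e \<le> s * u x" using su by linarith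
    then show ?thesis using \<phi>(2)[of x] by (simp add: mult_right_mono flip: mult.assoc)
  qed (simp add: \<phi>(3))
  have "(c + e) * (\<integral>x. \<phi> x \<partial>lborel) = (\<integral>x. (c + e) * \<phi> x \<partial>lborel)" by simp
  also have "\<dots> \<le> (\<integral>x. s * (u x * \<phi> x) \<partial>lborel)"
    by (intro integral_mono) (use le i test_functions_integrable[OF \<phi>(1)] in auto)
  also have "\<dots> = s * (\<integral>x. u x * \<phi> x \<partial>lborel)" by simp
  also have "\<dots> \<le> \<bar>\<integral>x. u x * \<phi> x \<partial>lborel\<bar>"
    using s1 mult_left_le_one_le[of "\<bar>\<integral>x. u x * \<phi> x \<partial>lborel\<bar>" "\<bar>s\<bar>"] by (simp add: abs_le_iff abs_mult[symmetric])
  also have "\<dots> \<le> c * (\<integral>x. \<phi> x \<partial>lborel)" using weak[OF \<phi>(1)] \<phi>(2) by simp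
  finally show False using mult_pos_pos[OF e \<phi>(4)] by (simp add: algebra_simps)
qed

lemma lborel_integral_shift:
  fixes f :: "'a::euclidean_space \<Rightarrow> 'b::{banach, second_countable_topology}"
  assumes [measurable]: "f \<in> borel_measurable borel"
  shows "(\<integral>y. f (h + y) \<partial>lborel) = (\<integral>y. f y \<partial>lborel)"
  using integral_distr[of "(+) h" lborel borel f] by (simp add: lborel_distr_plus)

section \<open>Correlation with a test function\<close>

text \<open>
  This is the convolution of \<open>f\<close> with the reflected test function. It is smooth, and its value at \<open>h\<close>
  is the pairing of the translate \<open>f (h + _)\<close> with \<open>\<phi>\<close>: a differential statement about \<open>corr f \<phi>\<close>
  is a weak differential statement about \<open>f\<close>.
\<close>

definition corr :: "('a::euclidean_space \<Rightarrow> real) \<Rightarrow> ('a \<Rightarrow> real) \<Rightarrow> 'a \<Rightarrow> real" where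
  "corr f \<phi> h = (\<integral>y. f y * \<phi> (y - h) \<partial>lborel)"

context
  fixes f :: "'a::euclidean_space \<Rightarrow> real" and N :: real
  assumes f_meas [measurable]: "f \<in> borel_measurable borel" and f_bdd: "\<And>x. \<bar>f x\<bar> \<le> N"
begin

lemma corr_integrable: "\<phi> \<in> test_functions \<Longrightarrow> integrable lborel (\<lambda>y. f y * \<phi> (y - h))"
  using integrable_bounded_mult_test[OF test_functions_translation f_meas f_bdd] .

lemma corr_bound:
  assumes "\<phi> \<in> test_functions"
  shows "\<bar>corr f \<phi> h\<bar> \<le> N * (\<integral>y. \<bar>\<phi> y\<bar> \<partial>lborel)"
proof -
  have "(\<integral>y. \<bar>\<phi> (y - h)\<bar> \<partial>lborel) = (\<integral>y. \<bar>\<phi> y\<bar> \<partial>lborel)"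
    using lborel_integral_shift[of "\<lambda>y. \<bar>\<phi> y\<bar>" "- h"] test_functions_measurable[OF assms] by simp
  with integral_bounded_mult_test_le[OF test_functions_translation[OF assms, of h] f_meas f_bdd]
  show ?thesis by (simp only: corr_def)
qed

text \<open>
  Differentiation under the integral sign. The derivative falls on \<open>\<phi>\<close>, whence the sign. The difference quotients along a convergent sequence of parameters are
  supported in one common ball, which gives the dominating function.
\<close>

lemma corr_DERIV:
  assumes \<phi>: "\<phi> \<in> test_functions"
  shows "((\<lambda>r. corr f \<phi> (x + r *\<^sub>R w)) has_real_derivative - corr f (dirderiv w \<phi>) (x + r *\<^sub>R w)) (at r)"
proof -
  define \<psi> where "\<psi> = dirderiv w \<phi>"
  have \<psi>: "\<psi> \<in> test_functions" unfolding \<psi>_def by (rule test_functions_dirderiv[OF \<phi>])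
  note [measurable] = test_functions_measurable[OF \<phi>] test_functions_measurable[OF \<psi>]
  obtain M R where "M \<ge> 0" "R > 0" and MR: "\<And>x. \<bar>\<phi> x\<bar> \<le> M * indicator (cball 0 R) x"
    using that by (rule test_functions_bounded_support[OF \<phi>])
  have R: "\<phi> x = 0" if "x \<notin> cball 0 R" for x
    using MR[of x] that by simp
  obtain B R' where B: "B \<ge> 0" "R' > 0" and BR: "\<And>x. \<bar>\<psi> x\<bar> \<le> B * indicator (cball 0 R') x"
    using that by (rule test_functions_bounded_support[OF \<psi>])
  have B': "\<bar>\<psi> x\<bar> \<le> B" for x
    using BR[of x] B by (cases "x \<in> cball 0 R'") auto
  have d: "((\<lambda>r. \<phi> (y - (x + r *\<^sub>R w))) has_real_derivative - \<psi> (y - (x + r *\<^sub>R w))) (at r)" for y r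
  proof -
    have "((\<lambda>r. y - (x + r *\<^sub>R w)) has_derivative (\<lambda>s. s *\<^sub>R (- w))) (at r)"
      by (auto intro!: derivative_eq_intros)
    from has_derivative_compose[OF this test_functions_has_derivative[OF \<phi>]]
    have c: "((\<lambda>r. \<phi> (y - (x + r *\<^sub>R w))) has_derivative (\<lambda>s. dirderiv (s *\<^sub>R (- w)) \<phi> (y - (x + r *\<^sub>R w)))) (at r)" .
    have l: "dirderiv (s *\<^sub>R (- w)) \<phi> z = - \<psi> z * s" for s z
    proof -
      interpret linear "\<lambda>v. dirderiv v \<phi> z"
        using has_derivative_linear[OF test_functions_has_derivative[OF \<phi>]] .
      show ?thesis unfolding \<psi>_def scale neg by simp
    qed
    show ?thesis
      unfolding has_field_derivative_def by (rule has_derivative_eq_rhs[OF c]) (auto simp: l fun_eq_iff simp del: scaleR_minus_right)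
  qed
  have lip: "\<bar>\<phi> (y - (x + s *\<^sub>R w)) - \<phi> (y - (x + r *\<^sub>R w))\<bar> \<le> B * \<bar>s - r\<bar>" for y s r
    using field_differentiable_bound[of UNIV "\<lambda>r. \<phi> (y - (x + r *\<^sub>R w))" "\<lambda>r. - \<psi> (y - (x + r *\<^sub>R w))" B s r] d B'
    by (simp add: has_field_derivative_at_within)
  show ?thesis
    unfolding has_field_derivative_iff \<psi>_def[symmetric]
  proof (subst tendsto_at_iff_sequentially, intro allI impI)
    fix X :: "nat \<Rightarrow> real" assume X0: "\<forall>i. X i \<in> UNIV - {r}" and X: "X \<longlonglongrightarrow> r"
    obtain K where K: "\<And>i. \<bar>X i\<bar> \<le> K"
      using convergent_imp_Bseq[OF convergentI[OF X]] by (auto simp: Bseq_def)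
    have Kr: "\<bar>r\<bar> \<le> K" using LIMSEQ_le_const2[OF tendsto_rabs[OF X]] K by blast
    \<comment> \<open>a ball that contains the supports of all translates \<open>\<phi> (_ - (x + X i *\<^sub>R w))\<close>\<close>
    define R1 where "R1 = R + norm x + K * norm w"
    have z: "\<phi> (y - (x + s *\<^sub>R w)) = 0" if "\<bar>s\<bar> \<le> K" "y \<notin> cball 0 R1" for y s
    proof (rule R)
      have "norm (s *\<^sub>R w) \<le> K * norm w" using that by (simp add: mult_right_mono)
      moreover have "norm y \<le> norm (y - (x + s *\<^sub>R w)) + norm x + norm (s *\<^sub>R w)"
        using norm_triangle_ineq[of "y - (x + s *\<^sub>R w)" "x + s *\<^sub>R w"] norm_triangle_ineq[of x "s *\<^sub>R w"] by simp
      ultimately show "y - (x + s *\<^sub>R w) \<notin> cball 0 R" using that by (simp add: R1_def)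
    qed
    let ?q = "\<lambda>i y. f y * ((\<phi> (y - (x + X i *\<^sub>R w)) - \<phi> (y - (x + r *\<^sub>R w))) / (X i - r))"
    have "(\<lambda>i. \<integral>y. ?q i y \<partial>lborel) \<longlonglongrightarrow> (\<integral>y. f y * (- \<psi> (y - (x + r *\<^sub>R w))) \<partial>lborel)"
    proof (rule integral_dominated_convergence[where w="\<lambda>y. (N * B) * indicator (cball 0 R1) y"])
      show "integrable lborel (\<lambda>y. (N * B) * indicator (cball (0::'a) R1) y :: real)"
        by (rule integrable_indicator_cball)
      show "AE y in lborel. (\<lambda>i. ?q i y) \<longlonglongrightarrow> f y * (- \<psi> (y - (x + r *\<^sub>R w)))"
      proof (intro always_eventually allI tendsto_mult_left)
        fix y
        have "((\<lambda>s. (\<phi> (y - (x + s *\<^sub>R w)) - \<phi> (y - (x + r *\<^sub>R w))) / (s - r)) \<longlongrightarrow> - \<psi> (y - (x + r *\<^sub>R w))) (at r)"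
          using d[of y r] unfolding has_field_derivative_iff .
        then show "(\<lambda>i. (\<phi> (y - (x + X i *\<^sub>R w)) - \<phi> (y - (x + r *\<^sub>R w))) / (X i - r)) \<longlonglongrightarrow> - \<psi> (y - (x + r *\<^sub>R w))"
          using X0 X unfolding tendsto_at_iff_sequentially o_def by blast
      qed
      show "AE y in lborel. norm (?q i y) \<le> (N * B) * indicator (cball 0 R1) y" for i
      proof (intro always_eventually allI)
        fix y
        show "norm (?q i y) \<le> (N * B) * indicator (cball 0 R1) y"
        proof (cases "y \<in> cball 0 R1")
          case True
          have "X i - r \<noteq> 0" using X0 by simp
          then have "\<bar>(\<phi> (y - (x + X i *\<^sub>R w)) - \<phi> (y - (x + r *\<^sub>R w))) / (X i - r)\<bar> \<le> B"
            using lip[of y "X i" r] by (simp add: abs_divide divide_le_eq)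
          with f_bdd[of y] have "norm (?q i y) \<le> N * B"
            unfolding real_norm_def abs_mult[of "f y"] by (intro mult_mono) auto
          then show ?thesis using True by simp
        next
          case False
          then show ?thesis using z[OF K[of i]] z[OF Kr] by simp
        qed
      qed
    qed measurable
    moreover have "(\<integral>y. ?q i y \<partial>lborel) = (corr f \<phi> (x + X i *\<^sub>R w) - corr f \<phi> (x + r *\<^sub>R w)) / (X i - r)" for i
    proof -
      have "(\<integral>y. ?q i y \<partial>lborel) =
          (\<integral>y. (f y * \<phi> (y - (x + X i *\<^sub>R w)) - f y * \<phi> (y - (x + r *\<^sub>R w))) / (X i - r) \<partial>lborel)"
        by (simp only: right_diff_distrib times_divide_eq_right)
      also have "\<dots> = (corr f \<phi> (x + X i *\<^sub>R w) - corr f \<phi> (x + r *\<^sub>R w)) / (X i - r)"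
        unfolding corr_def integral_divide_zero
        by (simp only: Bochner_Integration.integral_diff corr_integrable[OF \<phi>])
      finally show ?thesis .
    qed
    ultimately show "((\<lambda>s. (corr f \<phi> (x + s *\<^sub>R w) - corr f \<phi> (x + r *\<^sub>R w)) / (s - r)) \<circ> X) \<longlonglongrightarrow> - corr f \<psi> (x + r *\<^sub>R w)"
      by (simp only: o_def corr_def mult_minus_right Bochner_Integration.integral_minus)
  qed
qed

end

lemma dirderiv_expand:
  assumes "\<phi> \<in> test_functions"
  shows "dirderiv w \<phi> x = (\<Sum>b\<in>Basis. (w \<bullet> b) * dirderiv b \<phi> x)"
proof -
  interpret linear "\<lambda>v. dirderiv v \<phi> x"
    using has_derivative_linear[OF test_functions_has_derivative[OF assms]] .
  have "dirderiv w \<phi> x = dirderiv (\<Sum>b\<in>Basis. (w \<bullet> b) *\<^sub>R b) \<phi> x" by (simp add: euclidean_representation)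
  also have "\<dots> = (\<Sum>b\<in>Basis. (w \<bullet> b) * dirderiv b \<phi> x)" by (simp add: sum scale)
  finally show ?thesis .
qed

lemma grad_inner: "b \<in> Basis \<Longrightarrow> grad \<phi> x \<bullet> b = dirderiv b \<phi> x"
  by (simp add: grad_def dirderiv_def inner_sum_left inner_Basis if_distrib sum.delta cong: if_cong)

section \<open>Weak limits of bounded sequences\<close>

text \<open>
  A substitute for the convex hull of the tail \<open>h n, h (n + 1), \<dots>\<close>: the parallelogram law below needs
  midpoints only.
\<close>

inductive_set tail_hull :: "(nat \<Rightarrow> 'a \<Rightarrow> real) \<Rightarrow> nat \<Rightarrow> ('a \<Rightarrow> real) set" for h n where
  member: "n \<le> m \<Longrightarrow> h m \<in> tail_hull h n"
| midpoint: "u \<in> tail_hull h n \<Longrightarrow> v \<in> tail_hull h n \<Longrightarrow> (\<lambda>x. (u x + v x) / 2) \<in> tail_hull h n"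

lemma tail_hull_antimono: "u \<in> tail_hull h m \<Longrightarrow> n \<le> m \<Longrightarrow> u \<in> tail_hull h n"
  by (induction rule: tail_hull.induct) (auto intro: tail_hull.intros)

lemma tail_hull_measurable:
  assumes "\<And>n. h n \<in> borel_measurable M" "u \<in> tail_hull h n"
  shows "u \<in> borel_measurable M"
  using assms(2) by (induction rule: tail_hull.induct) (auto intro: assms(1))

lemma tail_hull_bounded:
  fixes K :: real
  assumes "\<And>n x. \<bar>h n x\<bar> \<le> K" "u \<in> tail_hull h n"
  shows "\<bar>u x\<bar> \<le> K"
  using assms(2)
proof (induction rule: tail_hull.induct)
  case (midpoint u v)
  then show ?case by (simp add: abs_le_iff)
qed (rule assms(1))

text \<open>
  Weak-star compactness of balls in \<open>L\<^sup>\<infinity>\<close>, for sequences. The idea is to replace weak by strong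
  convergence: with a weight \<open>\<rho>\<close> that makes the measure finite, take in each tail hull
  an element \<open>u n\<close> of almost minimal energy \<open>\<integral> (u n)\<^sup>2 \<rho>\<close>. The minimal energies increase to a limit, so by
  the parallelogram law \<open>u\<close> is a Cauchy sequence in the weighted \<open>L\<^sup>2\<close> and a subsequence converges
  almost everywhere. Elements of late tail hulls have the same asymptotic pairings as \<open>h\<close>, and
  dominated convergence passes both the bound and the pairings to the limit.
\<close>

lemma weak_limit_of_bounded_sequence:
  fixes h :: "nat \<Rightarrow> 'a \<Rightarrow> real" and \<Lambda> :: "('a \<Rightarrow> real) \<Rightarrow> real"
  assumes "sigma_finite_measure M"
    and meas [measurable]: "\<And>n. h n \<in> borel_measurable M"
    and bdd: "\<And>n x. \<bar>h n x\<bar> \<le> K"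
    and T: "\<And>\<phi>. \<phi> \<in> T \<Longrightarrow> integrable M \<phi>"
    and lim: "\<And>\<phi>. \<phi> \<in> T \<Longrightarrow> (\<lambda>n. \<integral>x. h n x * \<phi> x \<partial>M) \<longlonglongrightarrow> \<Lambda> \<phi>"
  shows "\<exists>g. g \<in> borel_measurable M \<and> (\<forall>x. \<bar>g x\<bar> \<le> K) \<and>
    (\<forall>\<phi>\<in>T. (\<integral>x. g x * \<phi> x \<partial>M) = \<Lambda> \<phi>)"
proof -
  have K0: "0 \<le> K" using bdd[of 0 undefined] by linarith
  obtain \<rho> :: "'a \<Rightarrow> real" where \<rho>m[measurable]: "\<rho> \<in> borel_measurable M" and \<rho>pos: "\<And>x. \<rho> x > 0"
    and \<rho>int: "integrable M \<rho>"
    using sigma_finite_measure.obtain_positive_integrable_function[OF assms(1)] by metis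
  define E where "E = (\<lambda>u :: 'a \<Rightarrow> real. \<integral>x. (u x)\<^sup>2 * \<rho> x \<partial>M)"
  have hullm: "u \<in> borel_measurable M" if "u \<in> tail_hull h n" for u n
    using tail_hull_measurable[OF meas that] .
  have hullb: "\<bar>u x\<bar> \<le> K" if "u \<in> tail_hull h n" for u n x
    using tail_hull_bounded[of h, OF bdd that] .
  have int_bdd: "integrable M (\<lambda>x. w x * \<rho> x)" if "w \<in> borel_measurable M" "\<And>x. \<bar>w x\<bar> \<le> C" for w C
  proof (rule Bochner_Integration.integrable_bound)
    show "integrable M (\<lambda>x. C * \<rho> x)" using \<rho>int by auto
    show "(\<lambda>x. w x * \<rho> x) \<in> borel_measurable M" using that(1) by measurable
    show "AE x in M. norm (w x * \<rho> x) \<le> norm (C * \<rho> x)"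
      using that(2) by (auto simp: abs_mult intro!: mult_right_mono order_trans[OF that(2)])
  qed
  have sq_le: "(u x)\<^sup>2 \<le> K\<^sup>2" if "u \<in> tail_hull h n" for u n x
    using hullb[OF that, of x] K0 by (metis abs_le_square_iff abs_of_nonneg)
  have int_sq: "integrable M (\<lambda>x. (u x)\<^sup>2 * \<rho> x)" if "u \<in> tail_hull h n" for u n
    using sq_le[OF that] hullm[OF that] by (intro int_bdd[where C="K\<^sup>2"]) auto
  have E0: "0 \<le> E u" for u unfolding E_def using \<rho>pos by (intro Bochner_Integration.integral_nonneg) (auto simp: less_imp_le)
  define q where "q = (\<lambda>n. INF u\<in>tail_hull h n. E u)"
  have ne: "tail_hull h n \<noteq> {}" for n using tail_hull.member[of n n h] by auto
  have bb: "bdd_below (E ` tail_hull h n)" for n using E0 by (intro bdd_belowI[of _ 0]) auto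
  have q_le: "q n \<le> E u" if "u \<in> tail_hull h n" for n u
    unfolding q_def by (rule cINF_lower[OF bb that])
  have q_mono: "q n \<le> q m" if "n \<le> m" for n m
    unfolding q_def
    by (rule cINF_superset_mono[OF ne bb]) (use tail_hull_antimono[OF _ that] in auto)
  have "q n \<le> K\<^sup>2 * (\<integral>x. \<rho> x \<partial>M)" for n
  proof -
    have "q n \<le> E (h n)" by (rule q_le) (simp add: tail_hull.member)
    also have "\<dots> \<le> (\<integral>x. K\<^sup>2 * \<rho> x \<partial>M)" unfolding E_def
      using \<rho>pos \<rho>int int_sq[OF tail_hull.member] sq_le[OF tail_hull.member[OF order_refl]]
      by (intro integral_mono) (auto intro!: mult_right_mono simp: less_imp_le)
    finally show ?thesis by simp
  qed
  then have "\<exists>Q. q \<longlonglongrightarrow> Q \<and> (\<forall>n. q n \<le> Q)"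
    using q_mono incseq_convergent[of q] by (metis monoI)
  then obtain Q where Q: "q \<longlonglongrightarrow> Q" "\<And>n. q n \<le> Q" by auto
  have "\<exists>u. u \<in> tail_hull h n \<and> E u < q n + 1 / real (Suc n)" for n
  proof -
    have "q n < q n + 1 / real (Suc n)" by simp
    then show ?thesis unfolding q_def using cINF_less_iff[OF ne bb] by blast
  qed
  then obtain u where u: "\<And>n. u n \<in> tail_hull h n" and uE: "\<And>n. E (u n) < q n + 1 / real (Suc n)" by metis
  note [measurable] = hullm[OF u]
  have dist_sq: "E (\<lambda>x. u n x - u m x) \<le> 4 * (Q - q n + 1 / real (Suc n))" if "n \<le> m" for n m
  proof -
    let ?v = "\<lambda>x. (u n x + u m x) / 2"
    have um: "u m \<in> tail_hull h n" using tail_hull_antimono[OF u that] .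
    have v: "?v \<in> tail_hull h n" by (intro tail_hull.midpoint u um)
    have "E (\<lambda>x. u n x - u m x) = (\<integral>x. 2 * ((u n x)\<^sup>2 * \<rho> x) + 2 * ((u m x)\<^sup>2 * \<rho> x) - 4 * ((?v x)\<^sup>2 * \<rho> x) \<partial>M)"
      unfolding E_def by (intro Bochner_Integration.integral_cong) (auto simp: power2_eq_square field_simps)
    also have "\<dots> = 2 * E (u n) + 2 * E (u m) - 4 * E ?v"
      unfolding E_def using int_sq[OF u[of n]] int_sq[OF um] int_sq[OF v]
      by (simp only: Bochner_Integration.integral_add Bochner_Integration.integral_diff
          integral_mult_right_zero integrable_mult_right Bochner_Integration.integrable_add)
    also have "\<dots> \<le> 2 * (Q + 1 / real (Suc n)) + 2 * (Q + 1 / real (Suc n)) - 4 * q n"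
    proof -
      have "1 / real (Suc m) \<le> 1 / real (Suc n)" using that by (simp add: frac_le)
      then have "E (u n) \<le> Q + 1 / real (Suc n)" "E (u m) \<le> Q + 1 / real (Suc n)"
        using uE[of n] uE[of m] Q(2)[of n] Q(2)[of m] by linarith+
      then show ?thesis using q_le[OF v] by (intro diff_mono add_mono mult_left_mono) auto
    qed
    finally show ?thesis by (simp add: algebra_simps)
  qed
  have lim0: "(\<lambda>n. 4 * (Q - q n + 1 / real (Suc n))) \<longlonglongrightarrow> 0"
    using tendsto_mult_left[OF tendsto_add[OF tendsto_diff[OF tendsto_const Q(1)] LIMSEQ_inverse_real_of_nat], of 4 Q]
    by (simp add: inverse_eq_divide)
  have cauchy: "\<exists>N. \<forall>i\<ge>N. \<forall>j\<ge>N. (\<integral>x. norm (u i x * \<rho> x - u j x * \<rho> x) \<partial>M) < e" if e: "e > 0" for e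
  proof -
    define I where "I = (\<integral>x. \<rho> x \<partial>M)"
    have "I \<ge> 0" unfolding I_def using \<rho>pos by (intro Bochner_Integration.integral_nonneg) (auto simp: less_imp_le)
    define \<delta> where "\<delta> = e / (2 * (I + 1))"
    have \<delta>: "\<delta> > 0" using \<open>I \<ge> 0\<close> e by (simp add: \<delta>_def)
    obtain N where N: "\<And>n. n \<ge> N \<Longrightarrow> 4 * (Q - q n + 1 / real (Suc n)) < e * \<delta>"
      using order_tendstoD(2)[OF lim0, of "e * \<delta>"] \<delta> e unfolding eventually_sequentially by (metis mult_pos_pos)
    \<comment> \<open>Young's inequality, with weight \<open>\<delta>\<close>, bounds the \<open>L\<^sup>1\<close> distance by the energy of the difference\<close>
    have *: "(\<integral>x. norm (u i x * \<rho> x - u j x * \<rho> x) \<partial>M) < e" if "N \<le> i" "i \<le> j" for i j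
    proof -
      have uj: "u j \<in> tail_hull h i" using tail_hull_antimono[OF u that(2)] .
      have b1: "\<bar>\<bar>u i x - u j x\<bar>\<bar> \<le> 2 * K" for x
        using hullb[OF u[of i], of x] hullb[OF uj, of x] by simp
      have b2: "\<bar>(u i x - u j x)\<^sup>2\<bar> \<le> (2 * K)\<^sup>2" for x
        using b1[of x] K0 abs_le_square_iff[of "u i x - u j x" "2 * K"] by simp
      have i2: "integrable M (\<lambda>x. (u i x - u j x)\<^sup>2 * \<rho> x)"
        by (rule int_bdd[OF _ b2]) measurable
      have i1: "integrable M (\<lambda>x. \<bar>u i x - u j x\<bar> * \<rho> x)"
        by (rule int_bdd[OF _ b1]) measurable
      have "\<bar>a\<bar> \<le> a\<^sup>2 / (2 * \<delta>) + \<delta> / 2" for a :: real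
        using \<delta> sum_squares_bound[of "\<bar>a\<bar>" \<delta>] by (simp add: field_simps power2_eq_square)
      then have pt: "\<bar>u i x - u j x\<bar> * \<rho> x \<le> (1 / (2 * \<delta>)) * ((u i x - u j x)\<^sup>2 * \<rho> x) + \<delta> / 2 * \<rho> x" for x
        using \<rho>pos[of x] mult_right_mono[of "\<bar>u i x - u j x\<bar>" "(u i x - u j x)\<^sup>2 / (2 * \<delta>) + \<delta> / 2" "\<rho> x"]
        by (simp add: algebra_simps)
      have "(\<integral>x. norm (u i x * \<rho> x - u j x * \<rho> x) \<partial>M) = (\<integral>x. \<bar>u i x - u j x\<bar> * \<rho> x \<partial>M)"
        using \<rho>pos by (intro Bochner_Integration.integral_cong) (auto simp: abs_mult less_imp_le simp flip: left_diff_distrib)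
      also have "\<dots> \<le> (\<integral>x. (1 / (2 * \<delta>)) * ((u i x - u j x)\<^sup>2 * \<rho> x) + \<delta> / 2 * \<rho> x \<partial>M)"
        using i1 i2 \<rho>int pt by (intro integral_mono) auto
      also have "\<dots> = (1 / (2 * \<delta>)) * E (\<lambda>x. u i x - u j x) + \<delta> / 2 * I"
        unfolding E_def I_def using i2 \<rho>int by simp
      also have "\<dots> < e"
      proof -
        have "E (\<lambda>x. u i x - u j x) < e * \<delta>"
          using dist_sq[OF that(2)] N[OF that(1)] by (rule le_less_trans)
        then have "(1 / (2 * \<delta>)) * E (\<lambda>x. u i x - u j x) < e / 2"
          using \<delta> by (simp add: field_simps)
        moreover have "\<delta> / 2 * I \<le> e / 2"
          using \<open>I \<ge> 0\<close> e by (simp add: \<delta>_def field_simps)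
        ultimately show ?thesis by simp
      qed
      finally show ?thesis .
    qed
    have "(\<integral>x. norm (u i x * \<rho> x - u j x * \<rho> x) \<partial>M) < e" if "N \<le> i" "N \<le> j" for i j
      using *[of i j] *[of j i] that by (cases "i \<le> j") (auto simp: norm_minus_commute abs_minus_commute)
    then show ?thesis by blast
  qed
  have "integrable M (\<lambda>x. u n x * \<rho> x)" for n
    by (rule int_bdd[OF hullm[OF u] hullb[OF u]])
  from cauchy_L1_AE_cauchy_subseq[OF this cauchy]
  obtain r where r: "strict_mono r" "AE x in M. Cauchy (\<lambda>i. u (r i) x * \<rho> x)" by metis
  \<comment> \<open>the value \<open>0\<close> off the set of convergence keeps the bound valid everywhere\<close>
  define g where "g = (\<lambda>x. if Cauchy (\<lambda>i. u (r i) x) then lim (\<lambda>i. u (r i) x) else 0)"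
  have ae: "AE x in M. (\<lambda>i. u (r i) x) \<longlonglongrightarrow> g x"
    using r(2)
  proof eventually_elim
    case (elim x)
    then obtain l where "(\<lambda>i. u (r i) x * \<rho> x) \<longlonglongrightarrow> l"
      unfolding Cauchy_convergent_iff convergent_def by blast
    from tendsto_divide[OF this tendsto_const, of "\<rho> x"] have "convergent (\<lambda>i. u (r i) x)"
      using \<rho>pos[of x] by (auto simp: convergent_def)
    then show ?case by (simp add: g_def convergent_LIMSEQ_iff Cauchy_convergent_iff)
  qed
  have gm: "g \<in> borel_measurable M" unfolding g_def by measurable
  have gb: "\<bar>g x\<bar> \<le> K" for x
  proof (cases "Cauchy (\<lambda>i. u (r i) x)")
    case True
    then have "(\<lambda>i. u (r i) x) \<longlonglongrightarrow> g x" by (simp add: g_def convergent_LIMSEQ_iff Cauchy_convergent_iff)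
    from tendsto_rabs[OF this] show ?thesis by (rule LIMSEQ_le_const2) (use hullb[OF u] in blast)
  qed (simp add: g_def K0)
  have "(\<integral>x. g x * \<phi> x \<partial>M) = \<Lambda> \<phi>" if \<phi>: "\<phi> \<in> T" for \<phi>
  proof -
    note [measurable] = borel_measurable_integrable[OF T[OF \<phi>]]
    have int\<phi>: "integrable M (\<lambda>x. w x * \<phi> x)" if "w \<in> tail_hull h n" for w n
    proof (rule Bochner_Integration.integrable_bound)
      show "integrable M (\<lambda>x. K * \<phi> x)" using T[OF \<phi>] by auto
      show "(\<lambda>x. w x * \<phi> x) \<in> borel_measurable M" using hullm[OF that] by measurable
      show "AE x in M. norm (w x * \<phi> x) \<le> norm (K * \<phi> x)"
        using hullb[OF that] by (auto simp: abs_mult intro!: mult_right_mono order_trans[OF hullb[OF that]])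
    qed
    have "(\<lambda>i. \<integral>x. u (r i) x * \<phi> x \<partial>M) \<longlonglongrightarrow> (\<integral>x. g x * \<phi> x \<partial>M)"
    proof (rule integral_dominated_convergence[where w="\<lambda>x. K * \<bar>\<phi> x\<bar>"])
      show "AE x in M. (\<lambda>i. u (r i) x * \<phi> x) \<longlonglongrightarrow> g x * \<phi> x"
        using ae by eventually_elim (intro tendsto_intros)
      show "AE x in M. norm (u (r i) x * \<phi> x) \<le> K * \<bar>\<phi> x\<bar>" for i
        using hullb[OF u] by (auto simp: abs_mult mult_right_mono)
    qed (use T[OF \<phi>] gm in auto)
    moreover have "(\<lambda>n. \<integral>x. u n x * \<phi> x \<partial>M) \<longlonglongrightarrow> \<Lambda> \<phi>"
    proof (rule LIMSEQ_I)
      fix e :: real assume "e > 0"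
      then obtain N where N: "\<And>n. n \<ge> N \<Longrightarrow> \<bar>(\<integral>x. h n x * \<phi> x \<partial>M) - \<Lambda> \<phi>\<bar> < e"
        using LIMSEQ_D[OF lim[OF \<phi>]] by (metis real_norm_def)
      have "\<bar>(\<integral>x. w x * \<phi> x \<partial>M) - \<Lambda> \<phi>\<bar> < e" if "w \<in> tail_hull h N" for w
        using that
      proof (induction rule: tail_hull.induct)
        case (midpoint v w)
        have "(\<integral>x. (v x + w x) / 2 * \<phi> x \<partial>M) = ((\<integral>x. v x * \<phi> x \<partial>M) + (\<integral>x. w x * \<phi> x \<partial>M)) / 2"
          using int\<phi>[OF midpoint(1)] int\<phi>[OF midpoint(2)]
          by (simp add: distrib_right add_divide_distrib)
        then show ?case using midpoint.IH by (simp add: abs_less_iff field_simps)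
      qed (rule N)
      then show "\<exists>no. \<forall>n\<ge>no. norm ((\<integral>x. u n x * \<phi> x \<partial>M) - \<Lambda> \<phi>) < e"
        using tail_hull_antimono[OF u] by (metis real_norm_def)
    qed
    then have "(\<lambda>i. \<integral>x. u (r i) x * \<phi> x \<partial>M) \<longlonglongrightarrow> \<Lambda> \<phi>"
      using LIMSEQ_subseq_LIMSEQ[OF _ r(1)] by (force simp: o_def)
    ultimately show ?thesis by (rule LIMSEQ_unique)
  qed
  with gm gb show ?thesis by blast
qed

section \<open>Brownian motion and the heat semigroup\<close>

lemma lborel_prod_Basis:
  fixes f :: "'a::euclidean_space \<Rightarrow> real \<Rightarrow> real"
  assumes f: "\<And>b. b \<in> Basis \<Longrightarrow> integrable lborel (f b)"
  shows integrable_lborel_prod_Basis: "integrable lborel (\<lambda>x::'a. \<Prod>b\<in>Basis. f b (x \<bullet> b))"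
    and integral_lborel_prod_Basis:
      "(\<integral>x. (\<Prod>b\<in>Basis. f b (x \<bullet> b)) \<partial>(lborel :: 'a measure)) = (\<Prod>b\<in>Basis. \<integral>s. f b s \<partial>lborel)"
proof -
  interpret product_sigma_finite "\<lambda>_ :: 'a. lborel :: real measure" ..
  have [measurable]: "f b \<in> borel_measurable borel" if "b \<in> Basis" for b
    using borel_measurable_integrable[OF f[OF that]] by simp
  have m: "(\<lambda>x. \<Prod>b\<in>Basis. f b (x \<bullet> b)) \<in> borel_measurable borel"
    by measurable
  have T: "(\<lambda>y. \<Sum>b\<in>Basis. y b *\<^sub>R b) \<in> (\<Pi>\<^sub>M b\<in>Basis. lborel) \<rightarrow>\<^sub>M (borel :: 'a measure)"
    by measurable
  have e: "(\<Prod>b\<in>Basis. f b ((\<Sum>c\<in>Basis. y c *\<^sub>R c) \<bullet> b)) = (\<Prod>b\<in>Basis. f b (y b))" for y :: "'a \<Rightarrow> real"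
    by (intro prod.cong) auto
  show "integrable lborel (\<lambda>x::'a. \<Prod>b\<in>Basis. f b (x \<bullet> b))"
    using product_integrable_prod[OF finite_Basis f] by (subst lborel_eq) (simp add: integrable_distr_eq[OF T m] e)
  show "(\<integral>x. (\<Prod>b\<in>Basis. f b (x \<bullet> b)) \<partial>(lborel :: 'a measure)) = (\<Prod>b\<in>Basis. \<integral>s. f b s \<partial>lborel)"
    using product_integral_prod[OF finite_Basis f] by (subst lborel_eq) (simp add: integral_distr[OF T m] e)
qed

locale brownian = prob_space M for M :: "'w measure" +
  fixes W :: "real \<Rightarrow> 'w \<Rightarrow> 'a::euclidean_space"
  assumes bm: "brownian_motion M W"
begin

lemma W_measurable [measurable (raw)]: "t \<ge> 0 \<Longrightarrow> W t \<in> borel_measurable M"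
  using bm by (simp add: brownian_motion_def)

lemma W_0: "AE \<omega> in M. W 0 \<omega> = 0"
  using bm by (simp add: brownian_motion_def)

lemma increment_distributed:
  assumes "0 \<le> s" "s < t"
  shows "distributed M lborel (\<lambda>\<omega>. W t \<omega> - W s \<omega>)
    (\<lambda>x. ennreal (\<Prod>b\<in>Basis. normal_density 0 (sqrt (t - s)) (x \<bullet> b)))"
proof -
  have "\<forall>s t. 0 \<le> s \<and> s < t \<longrightarrow> distributed M lborel (\<lambda>\<omega>. W t \<omega> - W s \<omega>)
    (\<lambda>x. ennreal (\<Prod>b\<in>Basis. normal_density 0 (sqrt (t - s)) (x \<bullet> b)))"
    using bm unfolding brownian_motion_def by (elim conjE)
  from this[rule_format, of s t] show ?thesis using assms by simp
qed

lemma increment_distr: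
  assumes "0 \<le> s" "0 \<le> t" shows "distr M borel (\<lambda>\<omega>. W (s + t) \<omega> - W s \<omega>) = distr M borel (W t)"
proof -
  have 1: "distr M borel (W t) = distr M borel (\<lambda>\<omega>. W t \<omega> - W 0 \<omega>)"
    using W_0 assms by (intro distr_cong_AE) auto
  have d: "distr M borel (\<lambda>\<omega>. W t' \<omega> - W s' \<omega>) =
      density lborel (\<lambda>x. ennreal (\<Prod>b\<in>Basis. normal_density 0 (sqrt (t' - s')) (x \<bullet> b)))"
    if "0 \<le> s'" "s' < t'" for s' t'
    using distributed_distr_eq_density[OF increment_distributed[OF that]] by (metis distr_cong sets_lborel)
  have "distr M borel (W 0) = distr M borel (\<lambda>_. 0)"
    using W_0 by (intro distr_cong_AE) auto
  then show ?thesis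
  proof (cases "t = 0")
    case False
    then show ?thesis using 1 d[of s "s + t"] d[of 0 t] assms by simp
  qed simp
qed

text \<open>
  The coordinates of \<open>W t\<close> are independent: products of functions of the single coordinates integrate
  to products. With \<open>m b = 1\<close> for most \<open>b\<close> this yields all the moments that are needed.
\<close>

lemma gaussian_moments:
  fixes m :: "'a \<Rightarrow> real \<Rightarrow> real"
  assumes t: "t > 0" and int: "\<And>b. b \<in> Basis \<Longrightarrow> integrable lborel (\<lambda>s. normal_density 0 (sqrt t) s * m b s)"
    and m [measurable]: "\<And>b. m b \<in> borel_measurable borel"
  shows "integrable M (\<lambda>\<omega>. \<Prod>b\<in>Basis. m b (W t \<omega> \<bullet> b))"
    and "(\<integral>\<omega>. (\<Prod>b\<in>Basis. m b (W t \<omega> \<bullet> b)) \<partial>M) = (\<Prod>b\<in>Basis. \<integral>s. normal_density 0 (sqrt t) s * m b s \<partial>lborel)"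
proof -
  let ?d = "\<lambda>x::'a. \<Prod>b\<in>Basis. normal_density 0 (sqrt t) (x \<bullet> b)"
  have D: "distributed M lborel (\<lambda>\<omega>. W t \<omega> - W 0 \<omega>) (\<lambda>x. ennreal (?d x))"
    using increment_distributed[of 0 t] t by simp
  have W[measurable]: "W t \<in> borel_measurable M" "W 0 \<in> borel_measurable M" using t by auto
  have nn: "0 \<le> ?d x" for x by (intro prod_nonneg) auto
  let ?g = "\<lambda>x::'a. \<Prod>b\<in>Basis. m b (x \<bullet> b)"
  have g: "?g \<in> borel_measurable borel" by measurable
  have ae: "AE \<omega> in M. ?g (W t \<omega> - W 0 \<omega>) = ?g (W t \<omega>)"
    using W_0 by eventually_elim simp
  have "integrable lborel (\<lambda>x. ?d x * ?g x)"
    using integrable_lborel_prod_Basis[OF int] by (simp add: prod.distrib)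
  then have "integrable M (\<lambda>\<omega>. ?g (W t \<omega> - W 0 \<omega>))"
    using distributed_integrable[OF D, of ?g] nn g by simp
  moreover have gW: "(\<lambda>\<omega>. ?g (W t \<omega>)) \<in> borel_measurable M" "(\<lambda>\<omega>. ?g (W t \<omega> - W 0 \<omega>)) \<in> borel_measurable M" by measurable
  ultimately show "integrable M (\<lambda>\<omega>. ?g (W t \<omega>))"
    using integrable_cong_AE[OF gW(2) gW(1) ae] by simp
  have "(\<integral>\<omega>. ?g (W t \<omega>) \<partial>M) = (\<integral>\<omega>. ?g (W t \<omega> - W 0 \<omega>) \<partial>M)"
    by (rule integral_cong_AE[OF gW(1) gW(2)]) (use ae in auto)
  also have "\<dots> = (\<integral>x. ?d x * ?g x \<partial>lborel)"
    using distributed_integral[OF D, of ?g] nn g by simp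
  also have "\<dots> = (\<Prod>b\<in>Basis. \<integral>s. normal_density 0 (sqrt t) s * m b s \<partial>lborel)"
    using integral_lborel_prod_Basis[OF int] by (simp add: prod.distrib)
  finally show "(\<integral>\<omega>. ?g (W t \<omega>) \<partial>M) = (\<Prod>b\<in>Basis. \<integral>s. normal_density 0 (sqrt t) s * m b s \<partial>lborel)" .
qed

lemma single_coordinate_moment:
  fixes p :: "real \<Rightarrow> real"
  assumes t: "t > 0" and b: "b \<in> Basis" and p: "p \<in> borel_measurable borel"
    and int: "has_bochner_integral lborel (\<lambda>s. normal_density 0 (sqrt t) s * p s) v"
  shows "has_bochner_integral M (\<lambda>\<omega>. p (W t \<omega> \<bullet> b)) v"
proof -
  let ?m = "\<lambda>c s. if c = b then p s else 1"
  have e: "(\<Prod>c\<in>Basis. ?m c (x \<bullet> c)) = p (x \<bullet> b)" for x :: 'a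
    using b prod.delta[of Basis b "\<lambda>c. p (x \<bullet> c)"] by (simp add: if_distrib cong: if_cong)
  have i: "integrable lborel (\<lambda>s. normal_density 0 (sqrt t) s * ?m c s)" for c
    using int t by (cases "c = b") (auto simp: integrable.intros integrable_normal_density)
  have v: "(\<integral>s. normal_density 0 (sqrt t) s * ?m c s \<partial>lborel) = (if c = b then v else 1)" for c
    using int t by (auto simp: has_bochner_integral_integral_eq integral_normal_density)
  have "\<And>c. ?m c \<in> borel_measurable borel" using p by auto
  note G = gaussian_moments[where m="?m", OF t i this]
  show ?thesis using G b unfolding e v by (simp add: has_bochner_integral_iff prod.delta)
qed

lemma mixed_second_moment:
  assumes t: "t > 0" and b: "b \<in> Basis" "c \<in> Basis" "b \<noteq> c"
  shows "has_bochner_integral M (\<lambda>\<omega>. (W t \<omega> \<bullet> b) * (W t \<omega> \<bullet> c)) 0"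
proof -
  let ?m = "\<lambda>a s::real. if a = b \<or> a = c then s else 1"
  have e: "(\<Prod>a\<in>Basis. ?m a (x \<bullet> a)) = (x \<bullet> b) * (x \<bullet> c)" for x :: 'a
  proof -
    have "(\<Prod>a\<in>Basis. ?m a (x \<bullet> a)) = (\<Prod>a\<in>{b, c}. ?m a (x \<bullet> a))"
      using b by (intro prod.mono_neutral_right) auto
    then show ?thesis using b by simp
  qed
  have i: "integrable lborel (\<lambda>s. normal_density 0 (sqrt t) s * ?m a s)" for a
    using t by (cases "a = b \<or> a = c") (auto simp: integrable_normal_moment_nz_1 integrable_normal_density)
  have "(\<integral>s. normal_density 0 (sqrt t) s * ?m b s \<partial>lborel) = 0"
    using t integral_normal_moment_nz_1[of "sqrt t" 0] by simp
  then have z: "(\<Prod>a\<in>Basis. \<integral>s. normal_density 0 (sqrt t) s * ?m a s \<partial>lborel) = 0"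
    using b(1) by (intro prod_zero bexI[of _ b] finite_Basis)
  have "\<And>a. ?m a \<in> borel_measurable borel" by auto
  note G = gaussian_moments[where m="?m", OF t i this]
  show ?thesis using G unfolding e z by (simp add: has_bochner_integral_iff)
qed

lemma second_moment:
  assumes t: "t > 0" and b: "b \<in> Basis" "c \<in> Basis"
  shows "has_bochner_integral M (\<lambda>\<omega>. (W t \<omega> \<bullet> b) * (W t \<omega> \<bullet> c)) (if b = c then t else 0)"
proof (cases "b = c")
  case True
  have "has_bochner_integral lborel (\<lambda>s. normal_density 0 (sqrt t) s * s\<^sup>2) t"
    using normal_moment_even[of "sqrt t" 0 1] t by simp
  then have "has_bochner_integral M (\<lambda>\<omega>. (W t \<omega> \<bullet> b)\<^sup>2) t"
    by (intro single_coordinate_moment t b) auto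
  then show ?thesis using True by (simp add: power2_eq_square)
qed (simp add: mixed_second_moment assms)

lemma first_moment:
  assumes t: "t > 0" and b: "b \<in> Basis"
  shows "has_bochner_integral M (\<lambda>\<omega>. W t \<omega> \<bullet> b) 0"
  using normal_moment_nz_1[of "sqrt t" 0] t by (intro single_coordinate_moment t b) auto

lemma abs_third_moment:
  assumes t: "t > 0" and b: "b \<in> Basis"
  shows "has_bochner_integral M (\<lambda>\<omega>. \<bar>W t \<omega> \<bullet> b\<bar> ^ 3) (2 * sqrt (2 / pi) * sqrt t ^ 3)"
proof -
  have "has_bochner_integral lborel (\<lambda>s. normal_density 0 (sqrt t) s * \<bar>s\<bar> ^ 3) (2 * sqrt (2 / pi) * sqrt t ^ 3)"
    using normal_moment_abs_odd[of "sqrt t" 0 1] t by (simp add: mult_ac numeral_3_eq_3)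
  then show ?thesis by (intro single_coordinate_moment t b) auto
qed

definition heat :: "real \<Rightarrow> ('a \<Rightarrow> real) \<Rightarrow> 'a \<Rightarrow> real" where
  "heat t f x = (\<integral>\<omega>. f (x + W t \<omega>) \<partial>M)"

lemma heat_integrable:
  fixes N :: real
  assumes "t \<ge> 0" "f \<in> borel_measurable borel" "\<And>x. \<bar>f x\<bar> \<le> N"
  shows "integrable M (\<lambda>\<omega>. f (x + W t \<omega>))"
proof (rule integrable_const_bound[of _ N])
  show "AE \<omega> in M. norm (f (x + W t \<omega>)) \<le> N" using assms(3) by auto
  show "(\<lambda>\<omega>. f (x + W t \<omega>)) \<in> borel_measurable M"
    using W_measurable[OF assms(1)] assms(2) by measurable
qed

lemma heat_0: assumes [measurable]: "f \<in> borel_measurable borel" shows "heat 0 f x = f x"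
proof -
  have [measurable]: "W 0 \<in> borel_measurable M" by simp
  have "heat 0 f x = (\<integral>\<omega>. f x \<partial>M)"
    unfolding heat_def
    by (rule integral_cong_AE) (use W_0 in \<open>measurable, auto\<close>)
  then show ?thesis by (simp add: prob_space)
qed

text \<open>
  Independence of \<open>W s\<close> and \<open>W (s + t) - W s\<close>, together with the stationarity of the increments,
  turns the expectation at time \<open>s + t\<close> into an iterated integral.
\<close>

lemma heat_semigroup:
  fixes N :: real
  assumes st: "0 \<le> s" "0 \<le> t" and f [measurable]: "f \<in> borel_measurable borel" and N: "\<And>x. \<bar>f x\<bar> \<le> N"
  shows "heat (s + t) f x = heat s (heat t f) x"
proof -
  have [measurable]: "W 0 \<in> borel_measurable M" "W s \<in> borel_measurable M" "W t \<in> borel_measurable M" "W (s + t) \<in> borel_measurable M"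
    using st by auto
  let ?X = "\<lambda>\<omega>. W s \<omega> - W 0 \<omega>" and ?Y = "\<lambda>\<omega>. W (s + t) \<omega> - W s \<omega>"
  define \<tau> where "\<tau> = (\<lambda>i::nat. if i = 0 then 0 else if i = 1 then s else s + t)"
  have "indep_vars (\<lambda>_. borel) (\<lambda>i \<omega>. W (\<tau> (Suc i)) \<omega> - W (\<tau> i) \<omega>) {..<2}"
  proof -
    have "0 \<le> \<tau> 0 \<and> (\<forall>i<2. \<tau> i \<le> \<tau> (Suc i))" using st by (auto simp: \<tau>_def)
    then show ?thesis using bm unfolding brownian_motion_def by blast
  qed
  from indep_var_restrict[OF this, of "{0}" "{1}"]
  have "indep_var (\<Pi>\<^sub>M i\<in>{0}. borel) (\<lambda>\<omega>. \<lambda>i\<in>{0}. W (\<tau> (Suc i)) \<omega> - W (\<tau> i) \<omega>)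
      (\<Pi>\<^sub>M i\<in>{1}. borel) (\<lambda>\<omega>. \<lambda>i\<in>{1}. W (\<tau> (Suc i)) \<omega> - W (\<tau> i) \<omega>)" by simp
  from indep_var_compose[OF this, of "\<lambda>g. g 0" borel "\<lambda>g. g 1" borel]
  have ind: "indep_var borel ?X borel ?Y"
    by (simp add: o_def \<tau>_def numeral_2_eq_2)
  have dX: "distr M borel ?X = distr M borel (W s)"
    using increment_distr[of 0 s] st by simp
  have dY: "distr M borel ?Y = distr M borel (W t)"
    using increment_distr[of s t] st by simp
  interpret X: prob_space "distr M borel (W s)" by (rule prob_space_distr) measurable
  interpret Y: prob_space "distr M borel (W t)" by (rule prob_space_distr) measurable
  interpret XY: pair_prob_space "distr M borel (W s)" "distr M borel (W t)" ..
  have joint: "distr M borel (W s) \<Otimes>\<^sub>M distr M borel (W t) = distr M (borel \<Otimes>\<^sub>M borel) (\<lambda>\<omega>. (?X \<omega>, ?Y \<omega>))"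
    using ind unfolding indep_var_distribution_eq dX dY by simp
  let ?h = "\<lambda>z. f (x + fst z + snd z)"
  have hm [measurable]: "?h \<in> borel_measurable (borel \<Otimes>\<^sub>M borel)" by measurable
  have "heat (s + t) f x = (\<integral>\<omega>. ?h (?X \<omega>, ?Y \<omega>) \<partial>M)"
    unfolding heat_def
    by (rule integral_cong_AE) (use W_0 in \<open>measurable, auto\<close>)
  also have "\<dots> = integral\<^sup>L (distr M (borel \<Otimes>\<^sub>M borel) (\<lambda>\<omega>. (?X \<omega>, ?Y \<omega>))) ?h"
    by (rule integral_distr[symmetric]) measurable
  also have "\<dots> = integral\<^sup>L (distr M borel (W s) \<Otimes>\<^sub>M distr M borel (W t)) ?h"
    by (simp add: joint)
  also have "\<dots> = (\<integral>u. (\<integral>v. f (x + u + v) \<partial>distr M borel (W t)) \<partial>distr M borel (W s))"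
  proof (subst XY.integral_fst'[symmetric])
    show "integrable (distr M borel (W s) \<Otimes>\<^sub>M distr M borel (W t)) ?h"
      by (rule XY.P.integrable_const_bound[of _ N]) (use N in \<open>auto simp: measurable_cong_sets[OF sets_pair_measure_cong[OF sets_distr sets_distr] refl]\<close>)
  qed simp
  also have "\<dots> = (\<integral>\<omega>. (\<integral>v. f (x + W s \<omega> + v) \<partial>distr M borel (W t)) \<partial>M)"
    by (rule integral_distr) measurable
  also have "\<dots> = heat s (heat t f) x"
    unfolding heat_def by (subst integral_distr) auto
  finally show ?thesis .
qed

end

section \<open>The generator estimate\<close>

lemma corr_eq_shift:
  fixes f :: "'a::euclidean_space \<Rightarrow> real"
  assumes [measurable]: "f \<in> borel_measurable borel" and \<phi>: "\<phi> \<in> test_functions"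
  shows "corr f \<phi> h = (\<integral>z. f (h + z) * \<phi> z \<partial>lborel)"
  using lborel_integral_shift[of "\<lambda>y. f y * \<phi> (y - h)" h] test_functions_measurable[OF \<phi>]
  by (simp add: corr_def)

lemma corr_measurable:
  fixes f :: "'a::euclidean_space \<Rightarrow> real"
  assumes [measurable]: "f \<in> borel_measurable borel" and \<phi>: "\<phi> \<in> test_functions"
  shows "corr f \<phi> \<in> borel_measurable borel"
proof -
  note [measurable] = test_functions_measurable[OF \<phi>]
  show ?thesis unfolding corr_def by measurable
qed

lemma corr_DERIV_sum:
  fixes f :: "'a::euclidean_space \<Rightarrow> real"
  assumes f: "f \<in> borel_measurable borel" "\<And>x. \<bar>f x\<bar> \<le> N" and \<phi>: "\<phi> \<in> test_functions"
  shows "((\<lambda>r. corr f \<phi> (x + r *\<^sub>R w)) has_real_derivative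
    - (\<Sum>b\<in>Basis. (w \<bullet> b) * corr f (dirderiv b \<phi>) (x + r *\<^sub>R w))) (at r)"
proof -
  have "corr f (dirderiv w \<phi>) h = (\<Sum>b\<in>Basis. (w \<bullet> b) * corr f (dirderiv b \<phi>) h)" for h
  proof -
    have "corr f (dirderiv w \<phi>) h = (\<integral>y. (\<Sum>b\<in>Basis. (w \<bullet> b) * (f y * dirderiv b \<phi> (y - h))) \<partial>lborel)"
      unfolding corr_def by (subst dirderiv_expand[OF \<phi>]) (simp add: sum_distrib_left mult_ac)
    also have "\<dots> = (\<Sum>b\<in>Basis. (w \<bullet> b) * corr f (dirderiv b \<phi>) h)"
      using corr_integrable[OF f test_functions_dirderiv[OF \<phi>]]
      by (simp add: corr_def)
    finally show ?thesis .
  qed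
  then show ?thesis using corr_DERIV[OF f \<phi>, of x w r] by simp
qed

text \<open>
  Third order Taylor expansion along the segment from \<open>x\<close> to \<open>x + w\<close>, with a constant independent of
  \<open>x\<close>: the third derivatives of \<open>corr f \<phi>\<close> are correlations with third derivatives of \<open>\<phi>\<close>, hence
  bounded. The remainder is expressed through the coordinates of \<open>w\<close> because their third absolute
  moments are explicit for Gaussian \<open>w\<close>.
\<close>

lemma corr_taylor:
  fixes f :: "'a::euclidean_space \<Rightarrow> real"
  assumes f: "f \<in> borel_measurable borel" "\<And>x. \<bar>f x\<bar> \<le> N" and \<phi>: "\<phi> \<in> test_functions"
  obtains K where "K \<ge> 0" and "\<And>x w. \<bar>corr f \<phi> (x + w) - corr f \<phi> x
      + (\<Sum>b\<in>Basis. (w \<bullet> b) * corr f (dirderiv b \<phi>) x)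
      - (\<Sum>b\<in>Basis. \<Sum>c\<in>Basis. ((w \<bullet> b) * (w \<bullet> c)) * (corr f (dirderiv c (dirderiv b \<phi>)) x / 2))\<bar>
      \<le> K * (\<Sum>b\<in>Basis. \<bar>w \<bullet> b\<bar> ^ 3)"
proof -
  have N0: "N \<ge> 0" using f(2)[of undefined] by linarith
  define J where "J = (\<lambda>b c d. \<integral>y. \<bar>dirderiv d (dirderiv c (dirderiv b \<phi>)) y\<bar> \<partial>lborel)"
  have J0: "J b c d \<ge> 0" for b c d by (simp add: J_def)
  have T: "dirderiv b \<phi> \<in> test_functions" "dirderiv c (dirderiv b \<phi>) \<in> test_functions"
    "dirderiv d (dirderiv c (dirderiv b \<phi>)) \<in> test_functions" for b c d
    by (intro test_functions_dirderiv \<phi>)+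
  define K where "K = N * (\<Sum>b\<in>Basis. \<Sum>c\<in>Basis. \<Sum>d\<in>Basis. J b c d)"
  have K0: "K \<ge> 0" unfolding K_def using N0 J0 by (intro mult_nonneg_nonneg sum_nonneg)
  have "\<bar>corr f \<phi> (x + w) - corr f \<phi> x
      + (\<Sum>b\<in>Basis. (w \<bullet> b) * corr f (dirderiv b \<phi>) x)
      - (\<Sum>b\<in>Basis. \<Sum>c\<in>Basis. ((w \<bullet> b) * (w \<bullet> c)) * (corr f (dirderiv c (dirderiv b \<phi>)) x / 2))\<bar>
      \<le> K * (\<Sum>b\<in>Basis. \<bar>w \<bullet> b\<bar> ^ 3)" for x w
  proof -
    define d0 where "d0 = (\<lambda>r. corr f \<phi> (x + r *\<^sub>R w))"
    define d1 where "d1 = (\<lambda>r. - (\<Sum>b\<in>Basis. (w \<bullet> b) * corr f (dirderiv b \<phi>) (x + r *\<^sub>R w)))"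
    define d2 where "d2 = (\<lambda>r. \<Sum>b\<in>Basis. (w \<bullet> b) * (\<Sum>c\<in>Basis. (w \<bullet> c) * corr f (dirderiv c (dirderiv b \<phi>)) (x + r *\<^sub>R w)))"
    define d3 where "d3 = (\<lambda>r. - (\<Sum>b\<in>Basis. (w \<bullet> b) * (\<Sum>c\<in>Basis. (w \<bullet> c) *
        (\<Sum>d\<in>Basis. (w \<bullet> d) * corr f (dirderiv d (dirderiv c (dirderiv b \<phi>))) (x + r *\<^sub>R w)))))"
    define diff where "diff = (\<lambda>m::nat. if m = 0 then d0 else if m = 1 then d1 else if m = 2 then d2 else d3)"
    have D0: "(d0 has_real_derivative d1 r) (at r)" for r
      unfolding d0_def d1_def by (rule corr_DERIV_sum[OF f \<phi>])
    have D1: "(d1 has_real_derivative d2 r) (at r)" for r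
      unfolding d1_def d2_def
      by (rule derivative_eq_intros corr_DERIV_sum[OF f T(1)] refl)+ (simp add: sum_negf mult.commute)
    have D2: "(d2 has_real_derivative d3 r) (at r)" for r
      unfolding d2_def d3_def
      by (rule derivative_eq_intros corr_DERIV_sum[OF f T(2)] refl)+ (simp add: sum_negf mult.commute)
    have "\<forall>m t. m < 3 \<and> 0 \<le> t \<and> t \<le> 1 \<longrightarrow> DERIV (diff m) t :> diff (Suc m) t"
      using D0 D1 D2 by (auto simp: diff_def numeral_3_eq_3 less_Suc_eq)
    from Maclaurin[OF _ _ _ this, of d0]
    obtain r where r: "d0 1 = (\<Sum>m<3. (diff m 0 / fact m) * 1 ^ m) + diff 3 r / fact 3 * 1 ^ 3"
      by (auto simp: diff_def)
    then have eq: "d0 1 - d0 0 - d1 0 - d2 0 / 2 = d3 r / 6"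
      by (simp add: diff_def numeral_3_eq_3 fact_numeral)
    define Q where "Q = (\<Sum>b\<in>Basis. \<bar>w \<bullet> b\<bar> ^ 3)"
    have Q1: "\<bar>w \<bullet> b\<bar> ^ 3 \<le> Q" if "b \<in> Basis" for b
      unfolding Q_def using that by (intro member_le_sum) auto
    have prod3: "\<bar>w \<bullet> b\<bar> * \<bar>w \<bullet> c\<bar> * \<bar>w \<bullet> d\<bar> \<le> Q" if "b \<in> Basis" "c \<in> Basis" "d \<in> Basis" for b c d
    proof -
      define m where "m = max \<bar>w \<bullet> b\<bar> (max \<bar>w \<bullet> c\<bar> \<bar>w \<bullet> d\<bar>)"
      have "\<bar>w \<bullet> b\<bar> * \<bar>w \<bullet> c\<bar> * \<bar>w \<bullet> d\<bar> \<le> m * m * m"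
        by (intro mult_mono) (auto simp: m_def)
      also have "\<dots> = m ^ 3" by (simp add: power3_eq_cube)
      also have "\<dots> \<le> Q" using Q1 that by (auto simp: m_def max_def)
      finally show ?thesis .
    qed
    have "\<bar>d3 r\<bar> \<le> (\<Sum>b\<in>Basis. \<Sum>c\<in>Basis. \<Sum>d\<in>Basis. Q * (N * J b c d))"
      unfolding d3_def abs_minus_cancel sum_distrib_left
    proof (intro order_trans[OF sum_abs] sum_mono)
      fix b c d :: 'a assume bcd: "b \<in> Basis" "c \<in> Basis" "d \<in> Basis"
      have "\<bar>(w \<bullet> b) * ((w \<bullet> c) * ((w \<bullet> d) * corr f (dirderiv d (dirderiv c (dirderiv b \<phi>))) (x + r *\<^sub>R w)))\<bar>
          = (\<bar>w \<bullet> b\<bar> * \<bar>w \<bullet> c\<bar> * \<bar>w \<bullet> d\<bar>) * \<bar>corr f (dirderiv d (dirderiv c (dirderiv b \<phi>))) (x + r *\<^sub>R w)\<bar>"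
        by (simp add: abs_mult)
      also have "\<dots> \<le> Q * (N * J b c d)"
        unfolding J_def using prod3[OF bcd] corr_bound[OF f T(3)] by (intro mult_mono) (auto intro: order_trans[OF _ prod3[OF bcd]])
      finally show "\<bar>(w \<bullet> b) * ((w \<bullet> c) * ((w \<bullet> d) * corr f (dirderiv d (dirderiv c (dirderiv b \<phi>))) (x + r *\<^sub>R w)))\<bar> \<le> Q * (N * J b c d)" .
    qed
    also have "\<dots> = K * Q"
      by (simp add: K_def sum_distrib_left sum_distrib_right mult_ac)
    finally have d3: "\<bar>d3 r\<bar> \<le> K * Q" .
    have "d1 0 = - (\<Sum>b\<in>Basis. (w \<bullet> b) * corr f (dirderiv b \<phi>) x)" by (simp add: d1_def)
    moreover have "d2 0 / 2 = (\<Sum>b\<in>Basis. \<Sum>c\<in>Basis. ((w \<bullet> b) * (w \<bullet> c)) * (corr f (dirderiv c (dirderiv b \<phi>)) x / 2))"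
      by (simp add: d2_def sum_distrib_left sum_divide_distrib mult_ac)
    moreover have "d0 1 = corr f \<phi> (x + w)" "d0 0 = corr f \<phi> x" by (auto simp: d0_def)
    ultimately have "corr f \<phi> (x + w) - corr f \<phi> x + (\<Sum>b\<in>Basis. (w \<bullet> b) * corr f (dirderiv b \<phi>) x)
      - (\<Sum>b\<in>Basis. \<Sum>c\<in>Basis. ((w \<bullet> b) * (w \<bullet> c)) * (corr f (dirderiv c (dirderiv b \<phi>)) x / 2)) = d3 r / 6"
      using eq by (simp only: diff_minus_eq_add)
    moreover have "\<bar>d3 r / 6\<bar> \<le> K * Q" using d3 by simp
    ultimately show ?thesis unfolding Q_def by (simp only:)
  qed
  with K0 show ?thesis by (rule that)
qed

lemma abs_integral_le_integral:
  fixes f g :: "'b \<Rightarrow> real"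
  assumes f: "integrable M f" and g: "integrable M g" and le: "\<And>x. \<bar>f x\<bar> \<le> g x"
  shows "\<bar>integral\<^sup>L M f\<bar> \<le> integral\<^sup>L M g"
proof -
  have "\<bar>integral\<^sup>L M f\<bar> \<le> (\<integral>x. \<bar>f x\<bar> \<partial>M)" by (rule integral_abs_bound)
  also have "\<dots> \<le> integral\<^sup>L M g" using f g le by (intro integral_mono) auto
  finally show ?thesis .
qed

context brownian
begin

lemma heat_measurable:
  assumes "t \<ge> 0" and [measurable]: "f \<in> borel_measurable borel"
  shows "heat t f \<in> borel_measurable borel"
proof -
  have [measurable]: "W t \<in> borel_measurable M" using assms by simp
  show ?thesis unfolding heat_def by measurable
qed

lemma heat_contraction:
  fixes N N' :: real
  assumes t: "t \<ge> 0" and f: "f \<in> borel_measurable borel" "\<And>x. \<bar>f x\<bar> \<le> N"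
    and g: "g \<in> borel_measurable borel" "\<And>x. \<bar>g x\<bar> \<le> N'" and le: "\<And>z. \<bar>f (x + z) - g (y + z)\<bar> \<le> e"
  shows "\<bar>heat t f x - heat t g y\<bar> \<le> e"
proof -
  have "\<bar>\<integral>\<omega>. f (x + W t \<omega>) - g (y + W t \<omega>) \<partial>M\<bar> \<le> (\<integral>\<omega>. e \<partial>M)"
    by (rule abs_integral_le_integral) (use heat_integrable[OF t f] heat_integrable[OF t g] le in auto)
  then show ?thesis
    unfolding heat_def using heat_integrable[OF t f] heat_integrable[OF t g] by (simp add: prob_space)
qed

lemma heat_bound:
  fixes N :: real
  assumes t: "t \<ge> 0" and f: "f \<in> borel_measurable borel" "\<And>x. \<bar>f x\<bar> \<le> N"
  shows "\<bar>heat t f x\<bar> \<le> N"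
proof -
  have "\<bar>heat t f x - heat t (\<lambda>_. 0) x\<bar> \<le> N"
    by (rule heat_contraction[OF t f, of "\<lambda>_. 0" 0]) (use f in auto)
  then show ?thesis by (simp add: heat_def)
qed

text \<open>
  The heat semigroup commutes with translations, hence with correlations (Fubini).
\<close>

lemma heat_corr:
  fixes N :: real
  assumes t: "t \<ge> 0" and f: "f \<in> borel_measurable borel" "\<And>x. \<bar>f x\<bar> \<le> N" and \<phi>: "\<phi> \<in> test_functions"
  shows "heat t (corr f \<phi>) x = corr (heat t f) \<phi> x"
proof -
  note [measurable] = f(1) test_functions_measurable[OF \<phi>]
  have [measurable]: "W t \<in> borel_measurable M" using t by simp
  interpret P: pair_sigma_finite lborel M ..
  let ?F = "\<lambda>z \<omega>. f (x + W t \<omega> + z) * \<phi> z"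
  have i: "integrable M (\<lambda>\<omega>. ?F z \<omega>)" for z
    using heat_integrable[OF t f, of "x + z"] by (simp add: ac_simps)
  have int: "integrable (lborel \<Otimes>\<^sub>M M) (\<lambda>(z, \<omega>). ?F z \<omega>)"
  proof (rule P.Fubini_integrable)
    show "integrable lborel (\<lambda>z. \<integral>\<omega>. norm (case (z, \<omega>) of (z, \<omega>) \<Rightarrow> ?F z \<omega>) \<partial>M)"
    proof (rule Bochner_Integration.integrable_bound)
      show "integrable lborel (\<lambda>z. N * \<phi> z)" using test_functions_integrable[OF \<phi>] by auto
      have "(\<integral>\<omega>. \<bar>?F z \<omega>\<bar> \<partial>M) \<le> N * \<bar>\<phi> z\<bar>" for z
      proof -
        have "(\<integral>\<omega>. \<bar>?F z \<omega>\<bar> \<partial>M) \<le> (\<integral>\<omega>. N * \<bar>\<phi> z\<bar> \<partial>M)"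
          using i[of z] f(2) by (intro integral_mono) (auto simp: abs_mult mult_right_mono)
        then show ?thesis by (simp add: prob_space)
      qed
      then show "AE z in lborel. norm (\<integral>\<omega>. norm (case (z, \<omega>) of (z, \<omega>) \<Rightarrow> ?F z \<omega>) \<partial>M) \<le> norm (N * \<phi> z)"
        using order_trans[OF abs_ge_zero f(2)] by (auto simp: abs_mult)
    qed measurable
  qed (use i in auto)
  have "heat t (corr f \<phi>) x = (\<integral>\<omega>. (\<integral>z. ?F z \<omega> \<partial>lborel) \<partial>M)"
    unfolding heat_def by (simp add: corr_eq_shift[OF f(1) \<phi>])
  also have "\<dots> = (\<integral>z. (\<integral>\<omega>. ?F z \<omega> \<partial>M) \<partial>lborel)"
    using P.Fubini_integral[OF int] by simp
  also have "\<dots> = (\<integral>z. heat t f (x + z) * \<phi> z \<partial>lborel)"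
    unfolding heat_def by (simp add: ac_simps)
  also have "\<dots> = corr (heat t f) \<phi> x"
    by (simp add: corr_eq_shift[OF heat_measurable[OF t f(1)] \<phi>])
  finally show ?thesis .
qed

text \<open>
  Take expectations in the Taylor expansion with \<open>w = W t\<close>: first and mixed second moments vanish, the
  pure second moments are \<open>t\<close>, and the third absolute moments are of order \<open>t\<close> to the power \<open>3/2\<close>. So the
  generator acts on correlations as half the Laplacian, with an error that is uniform in \<open>x\<close>; this
  uniformity is what permits summation over many small time steps.
\<close>

lemma generator_estimate:
  fixes N :: real
  assumes f: "f \<in> borel_measurable borel" "\<And>x. \<bar>f x\<bar> \<le> N" and \<phi>: "\<phi> \<in> test_functions"
  obtains K where "K \<ge> 0" and "\<And>t x. t > 0 \<Longrightarrow> \<bar>heat t (corr f \<phi>) x - corr f \<phi> x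
      - t / 2 * (\<Sum>b\<in>Basis. corr f (dirderiv b (dirderiv b \<phi>)) x)\<bar> \<le> K * sqrt t ^ 3"
proof -
  obtain K where K: "K \<ge> 0" "\<And>x w. \<bar>corr f \<phi> (x + w) - corr f \<phi> x
      + (\<Sum>b\<in>Basis. (w \<bullet> b) * corr f (dirderiv b \<phi>) x)
      - (\<Sum>b\<in>Basis. \<Sum>c\<in>Basis. ((w \<bullet> b) * (w \<bullet> c)) * (corr f (dirderiv c (dirderiv b \<phi>)) x / 2))\<bar>
      \<le> K * (\<Sum>b\<in>Basis. \<bar>w \<bullet> b\<bar> ^ 3)"
    using that by (rule corr_taylor[OF f \<phi>])
  define C where "C = K * (\<Sum>b\<in>(Basis::'a set). 2 * sqrt (2 / pi))"
  have "\<bar>heat t (corr f \<phi>) x - corr f \<phi> x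
      - t / 2 * (\<Sum>b\<in>Basis. corr f (dirderiv b (dirderiv b \<phi>)) x)\<bar> \<le> C * sqrt t ^ 3" if t: "t > 0" for t x
  proof -
    let ?a = "\<lambda>b. corr f (dirderiv b \<phi>) x" and ?A = "\<lambda>b c. corr f (dirderiv c (dirderiv b \<phi>)) x / 2"
    let ?X = "\<lambda>\<omega>. corr f \<phi> (x + W t \<omega>) - corr f \<phi> x
      + (\<Sum>b\<in>Basis. (W t \<omega> \<bullet> b) * ?a b)
      - (\<Sum>b\<in>Basis. \<Sum>c\<in>Basis. ((W t \<omega> \<bullet> b) * (W t \<omega> \<bullet> c)) * ?A b c)"
    have "integrable M (\<lambda>\<omega>. corr f \<phi> (x + W t \<omega>))"
      by (rule heat_integrable[OF _ corr_measurable[OF f(1) \<phi>] corr_bound[OF f \<phi>]]) (use t in auto)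
    then have h: "has_bochner_integral M (\<lambda>\<omega>. corr f \<phi> (x + W t \<omega>)) (heat t (corr f \<phi>) x)"
      unfolding heat_def by (rule has_bochner_integral_integrable)
    have X: "has_bochner_integral M ?X (heat t (corr f \<phi>) x - corr f \<phi> x + (\<Sum>b\<in>Basis. 0 * ?a b)
        - (\<Sum>b\<in>Basis. \<Sum>c\<in>Basis. (if b = c then t else 0) * ?A b c))"
      using t by (intro has_bochner_integral_diff has_bochner_integral_add has_bochner_integral_sum
          has_bochner_integral_mult_left h first_moment second_moment)
        (auto simp: has_bochner_integral_iff prob_space)
    have Y: "has_bochner_integral M (\<lambda>\<omega>. K * (\<Sum>b\<in>Basis. \<bar>W t \<omega> \<bullet> b\<bar> ^ 3))
        (K * (\<Sum>b\<in>(Basis::'a set). 2 * sqrt (2 / pi) * sqrt t ^ 3))"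
      using t by (intro has_bochner_integral_mult_right has_bochner_integral_sum abs_third_moment)
    have "\<bar>heat t (corr f \<phi>) x - corr f \<phi> x + (\<Sum>b\<in>Basis. 0 * ?a b)
        - (\<Sum>b\<in>Basis. \<Sum>c\<in>Basis. (if b = c then t else 0) * ?A b c)\<bar>
      \<le> K * (\<Sum>b\<in>(Basis::'a set). 2 * sqrt (2 / pi) * sqrt t ^ 3)"
    proof -
      note X' = X[unfolded has_bochner_integral_iff] and Y' = Y[unfolded has_bochner_integral_iff]
      show ?thesis
        using abs_integral_le_integral[OF conjunct1[OF X'] conjunct1[OF Y'] K(2)]
        unfolding conjunct2[OF X'] conjunct2[OF Y'] .
    qed
    also have "\<dots> = C * sqrt t ^ 3" by (simp add: C_def)
    finally have le: "\<bar>heat t (corr f \<phi>) x - corr f \<phi> x + (\<Sum>b\<in>Basis. 0 * ?a b)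
        - (\<Sum>b\<in>Basis. \<Sum>c\<in>Basis. (if b = c then t else 0) * ?A b c)\<bar> \<le> C * sqrt t ^ 3" .
    have "(\<Sum>c\<in>Basis. (if b = c then t else 0) * ?A b c) = t * ?A b b" if "b \<in> Basis" for b
    proof -
      have "(\<Sum>c\<in>Basis. (if b = c then t else 0) * ?A b c) = (\<Sum>c\<in>Basis. if b = c then t * ?A b c else 0)"
        by (intro sum.cong) auto
      then show ?thesis using that by simp
    qed
    then have "(\<Sum>b\<in>Basis. \<Sum>c\<in>Basis. (if b = c then t else 0) * ?A b c) = (\<Sum>b\<in>Basis. t * ?A b b)"
      by (intro sum.cong[OF refl])
    also have "\<dots> = t / 2 * (\<Sum>b\<in>Basis. corr f (dirderiv b (dirderiv b \<phi>)) x)"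
      by (simp add: sum_distrib_left)
    finally have "(\<Sum>b\<in>Basis. \<Sum>c\<in>Basis. (if b = c then t else 0) * ?A b c) =
        t / 2 * (\<Sum>b\<in>Basis. corr f (dirderiv b (dirderiv b \<phi>)) x)" .
    with le show ?thesis by simp
  qed
  moreover have "C \<ge> 0" unfolding C_def using K(1) by (intro mult_nonneg_nonneg sum_nonneg) auto
  ultimately show ?thesis using that by blast
qed

text \<open>
  Split \<open>[0, t]\<close> into \<open>n\<close> steps. Each moves the function by at most \<open>t / (2 n) * A\<close> plus an error of
  order \<open>n\<close> to the power \<open>-3/2\<close>; contractivity lets the displacements add up, and the total error
  vanishes as \<open>n\<close> grows. This replaces integrating the heat equation in time.
\<close>

lemma heat_displacement_of_laplacian_bound:
  fixes N A :: real
  assumes f: "f \<in> borel_measurable borel" "\<And>x. \<bar>f x\<bar> \<le> N" and \<phi>: "\<phi> \<in> test_functions"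
    and A: "\<And>h. \<bar>\<Sum>b\<in>Basis. corr f (dirderiv b (dirderiv b \<phi>)) h\<bar> \<le> A" and t: "t > 0"
  shows "\<bar>heat t (corr f \<phi>) x - corr f \<phi> x\<bar> \<le> t / 2 * A"
proof -
  let ?u = "corr f \<phi>"
  obtain K where K: "K \<ge> 0" "\<And>t x. t > 0 \<Longrightarrow> \<bar>heat t ?u x - ?u x
      - t / 2 * (\<Sum>b\<in>Basis. corr f (dirderiv b (dirderiv b \<phi>)) x)\<bar> \<le> K * sqrt t ^ 3"
    using that by (rule generator_estimate[OF f \<phi>])
  note um = corr_measurable[OF f(1) \<phi>] and ub = corr_bound[OF f \<phi>]
  have step: "\<bar>heat h ?u x - ?u x\<bar> \<le> h / 2 * A + K * sqrt h ^ 3" if "h > 0" for h x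
  proof -
    have "\<bar>h / 2 * (\<Sum>b\<in>Basis. corr f (dirderiv b (dirderiv b \<phi>)) x)\<bar> \<le> h / 2 * A"
      using A[of x] that by (simp add: abs_mult)
    then show ?thesis using K(2)[OF that, of x] by linarith
  qed
  have iter: "\<bar>heat (real k * h) ?u x - ?u x\<bar> \<le> real k * (h / 2 * A + K * sqrt h ^ 3)" if h: "h > 0" for h k x
  proof (induction k)
    case 0
    show ?case using heat_0[OF um] by simp
  next
    case (Suc k)
    have "heat (real (Suc k) * h) ?u x = heat (real k * h) (heat h ?u) x"
      using heat_semigroup[OF _ _ um ub, of "real k * h" h x] h by (simp add: distrib_right add.commute)
    moreover have "\<bar>heat (real k * h) (heat h ?u) x - heat (real k * h) ?u x\<bar> \<le> h / 2 * A + K * sqrt h ^ 3"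
      by (rule heat_contraction[OF _ heat_measurable[OF _ um] heat_bound[OF _ um ub] um ub]) (use h step in auto)
    moreover have "real (Suc k) * (h / 2 * A + K * sqrt h ^ 3) = real k * (h / 2 * A + K * sqrt h ^ 3) + (h / 2 * A + K * sqrt h ^ 3)"
      by (simp add: distrib_right)
    ultimately show ?case using Suc.IH by linarith
  qed
  have "\<bar>heat t ?u x - ?u x\<bar> \<le> t / 2 * A + K * t * sqrt (t / real (Suc n))" for n
  proof -
    define a where "a = t / real (Suc n)"
    have a: "a > 0" "real (Suc n) * a = t" using t by (auto simp: a_def)
    have "real (Suc n) * (a / 2 * A + K * sqrt a ^ 3) = (real (Suc n) * a) / 2 * A + K * (real (Suc n) * a) * sqrt a"
      using a(1) by (simp add: power3_eq_cube distrib_left mult_ac)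
    then show ?thesis using iter[OF a(1), of "Suc n" x] unfolding a(2) by (simp add: a_def)
  qed
  moreover have "(\<lambda>n. t / 2 * A + K * t * sqrt (t / real (Suc n))) \<longlonglongrightarrow> t / 2 * A + K * t * sqrt 0"
    by (intro tendsto_intros LIMSEQ_Suc lim_const_over_n)
  ultimately show ?thesis using LIMSEQ_le_const[of _ "t / 2 * A" "\<bar>heat t ?u x - ?u x\<bar>"] by auto
qed

end

section \<open>The Lipschitz set of the heat semigroup as a Sobolev space\<close>

lemma C0_continuous: "f \<in> C0 \<Longrightarrow> continuous_on UNIV f"
  by (simp add: C0_def)

lemma C0_measurable: "f \<in> C0 \<Longrightarrow> f \<in> borel_measurable borel"
  using C0_continuous borel_measurable_continuous_onI by auto

lemma C0_eventually_small:
  assumes "f \<in> C0" "e > 0" obtains B where "\<And>x. norm x \<ge> B \<Longrightarrow> \<bar>f x\<bar> < e"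
proof -
  have "eventually (\<lambda>x. \<bar>f x\<bar> < e) at_infinity"
    using assms tendstoD[of f 0 at_infinity e] by (auto simp: C0_def)
  then show ?thesis using that unfolding eventually_at_infinity by blast
qed

lemma C0_bounded:
  assumes "f \<in> C0" obtains N where "\<And>x. \<bar>f x\<bar> \<le> N"
proof -
  obtain B where B: "\<And>x. norm x \<ge> B \<Longrightarrow> \<bar>f x\<bar> < 1" using C0_eventually_small[OF assms, of 1] by auto
  have "compact (f ` cball 0 B)"
    by (intro compact_continuous_image continuous_on_subset[OF C0_continuous[OF assms]]) auto
  then obtain a where a: "\<And>x. x \<in> cball 0 B \<Longrightarrow> \<bar>f x\<bar> \<le> a"
    by (metis bounded_iff compact_imp_bounded imageI real_norm_def)
  have "\<bar>f x\<bar> \<le> max a 1" for x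
    using B[of x] a[of x] by (cases "norm x \<le> B") auto
  then show ?thesis by (rule that)
qed

lemma C0_uniformly_continuous:
  assumes f: "f \<in> C0" shows "uniformly_continuous_on UNIV f"
  unfolding uniformly_continuous_on_def
proof (intro allI impI)
  fix e :: real assume e: "e > 0"
  obtain B where B: "\<And>x. norm x \<ge> B \<Longrightarrow> \<bar>f x\<bar> < e / 2" using C0_eventually_small[OF f, of "e / 2"] e by auto
  have "uniformly_continuous_on (cball 0 (B + 1)) f"
    by (intro compact_uniformly_continuous continuous_on_subset[OF C0_continuous[OF f]]) auto
  then obtain d where d: "d > 0" "\<And>x y. x \<in> cball 0 (B + 1) \<Longrightarrow> y \<in> cball 0 (B + 1) \<Longrightarrow> dist y x < d \<Longrightarrow> dist (f y) (f x) < e"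
    unfolding uniformly_continuous_on_def using e by metis
  have "dist (f y) (f x) < e" if xy: "dist y x < min d 1" for x y
  proof (cases "x \<in> cball 0 (B + 1) \<and> y \<in> cball 0 (B + 1)")
    case False
    have "norm x \<le> norm y + dist y x" "norm y \<le> norm x + dist y x"
      by (metis dist_norm norm_triangle_sub add.commute norm_minus_commute)+
    then have "norm x \<ge> B" "norm y \<ge> B" using False xy by auto
    then show ?thesis using B[of x] B[of y] by (simp add: dist_real_def)
  qed (use d xy in auto)
  then show "\<exists>d>0. \<forall>x\<in>UNIV. \<forall>x'\<in>UNIV. dist x' x < d \<longrightarrow> dist (f x') (f x) < e"
    using d(1) by (intro exI[of _ "min d 1"]) auto
qed

lemma C0_uminus: "f \<in> C0 \<Longrightarrow> (\<lambda>x. - f x) \<in> C0"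
  using tendsto_minus[of f 0 at_infinity] by (auto simp: C0_def intro: continuous_on_minus)

lemma dirderiv_translation:
  assumes "\<phi> \<in> test_functions"
  shows "dirderiv b (\<lambda>y. \<phi> (y - h)) = (\<lambda>y. dirderiv b \<phi> (y - h))"
proof
  fix y
  have "((\<lambda>y. y - h) has_derivative (\<lambda>v. v)) (at y)" by (auto intro!: derivative_eq_intros)
  from has_derivative_compose[OF this test_functions_has_derivative[OF assms]]
  show "dirderiv b (\<lambda>y. \<phi> (y - h)) y = dirderiv b \<phi> (y - h)" by (rule dirderiv_eq)
qed

lemma integral_abs_translation:
  fixes \<phi> :: "'a::euclidean_space \<Rightarrow> real"
  assumes "\<phi> \<in> test_functions"
  shows "(\<integral>y. \<bar>\<phi> (y - h)\<bar> \<partial>lborel) = (\<integral>y. \<bar>\<phi> y\<bar> \<partial>lborel)"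
  using lborel_integral_shift[of "\<lambda>y. \<bar>\<phi> y\<bar>" "- h"] test_functions_measurable[OF assms] by simp

lemma corr_0: "corr f \<phi> 0 = (\<integral>y. f y * \<phi> y \<partial>lborel)"
  by (simp add: corr_def)

context brownian
begin

text \<open>
  The Lipschitz set of the heat semigroup within the Lipschitz continuous functions. Lipschitz
  continuity in space is what makes drifts comparable to time: moving by \<open>t *\<^sub>R l\<close> changes the function
  by a multiple of \<open>t\<close>.
\<close>

definition heat_lip_set :: "('a \<Rightarrow> real) set" where
  "heat_lip_set = {f \<in> C0. (\<exists>B. \<forall>x y. \<bar>f x - f y\<bar> \<le> B * norm (x - y)) \<and>
     (\<exists>t0>0. \<exists>c. \<forall>t\<in>{0..t0}. \<forall>x. \<bar>heat t f x - f x\<bar> \<le> c * t)}"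

text \<open>
  The difference quotients \<open>(f (x + s *\<^sub>R b) - f x) / s\<close> are bounded by the Lipschitz constant and, tested
  with \<open>\<phi>\<close>, converge to the distributional derivative by \<open>corr_DERIV\<close>; likewise
  \<open>2 / s * (heat s f x - f x)\<close> is bounded and converges to the distributional Laplacian by
  \<open>generator_estimate\<close>. Weak limits of bounded sequences are bounded functions, so these
  distributions lie in \<open>L\<^sup>\<infinity>\<close>.
\<close>

lemma heat_lip_set_subset_sobolev:
  assumes "f \<in> heat_lip_set"
  shows "f \<in> W1inf" and "\<exists>g\<in>Linf. weak_laplacian f g"
proof -
  obtain B t0 c where f: "f \<in> C0" and B: "\<And>x y. \<bar>f x - f y\<bar> \<le> B * norm (x - y)"
    and t0: "t0 > 0" and c: "\<And>t x. 0 \<le> t \<Longrightarrow> t \<le> t0 \<Longrightarrow> \<bar>heat t f x - f x\<bar> \<le> c * t"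
    using assms unfolding heat_lip_set_def by fastforce
  obtain N where N: "\<And>x. \<bar>f x\<bar> \<le> N" using C0_bounded[OF f] by blast
  have fm [measurable]: "f \<in> borel_measurable borel" by (rule C0_measurable[OF f])
  have sf: "sigma_finite_measure (lborel :: 'a measure)" by (rule sigma_finite_lborel)
  have "\<exists>g. g \<in> borel_measurable borel \<and> (\<forall>x. \<bar>g x\<bar> \<le> B) \<and>
      (\<forall>\<phi>\<in>test_functions. (\<integral>x. g x * \<phi> x \<partial>lborel) = - (\<integral>x. f x * dirderiv b \<phi> x \<partial>lborel))"
    if b: "b \<in> Basis" for b
  proof -
    define h where "h = (\<lambda>n x. real (Suc n) * (f (x + (1 / real (Suc n)) *\<^sub>R b) - f x))"
    have hm: "h n \<in> borel_measurable lborel" for n unfolding h_def by measurable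
    have hb: "\<bar>h n x\<bar> \<le> B" for n x
    proof -
      have "\<bar>f (x + (1 / real (Suc n)) *\<^sub>R b) - f x\<bar> \<le> B / real (Suc n)"
        using B[of "x + (1 / real (Suc n)) *\<^sub>R b" x] b by simp
      then show ?thesis
        unfolding h_def abs_mult by (simp add: pos_le_divide_eq mult.commute del: of_nat_Suc)
    qed
    have lim: "(\<lambda>n. \<integral>x. h n x * \<phi> x \<partial>lborel) \<longlonglongrightarrow> - (\<integral>x. f x * dirderiv b \<phi> x \<partial>lborel)"
      if \<phi>: "\<phi> \<in> test_functions" for \<phi>
    proof -
      have "(\<integral>x. h n x * \<phi> x \<partial>lborel) =
          (corr f \<phi> (0 + inverse (real (Suc n)) *\<^sub>R b) - corr f \<phi> (0 + 0 *\<^sub>R b)) / (inverse (real (Suc n)) - 0)" for n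
      proof -
        let ?s = "(1 / real (Suc n)) *\<^sub>R b"
        have i1: "integrable lborel (\<lambda>x. f (?s + x) * \<phi> x)"
          using \<phi> N by (intro integrable_bounded_mult_test) auto
        have i2: "integrable lborel (\<lambda>x. f x * \<phi> x)"
          using \<phi> N by (intro integrable_bounded_mult_test) auto
        have "(\<integral>x. h n x * \<phi> x \<partial>lborel) = (\<integral>x. real (Suc n) * (f (?s + x) * \<phi> x - f x * \<phi> x) \<partial>lborel)"
          unfolding h_def by (simp add: algebra_simps)
        also have "\<dots> = real (Suc n) * ((\<integral>x. f (?s + x) * \<phi> x \<partial>lborel) - (\<integral>x. f x * \<phi> x \<partial>lborel))"
          using i1 i2 by simp
        also have "\<dots> = real (Suc n) * (corr f \<phi> ?s - corr f \<phi> 0)"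
          by (simp only: corr_eq_shift[OF fm \<phi>] add_0)
        finally show ?thesis by (simp add: divide_inverse mult.commute)
      qed
      moreover have "((\<lambda>r. (corr f \<phi> (0 + r *\<^sub>R b) - corr f \<phi> (0 + 0 *\<^sub>R b)) / (r - 0)) \<longlongrightarrow> - corr f (dirderiv b \<phi>) (0 + 0 *\<^sub>R b)) (at 0)"
        using corr_DERIV[OF fm N \<phi>, of 0 b 0] unfolding has_field_derivative_iff .
      then have "(\<lambda>n. (corr f \<phi> (0 + inverse (real (Suc n)) *\<^sub>R b) - corr f \<phi> (0 + 0 *\<^sub>R b)) / (inverse (real (Suc n)) - 0))
          \<longlonglongrightarrow> - corr f (dirderiv b \<phi>) (0 + 0 *\<^sub>R b)"
        by (rule filterlim_compose) (intro filterlim_atI LIMSEQ_inverse_real_of_nat always_eventually, simp)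
      ultimately show ?thesis by (simp add: corr_0 del: of_nat_Suc)
    qed
    have "\<exists>g. g \<in> borel_measurable lborel \<and> (\<forall>x. \<bar>g x\<bar> \<le> B) \<and>
      (\<forall>\<phi>\<in>test_functions. (\<integral>x. g x * \<phi> x \<partial>lborel) = - (\<integral>x. f x * dirderiv b \<phi> x \<partial>lborel))"
      by (rule weak_limit_of_bounded_sequence[OF sf hm hb test_functions_integrable lim])
    then show ?thesis by simp
  qed
  then have "\<forall>b\<in>Basis. \<exists>g. g \<in> borel_measurable borel \<and> (\<forall>x. \<bar>g x\<bar> \<le> B) \<and>
      (\<forall>\<phi>\<in>test_functions. (\<integral>x. g x * \<phi> x \<partial>lborel) = - (\<integral>x. f x * dirderiv b \<phi> x \<partial>lborel))"
    by blast
  from bchoice[OF this] obtain G where Gm: "\<And>b. b \<in> Basis \<Longrightarrow> G b \<in> borel_measurable borel"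
    and Gb: "\<And>b x. b \<in> Basis \<Longrightarrow> \<bar>G b x\<bar> \<le> B"
    and G: "\<And>b \<phi>. b \<in> Basis \<Longrightarrow> \<phi> \<in> test_functions \<Longrightarrow>
      (\<integral>x. G b x * \<phi> x \<partial>lborel) = - (\<integral>x. f x * dirderiv b \<phi> x \<partial>lborel)"
    by blast
  define V where "V = (\<lambda>x. \<Sum>b\<in>Basis. G b x *\<^sub>R b)"
  have Vb: "V x \<bullet> b = G b x" if "b \<in> Basis" for x b using that by (simp add: V_def)
  have "V \<in> borel_measurable borel" unfolding V_def using Gm by measurable
  moreover have "norm (V x) \<le> (\<Sum>b\<in>(Basis::'a set). B)" for x
    using norm_le_l1[of "V x"] Gb Vb by (intro order_trans[OF norm_le_l1] sum_mono) auto
  then have "bounded (range V)" by (auto simp: bounded_iff)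
  ultimately have V: "V \<in> Linf" by (simp add: Linf_def)
  have wg: "weak_gradient f V"
    unfolding weak_gradient_def using G by (auto simp: Vb grad_inner)
  have "f \<in> Linf" using N fm by (auto simp: Linf_def bounded_iff)
  then show "f \<in> W1inf" using V wg by (auto simp: W1inf_def)

  \<comment> \<open>the offset keeps the times below \<open>t0\<close>\<close>
  define \<tau> where "\<tau> = (\<lambda>n. inverse (real (Suc n + nat \<lceil>1 / t0\<rceil>)))"
  have \<tau>: "\<tau> n > 0" "\<tau> n \<le> t0" for n
  proof -
    have "1 / t0 \<le> real (Suc n + nat \<lceil>1 / t0\<rceil>)" using real_nat_ceiling_ge[of "1 / t0"] by simp
    then have "inverse (real (Suc n + nat \<lceil>1 / t0\<rceil>)) \<le> inverse (1 / t0)"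
      using t0 by (intro le_imp_inverse_le) auto
    then show "\<tau> n \<le> t0" by (simp add: \<tau>_def)
  qed (simp add: \<tau>_def)
  have \<tau>0: "\<tau> \<longlonglongrightarrow> 0"
    unfolding \<tau>_def using LIMSEQ_ignore_initial_segment[OF LIMSEQ_inverse_real_of_nat, of "nat \<lceil>1 / t0\<rceil>"] by simp
  define k where "k = (\<lambda>n x. 2 / \<tau> n * (heat (\<tau> n) f x - f x))"
  have hm: "heat (\<tau> n) f \<in> borel_measurable borel" for n
    using heat_measurable[OF _ fm] \<tau>(1)[of n] by simp
  have km: "k n \<in> borel_measurable lborel" for n unfolding k_def using hm[of n] by measurable
  have kb: "\<bar>k n x\<bar> \<le> 2 * c" for n x
    using c[of "\<tau> n" x] \<tau>[of n] by (simp add: k_def abs_mult field_simps)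
  have klim: "(\<lambda>n. \<integral>x. k n x * \<phi> x \<partial>lborel) \<longlonglongrightarrow> (\<Sum>b\<in>Basis. corr f (dirderiv b (dirderiv b \<phi>)) 0)"
    if \<phi>: "\<phi> \<in> test_functions" for \<phi>
  proof -
    obtain K where K: "K \<ge> 0" "\<And>t x. t > 0 \<Longrightarrow> \<bar>heat t (corr f \<phi>) x - corr f \<phi> x
      - t / 2 * (\<Sum>b\<in>Basis. corr f (dirderiv b (dirderiv b \<phi>)) x)\<bar> \<le> K * sqrt t ^ 3"
      using that by (rule generator_estimate[OF fm N \<phi>])
    have e1: "\<bar>(\<integral>x. k n x * \<phi> x \<partial>lborel) - (\<Sum>b\<in>Basis. corr f (dirderiv b (dirderiv b \<phi>)) 0)\<bar> \<le> 2 * K * sqrt (\<tau> n)" for n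
    proof -
      let ?s = "\<Sum>b\<in>Basis. corr f (dirderiv b (dirderiv b \<phi>)) 0"
      have i1: "integrable lborel (\<lambda>x. heat (\<tau> n) f x * \<phi> x)"
        using \<phi> hm heat_bound[OF _ fm N] \<tau>(1)[of n] by (intro integrable_bounded_mult_test[where N=N]) auto
      have i2: "integrable lborel (\<lambda>x. f x * \<phi> x)"
        using \<phi> N by (intro integrable_bounded_mult_test) auto
      have "(\<integral>x. k n x * \<phi> x \<partial>lborel) = (\<integral>x. 2 / \<tau> n * (heat (\<tau> n) f x * \<phi> x - f x * \<phi> x) \<partial>lborel)"
        unfolding k_def by (simp only: mult.assoc left_diff_distrib)
      also have "\<dots> = 2 / \<tau> n * (corr (heat (\<tau> n) f) \<phi> 0 - corr f \<phi> 0)"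
        using i1 i2 by (simp add: corr_0)
      also have "corr (heat (\<tau> n) f) \<phi> 0 = heat (\<tau> n) (corr f \<phi>) 0"
        using heat_corr[OF _ fm N \<phi>] \<tau>(1)[of n] by simp
      finally have "(\<integral>x. k n x * \<phi> x \<partial>lborel) - ?s
          = 2 / \<tau> n * (heat (\<tau> n) (corr f \<phi>) 0 - corr f \<phi> 0 - \<tau> n / 2 * ?s)"
        using \<tau>(1)[of n] by (simp add: field_simps)
      then have "\<bar>(\<integral>x. k n x * \<phi> x \<partial>lborel) - ?s\<bar> \<le> 2 / \<tau> n * (K * sqrt (\<tau> n) ^ 3)"
        using K(2)[OF \<tau>(1)[of n], of 0] \<tau>(1)[of n]
        by (simp only: abs_mult) (intro mult_mono, auto)
      also have "\<dots> = 2 * K * sqrt (\<tau> n)"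
        using \<tau>(1)[of n] by (simp add: power3_eq_cube field_simps)
      finally show ?thesis .
    qed
    have e2: "(\<lambda>n. 2 * K * sqrt (\<tau> n)) \<longlonglongrightarrow> 0"
      using tendsto_mult_left[OF tendsto_real_sqrt[OF \<tau>0], of "2 * K"] by simp
    have "(\<lambda>n. (\<integral>x. k n x * \<phi> x \<partial>lborel) - (\<Sum>b\<in>Basis. corr f (dirderiv b (dirderiv b \<phi>)) 0)) \<longlonglongrightarrow> 0"
      by (rule Lim_null_comparison[OF always_eventually e2]) (simp add: e1)
    then show ?thesis by (simp add: LIM_zero_iff)
  qed
  have "\<exists>g. g \<in> borel_measurable lborel \<and> (\<forall>x. \<bar>g x\<bar> \<le> 2 * c) \<and>
      (\<forall>\<phi>\<in>test_functions. (\<integral>x. g x * \<phi> x \<partial>lborel) = (\<Sum>b\<in>Basis. corr f (dirderiv b (dirderiv b \<phi>)) 0))"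
    by (rule weak_limit_of_bounded_sequence[OF sf km kb test_functions_integrable klim])
  then obtain g where g: "g \<in> borel_measurable lborel" "\<And>x. \<bar>g x\<bar> \<le> 2 * c"
    "\<And>\<phi>. \<phi> \<in> test_functions \<Longrightarrow> (\<integral>x. g x * \<phi> x \<partial>lborel) = (\<Sum>b\<in>Basis. corr f (dirderiv b (dirderiv b \<phi>)) 0)"
    by blast
  have gL: "g \<in> Linf" using g(1,2) by (auto simp: Linf_def bounded_iff)
  have "(\<integral>x. g x * \<phi> x \<partial>lborel) = - (\<integral>x. V x \<bullet> grad \<phi> x \<partial>lborel)" if \<phi>: "\<phi> \<in> test_functions" for \<phi>
  proof -
    have i: "integrable lborel (\<lambda>x. G b x * dirderiv b \<phi> x)" if "b \<in> Basis" for b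
      using Gm Gb that by (intro integrable_bounded_mult_test test_functions_dirderiv \<phi>) auto
    have "(\<integral>x. V x \<bullet> grad \<phi> x \<partial>lborel) = (\<integral>x. (\<Sum>b\<in>Basis. G b x * dirderiv b \<phi> x) \<partial>lborel)"
      by (subst euclidean_inner) (simp add: Vb grad_inner)
    also have "\<dots> = (\<Sum>b\<in>Basis. - (\<integral>x. f x * dirderiv b (dirderiv b \<phi>) x \<partial>lborel))"
      using i by (simp add: G test_functions_dirderiv \<phi>)
    finally show ?thesis using g(3)[OF \<phi>] by (simp add: corr_0 sum_negf)
  qed
  then show "\<exists>g\<in>Linf. weak_laplacian f g"
    using gL V wg unfolding weak_laplacian_def by blast
qed

text \<open>
  For every test function \<open>\<phi>\<close> the smooth function \<open>corr f \<phi>\<close> has gradient and Laplacian bounded by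
  multiples of \<open>\<integral> \<bar>\<phi>\<bar>\<close>, because the weak derivatives may be applied to all translates of \<open>\<phi>\<close>. So
  translations by \<open>w\<close> and the heat semigroup at time \<open>t\<close> displace it by at most a multiple of
  \<open>norm w * \<integral> \<bar>\<phi>\<bar>\<close> and \<open>t * \<integral> \<bar>\<phi>\<bar>\<close>, respectively. As \<open>\<phi>\<close> is arbitrary, the same bounds without the
  factor \<open>\<integral> \<bar>\<phi>\<bar>\<close> hold for \<open>f\<close> itself.
\<close>

lemma sobolev_subset_heat_lip_set:
  assumes f: "f \<in> C0" and g: "g \<in> Linf" and lap: "weak_laplacian f g"
  shows "f \<in> heat_lip_set"
proof -
  obtain V where V: "V \<in> Linf" "weak_gradient f V"
    and Vg: "\<And>\<phi>. \<phi> \<in> test_functions \<Longrightarrow> (\<integral>x. g x * \<phi> x \<partial>lborel) = - (\<integral>x. V x \<bullet> grad \<phi> x \<partial>lborel)"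
    using lap unfolding weak_laplacian_def by blast
  obtain N where N: "\<And>x. \<bar>f x\<bar> \<le> N" using C0_bounded[OF f] by blast
  have fm [measurable]: "f \<in> borel_measurable borel" by (rule C0_measurable[OF f])
  obtain A where A: "\<And>x. norm (V x) \<le> A" using V(1) by (auto simp: Linf_def bounded_iff)
  obtain A' where A': "\<And>x. \<bar>g x\<bar> \<le> A'" using g by (auto simp: Linf_def bounded_iff)
  have A0: "0 \<le> A" using order_trans[OF norm_ge_zero A] .
  have [measurable]: "V \<in> borel_measurable borel" "g \<in> borel_measurable borel" using V g by (auto simp: Linf_def)
  have Vc: "\<bar>V x \<bullet> b\<bar> \<le> A" if "b \<in> Basis" for x b
    using Basis_le_norm[OF that, of "V x"] A[of x] by linarith
  have wg: "(\<integral>x. f x * dirderiv b \<phi> x \<partial>lborel) = - (\<integral>x. (V x \<bullet> b) * \<phi> x \<partial>lborel)"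
    if "b \<in> Basis" "\<phi> \<in> test_functions" for b \<phi>
    using V(2) that by (auto simp: weak_gradient_def grad_inner)
  have first: "\<bar>corr f (dirderiv b \<phi>) h\<bar> \<le> A * (\<integral>y. \<bar>\<phi> y\<bar> \<partial>lborel)"
    if b: "b \<in> Basis" and \<phi>: "\<phi> \<in> test_functions" for b h \<phi>
  proof -
    have "corr f (dirderiv b \<phi>) h = - (\<integral>x. (V x \<bullet> b) * \<phi> (x - h) \<partial>lborel)"
      using wg[OF b test_functions_translation[OF \<phi>, of h]] by (simp add: corr_def dirderiv_translation[OF \<phi>])
    then show ?thesis
      using integral_bounded_mult_test_le[OF test_functions_translation[OF \<phi>, of h], of "\<lambda>x. V x \<bullet> b" A] Vc[OF b]
      by (simp add: integral_abs_translation[OF \<phi>])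
  qed
  have second: "\<bar>\<Sum>b\<in>Basis. corr f (dirderiv b (dirderiv b \<phi>)) h\<bar> \<le> A' * (\<integral>y. \<bar>\<phi> y\<bar> \<partial>lborel)"
    if \<phi>: "\<phi> \<in> test_functions" for h \<phi>
  proof -
    define \<psi> where "\<psi> = (\<lambda>y. \<phi> (y - h))"
    have \<psi>: "\<psi> \<in> test_functions" unfolding \<psi>_def by (rule test_functions_translation[OF \<phi>])
    have i: "integrable lborel (\<lambda>x. (V x \<bullet> b) * dirderiv b \<psi> x)" if "b \<in> Basis" for b
      using Vc that by (intro integrable_bounded_mult_test test_functions_dirderiv \<psi>) auto
    have "(\<Sum>b\<in>Basis. corr f (dirderiv b (dirderiv b \<phi>)) h) = (\<Sum>b\<in>Basis. \<integral>x. f x * dirderiv b (dirderiv b \<psi>) x \<partial>lborel)"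
      by (simp add: corr_def \<psi>_def dirderiv_translation \<phi> test_functions_dirderiv)
    also have "\<dots> = - (\<Sum>b\<in>Basis. \<integral>x. (V x \<bullet> b) * dirderiv b \<psi> x \<partial>lborel)"
      by (simp add: wg test_functions_dirderiv \<psi> sum_negf)
    also have "\<dots> = - (\<integral>x. V x \<bullet> grad \<psi> x \<partial>lborel)"
      using i by (subst euclidean_inner) (simp add: grad_inner)
    also have "\<dots> = (\<integral>x. g x * \<psi> x \<partial>lborel)" using Vg[OF \<psi>] by simp
    finally show ?thesis
      using integral_bounded_mult_test_le[OF \<psi>, of g A'] A' integral_abs_translation[OF \<phi>, of h] by (simp add: \<psi>_def)
  qed
  define B where "B = real DIM('a) * A"
  have lip0: "\<bar>f (w + z) - f z\<bar> \<le> B * norm w" for w z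
  proof (rule pointwise_bound_of_weak_bound[where u="\<lambda>z. f (w + z) - f z" and N="2 * N"])
    show "continuous_on UNIV (\<lambda>z. f (w + z) - f z)"
      by (intro continuous_intros continuous_on_compose2[OF C0_continuous[OF f]] C0_continuous[OF f]) auto
    show "\<bar>f (w + x) - f x\<bar> \<le> 2 * N" for x using N[of "w + x"] N[of x] by linarith
    fix \<phi> :: "'a \<Rightarrow> real" assume \<phi>: "\<phi> \<in> test_functions"
    define I where "I = (\<integral>y. \<bar>\<phi> y\<bar> \<partial>lborel)"
    have i1: "integrable lborel (\<lambda>x. f (w + x) * \<phi> x)"
      using \<phi> N by (intro integrable_bounded_mult_test) auto
    have i2: "integrable lborel (\<lambda>x. f x * \<phi> x)"
      using \<phi> N by (intro integrable_bounded_mult_test) auto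
    have d: "\<bar>\<Sum>b\<in>Basis. (w \<bullet> b) * corr f (dirderiv b \<phi>) (0 + r *\<^sub>R w)\<bar> \<le> B * norm w * I" for r
    proof -
      have "\<bar>\<Sum>b\<in>Basis. (w \<bullet> b) * corr f (dirderiv b \<phi>) (0 + r *\<^sub>R w)\<bar> \<le> (\<Sum>b\<in>(Basis::'a set). norm w * (A * I))"
        unfolding I_def
        by (intro order_trans[OF sum_abs] sum_mono)
          (simp only: abs_mult, intro mult_mono Basis_le_norm first \<phi>, auto)
      then show ?thesis by (simp add: B_def mult_ac)
    qed
    have "norm (corr f \<phi> (0 + 1 *\<^sub>R w) - corr f \<phi> (0 + 0 *\<^sub>R w)) \<le> B * norm w * I * norm (1 - 0 :: real)"
      by (rule field_differentiable_bound[of UNIV "\<lambda>r. corr f \<phi> (0 + r *\<^sub>R w)"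
          "\<lambda>r. - (\<Sum>b\<in>Basis. (w \<bullet> b) * corr f (dirderiv b \<phi>) (0 + r *\<^sub>R w))"])
        (use d in \<open>auto intro!: corr_DERIV_sum[OF fm N \<phi>, of 0] has_field_derivative_at_within simp del: add_0\<close>)
    then have "\<bar>corr f \<phi> w - corr f \<phi> 0\<bar> \<le> B * norm w * I" by simp
    moreover have "(\<integral>x. (f (w + x) - f x) * \<phi> x \<partial>lborel) = corr f \<phi> w - corr f \<phi> 0"
      using i1 i2 by (simp add: corr_eq_shift[OF fm \<phi>] left_diff_distrib)
    ultimately show "\<bar>\<integral>x. (f (w + x) - f x) * \<phi> x \<partial>lborel\<bar> \<le> B * norm w * (\<integral>x. \<bar>\<phi> x\<bar> \<partial>lborel)"
      by (simp add: I_def)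
  qed
  have lip: "\<bar>f x - f y\<bar> \<le> B * norm (x - y)" for x y
    using lip0[of "x - y" y] by simp
  have lip_shift: "\<bar>f (x + z) - f (y + z)\<bar> \<le> B * norm (x - y)" for x y z
    using lip[of "x + z" "y + z"] by simp
  have "\<bar>heat t f x - f x\<bar> \<le> A' / 2 * t" if t: "t > 0" for t x
  proof (rule pointwise_bound_of_weak_bound[where u="\<lambda>x. heat t f x - f x" and N="2 * N"])
    have "B-lipschitz_on UNIV (heat t f)"
    proof (rule lipschitz_onI)
      show "0 \<le> B" using A0 by (simp add: B_def)
      show "dist (heat t f x) (heat t f y) \<le> B * dist x y" for x y
        unfolding dist_norm real_norm_def
        by (rule heat_contraction[OF _ fm N fm N]) (use t lip_shift in auto)
    qed
    then show "continuous_on UNIV (\<lambda>x. heat t f x - f x)"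
      by (intro continuous_intros C0_continuous[OF f] lipschitz_on_continuous_on)
    show "\<bar>heat t f x - f x\<bar> \<le> 2 * N" for x using heat_bound[OF _ fm N, of t x] N[of x] t by linarith
    fix \<phi> :: "'a \<Rightarrow> real" assume \<phi>: "\<phi> \<in> test_functions"
    have hm: "heat t f \<in> borel_measurable borel" using heat_measurable[OF _ fm] t by simp
    have i1: "integrable lborel (\<lambda>x. heat t f x * \<phi> x)"
      using \<phi> hm heat_bound[OF _ fm N] t by (intro integrable_bounded_mult_test[where N=N]) auto
    have i2: "integrable lborel (\<lambda>x. f x * \<phi> x)"
      using \<phi> N by (intro integrable_bounded_mult_test) auto
    have "(\<integral>x. (heat t f x - f x) * \<phi> x \<partial>lborel) = heat t (corr f \<phi>) 0 - corr f \<phi> 0"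
      using i1 i2 t by (simp add: heat_corr[OF _ fm N \<phi>] corr_0 left_diff_distrib)
    then show "\<bar>\<integral>x. (heat t f x - f x) * \<phi> x \<partial>lborel\<bar> \<le> A' / 2 * t * (\<integral>x. \<bar>\<phi> x\<bar> \<partial>lborel)"
      using heat_displacement_of_laplacian_bound[OF fm N \<phi> second[OF \<phi>] t, of 0] by (simp add: mult_ac)
  qed
  then have "\<bar>heat t f x - f x\<bar> \<le> A' / 2 * t" if "t \<in> {0..1}" for t x
    using that heat_0[OF fm, of x] by (cases "t = 0") auto
  then show ?thesis using f lip zero_less_one unfolding heat_lip_set_def by blast
qed

theorem heat_lip_set_eq_sobolev:
  "heat_lip_set = {f \<in> W1inf \<inter> C0. \<exists>g\<in>Linf. weak_laplacian f g}"
proof (intro equalityI subsetI)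
  fix f assume f: "f \<in> heat_lip_set"
  then have "f \<in> C0" by (simp add: heat_lip_set_def)
  then show "f \<in> {f \<in> W1inf \<inter> C0. \<exists>g\<in>Linf. weak_laplacian f g}"
    using heat_lip_set_subset_sobolev[OF f] by simp
qed (auto intro: sobolev_subset_heat_lip_set)

end

section \<open>The control operators, compared with the heat semigroup\<close>

lemma abs_le_supnorm:
  assumes "\<And>x. \<bar>h x\<bar> \<le> N" shows "\<bar>h x\<bar> \<le> supnorm h"
  unfolding supnorm_def by (rule cSUP_upper) (use assms in \<open>auto intro!: bdd_aboveI[of _ N]\<close>)

lemma supnorm_le: "(\<And>x. \<bar>h x\<bar> \<le> c) \<Longrightarrow> supnorm h \<le> c"
  unfolding supnorm_def by (rule cSUP_least) auto

lemma tendsto_of_supnorm: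
  assumes "\<And>n. \<exists>N. \<forall>x. \<bar>h n x - g x\<bar> \<le> N" and "(\<lambda>n. supnorm (\<lambda>x. h n x - g x)) \<longlonglongrightarrow> 0"
  shows "(\<lambda>n. h n x) \<longlonglongrightarrow> g x"
proof -
  have "\<bar>h n x - g x\<bar> \<le> supnorm (\<lambda>x. h n x - g x)" for n
    using assms(1)[of n] abs_le_supnorm[of "\<lambda>x. h n x - g x"] by blast
  then have "(\<lambda>n. h n x - g x) \<longlonglongrightarrow> 0"
    by (intro Lim_null_comparison[OF always_eventually assms(2)]) simp
  then show ?thesis by (simp add: LIM_zero_iff)
qed

text \<open>
  The class in which the iterates of the control operators are studied: it contains \<^const>\<open>C0\<close>, and the
  operators preserve it for the simple reason that they preserve every modulus of continuity. That
  suffices for the iterates to be measurable.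
\<close>

definition buc :: "('a::euclidean_space \<Rightarrow> real) \<Rightarrow> bool" where
  "buc f \<longleftrightarrow> (\<exists>N. \<forall>x. \<bar>f x\<bar> \<le> N) \<and> uniformly_continuous_on UNIV f"

lemma buc_bounded: assumes "buc f" obtains N where "\<And>x. \<bar>f x\<bar> \<le> N"
  using assms unfolding buc_def by blast

lemma buc_measurable: "buc f \<Longrightarrow> f \<in> borel_measurable borel"
  unfolding buc_def by (auto intro: borel_measurable_continuous_onI uniformly_continuous_imp_continuous)

lemma C0_buc: "f \<in> C0 \<Longrightarrow> buc f"
  unfolding buc_def using C0_bounded C0_uniformly_continuous by metis

lemma dyadic_approximation:
  assumes "0 \<le> t"
  obtains s where "\<And>n. s n \<in> dyadics" "\<And>n. 0 \<le> s n" "s \<longlonglongrightarrow> t"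
proof -
  define s where "s = (\<lambda>n. real (nat \<lfloor>t * 2 ^ n\<rfloor>) / 2 ^ n)"
  have "\<bar>s n - t\<bar> \<le> (1 / 2) ^ n" for n
  proof -
    have "real (nat \<lfloor>t * 2 ^ n\<rfloor>) \<le> t * 2 ^ n" "t * 2 ^ n \<le> real (nat \<lfloor>t * 2 ^ n\<rfloor>) + 1"
      using assms by (auto simp: of_nat_nat)
    then have "\<bar>real (nat \<lfloor>t * 2 ^ n\<rfloor>) - t * 2 ^ n\<bar> \<le> 1" by linarith
    then have "\<bar>real (nat \<lfloor>t * 2 ^ n\<rfloor>) - t * 2 ^ n\<bar> / 2 ^ n \<le> 1 / 2 ^ n" by (intro divide_right_mono) auto
    moreover have "s n - t = (real (nat \<lfloor>t * 2 ^ n\<rfloor>) - t * 2 ^ n) / 2 ^ n"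
      by (simp add: s_def diff_divide_distrib)
    ultimately show ?thesis by (simp add: power_one_over)
  qed
  then have "(\<lambda>n. s n - t) \<longlonglongrightarrow> 0"
    by (intro Lim_null_comparison[OF always_eventually LIMSEQ_power_zero[of "1 / 2 :: real"]]) auto
  then have "s \<longlonglongrightarrow> t" by (simp add: LIM_zero_iff)
  moreover have "s n \<in> dyadics" "0 \<le> s n" for n by (auto simp: s_def dyadics_def)
  ultimately show ?thesis using that by blast
qed

context brownian
begin

lemma heat_le:
  fixes N N' :: real
  assumes t: "t \<ge> 0" and f: "f \<in> borel_measurable borel" "\<And>x. \<bar>f x\<bar> \<le> N"
    and g: "g \<in> borel_measurable borel" "\<And>x. \<bar>g x\<bar> \<le> N'" and le: "\<And>z. f (x + z) \<le> g (y + z) + e"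
  shows "heat t f x \<le> heat t g y + e"
proof -
  have "heat t f x \<le> (\<integral>\<omega>. g (y + W t \<omega>) + e \<partial>M)"
    unfolding heat_def using heat_integrable[OF t f] heat_integrable[OF t g] le by (intro integral_mono) auto
  then show ?thesis
    unfolding heat_def using heat_integrable[OF t g] by (simp add: prob_space)
qed

lemma heat_uminus: "heat t (\<lambda>x. - f x) x = - heat t f x"
  by (simp add: heat_def)

lemma heat_lipschitz:
  fixes N :: real
  assumes t: "t \<ge> 0" and f: "f \<in> borel_measurable borel" "\<And>x. \<bar>f x\<bar> \<le> N"
    and B: "\<And>x y. \<bar>f x - f y\<bar> \<le> B * norm (x - y)"
  shows "\<bar>heat t f x - heat t f y\<bar> \<le> B * norm (x - y)"
proof (rule heat_contraction[OF t f f])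
  show "\<bar>f (x + z) - f (y + z)\<bar> \<le> B * norm (x - y)" for z
    using B[of "x + z" "y + z"] by simp
qed

text \<open>
  Continuity in time comes from the continuity of the Brownian paths.
\<close>

lemma heat_tendsto:
  assumes f: "f \<in> C0" and s: "\<And>n. 0 \<le> s n" "s \<longlonglongrightarrow> t" and x: "X \<longlonglongrightarrow> x"
  shows "(\<lambda>n. heat (s n) f (X n)) \<longlonglongrightarrow> heat t f x"
proof -
  have t: "0 \<le> t" using LIMSEQ_le_const[OF s(2)] s(1) by blast
  obtain N where N: "\<And>x. \<bar>f x\<bar> \<le> N" using C0_bounded[OF f] by blast
  have [measurable]: "f \<in> borel_measurable borel" by (rule C0_measurable[OF f])
  have [measurable]: "W (s n) \<in> borel_measurable M" "W t \<in> borel_measurable M" for n using s t by auto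
  have paths: "AE \<omega> in M. continuous_on {0..} (\<lambda>t. W t \<omega>)"
    using bm unfolding brownian_motion_def by (elim conjE)
  have ae: "AE \<omega> in M. (\<lambda>n. f (X n + W (s n) \<omega>)) \<longlonglongrightarrow> f (x + W t \<omega>)"
    using paths
  proof eventually_elim
    case (elim \<omega>)
    have "(\<lambda>n. W (s n) \<omega>) \<longlonglongrightarrow> W t \<omega>"
      by (rule continuous_on_tendsto_compose[OF elim s(2)]) (use s t in auto)
    from continuous_on_tendsto_compose[OF C0_continuous[OF f] tendsto_add[OF x this]]
    show ?case by simp
  qed
  show ?thesis
    unfolding heat_def
    by (rule integral_dominated_convergence[where w="\<lambda>_. N"]) (use ae N in auto)
qed

end

locale controlled_brownian = brownian M W for M :: "'w measure" and W :: "real \<Rightarrow> 'w \<Rightarrow> 'a::euclidean_space" +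
  fixes L :: "'a \<Rightarrow> ennreal"
  assumes L_min: "\<exists>l. L l = 0"
    and L_growth: "((\<lambda>l. L l / ennreal (norm l)) \<longlongrightarrow> \<infinity>) at_infinity"
    and L_sphere: "\<exists>\<epsilon>::real. \<epsilon> > 0 \<and> (SUP l\<in>{l. norm l = \<epsilon>}. L l) < \<infinity>"
begin

abbreviation cost :: "'a \<Rightarrow> real" where "cost l \<equiv> enn2real (L l)"

text \<open>
  The superlinear growth of \<open>L\<close> makes its convex conjugate finite at every slope.
\<close>

lemma legendre_bound:
  obtains K where "K \<ge> 0" "\<And>l. L l \<noteq> \<top> \<Longrightarrow> B * norm l - cost l \<le> K"
proof -
  define B' where "B' = max B 0"
  have B': "0 \<le> B'" by (simp add: B'_def)
  have "eventually (\<lambda>l. ennreal B' < L l / ennreal (norm l)) at_infinity"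
    using order_tendstoD(1)[OF L_growth, of "ennreal B'"] by simp
  then obtain R where R: "\<And>l. norm l \<ge> R \<Longrightarrow> ennreal B' < L l / ennreal (norm l)"
    unfolding eventually_at_infinity by blast
  have "B * norm l - cost l \<le> B' * max R 1" if "L l \<noteq> \<top>" for l
  proof (cases "norm l \<ge> max R 1")
    case True
    then have "norm l \<ge> 1" "norm l \<ge> R" by auto
    then have l: "norm l > 0" by linarith
    have "L l = ennreal (cost l)" using that by (simp add: less_top)
    then have "L l / ennreal (norm l) = ennreal (cost l / norm l)"
      using divide_ennreal[OF enn2real_nonneg l, of "L l"] by simp
    then have "ennreal B' < ennreal (cost l / norm l)"
      using R[OF \<open>norm l \<ge> R\<close>] by simp
    then have "B' < cost l / norm l" using B' by (simp add: ennreal_less_iff)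
    then have "B' * norm l \<le> cost l" using l by (simp add: field_simps)
    moreover have "B * norm l \<le> B' * norm l" by (simp add: B'_def mult_right_mono)
    moreover have "0 \<le> B' * max R 1" by (simp add: B'_def)
    ultimately show ?thesis by linarith
  next
    case False
    have "B * norm l \<le> B' * max R 1"
      using False by (intro mult_mono) (auto simp: B'_def)
    then show ?thesis using enn2real_nonneg[of "L l"] by linarith
  qed
  then show ?thesis using that[of "B' * max R 1"] by (auto simp: B'_def)
qed

text \<open>
  The conversion to reals loses nothing: a control without cost bounds the supremum below, and
  nonnegativity of the cost bounds it above.
\<close>

lemma control_op_eq_ereal:
  fixes N :: real
  assumes t: "t > 0" and f: "f \<in> borel_measurable borel" "\<And>x. \<bar>f x\<bar> \<le> N"
  shows "ereal (control_op M W L t f x) = (SUP l. ereal (heat t f (x + t *\<^sub>R l)) - enn2ereal (L l) * ereal t)"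
    (is "_ = (SUP l. ?s l)")
proof -
  have e: "(\<integral>\<omega>. f (x + W t \<omega> + t *\<^sub>R l) \<partial>M) = heat t f (x + t *\<^sub>R l)" for l
    by (simp add: heat_def ac_simps)
  obtain l0 where l0: "L l0 = 0" using L_min by blast
  have b: "\<bar>heat t f y\<bar> \<le> N" for y using heat_bound[OF _ f] t by simp
  have "(SUP l. ?s l) \<le> ereal N"
  proof (rule SUP_least)
    fix l
    have "?s l \<le> ereal (heat t f (x + t *\<^sub>R l)) - 0"
      using t by (intro ereal_minus_mono) auto
    also have "\<dots> \<le> ereal N" using b[of "x + t *\<^sub>R l"] by simp
    finally show "?s l \<le> ereal N" .
  qed
  moreover have "ereal (- N) \<le> (SUP l. ?s l)"
  proof -
    have "ereal (- N) \<le> ?s l0" using b[of "x + t *\<^sub>R l0"] l0 by (simp add: zero_ennreal.rep_eq)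
    also have "\<dots> \<le> (SUP l. ?s l)" by (rule SUP_upper) simp
    finally show ?thesis .
  qed
  ultimately have "\<bar>SUP l. ?s l\<bar> \<noteq> \<infinity>" by (cases "SUP l. ?s l") auto
  then show ?thesis unfolding control_op_def e by (rule ereal_real')
qed

lemma finite_cost_term:
  assumes "L l \<noteq> \<top>"
  shows "ereal a - enn2ereal (L l) * ereal t = ereal (a - t * cost l)"
proof -
  have "L l = ennreal (cost l)" using assms by (simp add: less_top)
  then have "enn2ereal (L l) = ereal (cost l)" by (metis enn2ereal_ennreal enn2real_nonneg)
  then show ?thesis by (simp add: mult.commute)
qed

lemma control_op_lower:
  fixes N :: real
  assumes t: "t > 0" and f: "f \<in> borel_measurable borel" "\<And>x. \<bar>f x\<bar> \<le> N" and l: "L l \<noteq> \<top>"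
  shows "heat t f (x + t *\<^sub>R l) - t * cost l \<le> control_op M W L t f x"
proof -
  have "ereal (heat t f (x + t *\<^sub>R l) - t * cost l) \<le> ereal (control_op M W L t f x)"
    unfolding control_op_eq_ereal[OF t f] finite_cost_term[OF l, symmetric] by (rule SUP_upper) simp
  then show ?thesis by simp
qed

lemma control_op_upper:
  fixes N :: real
  assumes t: "t > 0" and f: "f \<in> borel_measurable borel" "\<And>x. \<bar>f x\<bar> \<le> N"
    and le: "\<And>l. L l \<noteq> \<top> \<Longrightarrow> heat t f (x + t *\<^sub>R l) - t * cost l \<le> c"
  shows "control_op M W L t f x \<le> c"
proof -
  have "ereal (control_op M W L t f x) \<le> ereal c"
    unfolding control_op_eq_ereal[OF t f]
  proof (rule SUP_least)
    fix l
    show "ereal (heat t f (x + t *\<^sub>R l)) - enn2ereal (L l) * ereal t \<le> ereal c"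
    proof (cases "L l = \<top>")
      case True
      then show ?thesis using t by (simp add: top_ennreal.rep_eq top_ereal_def)
    next
      case False
      then show ?thesis using le[of l] by (simp add: finite_cost_term)
    qed
  qed
  then show ?thesis by simp
qed

lemma control_op_0:
  assumes "f \<in> borel_measurable borel" shows "control_op M W L 0 f x = f x"
proof -
  have "(\<integral>\<omega>. f (x + W 0 \<omega>) \<partial>M) = f x" using heat_0[OF assms] by (simp add: heat_def)
  then show ?thesis by (simp add: control_op_def flip: zero_ereal_def)
qed

lemma control_op_le:
  fixes N N' :: real
  assumes t: "t > 0" and f: "f \<in> borel_measurable borel" "\<And>x. \<bar>f x\<bar> \<le> N"
    and g: "g \<in> borel_measurable borel" "\<And>x. \<bar>g x\<bar> \<le> N'" and le: "\<And>z. f (x + z) \<le> g (y + z) + e"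
  shows "control_op M W L t f x \<le> control_op M W L t g y + e"
proof (rule control_op_upper[OF t f])
  fix l assume l: "L l \<noteq> \<top>"
  have "heat t f (x + t *\<^sub>R l) \<le> heat t g (y + t *\<^sub>R l) + e"
    by (rule heat_le[OF _ f g]) (use t le[of "t *\<^sub>R l + _"] in \<open>auto simp: add.assoc\<close>)
  then show "heat t f (x + t *\<^sub>R l) - t * cost l \<le> control_op M W L t g y + e"
    using control_op_lower[OF t g l, of y] by linarith
qed

lemma control_op_oscillation:
  fixes N :: real
  assumes t: "t > 0" and f: "f \<in> borel_measurable borel" "\<And>x. \<bar>f x\<bar> \<le> N"
    and le: "\<And>z. \<bar>f (x + z) - f (y + z)\<bar> \<le> e"
  shows "\<bar>control_op M W L t f x - control_op M W L t f y\<bar> \<le> e"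
proof -
  have "f (x + z) \<le> f (y + z) + e" "f (y + z) \<le> f (x + z) + e" for z using le[of z] by auto
  then show ?thesis
    using control_op_le[OF t f f, of x y e] control_op_le[OF t f f, of y x e] by auto
qed

lemma control_op_bound:
  fixes N :: real
  assumes t: "t > 0" and f: "f \<in> borel_measurable borel" "\<And>x. \<bar>f x\<bar> \<le> N"
  shows "\<bar>control_op M W L t f x\<bar> \<le> N"
proof -
  obtain l0 where l0: "L l0 = 0" using L_min by blast
  have b: "\<bar>heat t f y\<bar> \<le> N" for y using heat_bound[OF _ f] t by simp
  have "control_op M W L t f x \<le> N"
  proof (rule control_op_upper[OF t f])
    fix l
    have "0 \<le> t * cost l" using t by simp
    then show "heat t f (x + t *\<^sub>R l) - t * cost l \<le> N" using b[of "x + t *\<^sub>R l"] by linarith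
  qed
  moreover have "- N \<le> control_op M W L t f x"
    using control_op_lower[OF t f, of l0 x] b[of "x + t *\<^sub>R l0"] l0 by auto
  ultimately show ?thesis by auto
qed

lemma control_op_buc:
  assumes t: "t > 0" and f: "buc f" shows "buc (control_op M W L t f)"
proof -
  obtain N where N: "\<And>x. \<bar>f x\<bar> \<le> N" using buc_bounded[OF f] by blast
  note fm = buc_measurable[OF f]
  have "uniformly_continuous_on UNIV (control_op M W L t f)"
    unfolding uniformly_continuous_on_def
  proof (intro allI impI)
    fix e :: real assume e: "e > 0"
    then obtain d where d: "d > 0" "\<And>x y. dist y x < d \<Longrightarrow> dist (f y) (f x) < e / 2"
      using f unfolding buc_def uniformly_continuous_on_def by (meson UNIV_I half_gt_zero)
    have "dist (control_op M W L t f y) (control_op M W L t f x) < e" if "dist y x < d" for x y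
    proof -
      have "\<bar>f (y + z) - f (x + z)\<bar> \<le> e / 2" for z
        using d(2)[of "y + z" "x + z"] that by (simp add: dist_norm)
      then show ?thesis
        using control_op_oscillation[OF t fm N, of y x "e / 2"] e by (simp add: dist_real_def)
    qed
    then show "\<exists>d>0. \<forall>x\<in>UNIV. \<forall>x'\<in>UNIV. dist x' x < d \<longrightarrow> dist (control_op M W L t f x') (control_op M W L t f x) < e"
      using d(1) by blast
  qed
  then show ?thesis using control_op_bound[OF t fm N] unfolding buc_def by blast
qed

lemma iterate_buc:
  assumes "h > 0" "buc f" shows "buc ((control_op M W L h ^^ k) f)"
  by (induction k) (use assms control_op_buc in auto)

lemma iterate_lipschitz:
  assumes h: "h > 0" and f: "buc f" and B: "\<And>x y. \<bar>f x - f y\<bar> \<le> B * norm (x - y)"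
  shows "\<bar>(control_op M W L h ^^ k) f x - (control_op M W L h ^^ k) f y\<bar> \<le> B * norm (x - y)"
proof (induction k arbitrary: x y)
  case (Suc k)
  let ?g = "(control_op M W L h ^^ k) f"
  obtain N where N: "\<And>x. \<bar>?g x\<bar> \<le> N" using buc_bounded[OF iterate_buc[OF h f]] by blast
  have "\<bar>?g (x + z) - ?g (y + z)\<bar> \<le> B * norm (x - y)" for z
    using Suc.IH[of "x + z" "y + z"] by simp
  then show ?case
    using control_op_oscillation[OF h buc_measurable[OF iterate_buc[OF h f]] N] by simp
qed (simp add: B)

text \<open>
  The control \<open>l\<close> is admissible in every step, and using it throughout amounts to running the heat
  semigroup with the constant drift \<open>l\<close>.
\<close>

lemma iterate_lower:
  assumes h: "h > 0" and f: "buc f" and l: "L l \<noteq> \<top>"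
  shows "heat (real k * h) f (x + (real k * h) *\<^sub>R l) - (real k * h) * cost l \<le> (control_op M W L h ^^ k) f x"
proof (induction k arbitrary: x)
  case 0
  then show ?case using heat_0[OF buc_measurable[OF f]] by simp
next
  case (Suc k)
  let ?g = "(control_op M W L h ^^ k) f"
  obtain N where N: "\<And>x. \<bar>f x\<bar> \<le> N" using buc_bounded[OF f] by blast
  obtain N' where N': "\<And>x. \<bar>?g x\<bar> \<le> N'" using buc_bounded[OF iterate_buc[OF h f]] by blast
  note fm = buc_measurable[OF f] and gm = buc_measurable[OF iterate_buc[OF h f, of k]]
  have k: "0 \<le> real k * h" using h by simp
  have s: "real (Suc k) * h = h + real k * h" by (simp add: distrib_right)
  have "heat (real (Suc k) * h) f (x + (real (Suc k) * h) *\<^sub>R l)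
      = heat h (heat (real k * h) f) (x + h *\<^sub>R l + (real k * h) *\<^sub>R l)"
    unfolding s using heat_semigroup[OF less_imp_le[OF h] k fm N] by (simp add: scaleR_add_left add.assoc)
  also have "\<dots> \<le> heat h ?g (x + h *\<^sub>R l) + real k * h * cost l"
  proof (rule heat_le[OF less_imp_le[OF h] heat_measurable[OF k fm] heat_bound[OF k fm N] gm N'])
    fix z
    have e: "x + h *\<^sub>R l + z + (real k * h) *\<^sub>R l = x + h *\<^sub>R l + (real k * h) *\<^sub>R l + z" by (simp add: ac_simps)
    show "heat (real k * h) f (x + h *\<^sub>R l + (real k * h) *\<^sub>R l + z) \<le> ?g (x + h *\<^sub>R l + z) + real k * h * cost l"
      using Suc.IH[of "x + h *\<^sub>R l + z"] unfolding e by linarith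
  qed
  also have "heat h ?g (x + h *\<^sub>R l) \<le> control_op M W L h ?g x + h * cost l"
    using control_op_lower[OF h gm N' l, of x] by linarith
  finally show ?case by (simp add: distrib_right)
qed

text \<open>
  A drift \<open>l\<close> gains at most \<open>B * norm l\<close> per unit of time on a \<open>B\<close>-Lipschitz function and costs \<open>L l\<close>.
\<close>

lemma control_op_upper_lipschitz:
  assumes t: "t > 0" and f: "buc f" and B: "\<And>x y. \<bar>f x - f y\<bar> \<le> B * norm (x - y)"
    and K: "\<And>l. L l \<noteq> \<top> \<Longrightarrow> B * norm l - cost l \<le> K"
  shows "control_op M W L t f x \<le> heat t f x + t * K"
proof -
  obtain N where N: "\<And>x. \<bar>f x\<bar> \<le> N" using buc_bounded[OF f] by blast
  note fm = buc_measurable[OF f]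
  show ?thesis
  proof (rule control_op_upper[OF t fm N])
    fix l assume "L l \<noteq> \<top>"
    from mult_left_mono[OF K[OF this], of t] t have "t * (B * norm l) - t * cost l \<le> t * K"
      by (simp add: right_diff_distrib)
    moreover have "\<bar>heat t f (x + t *\<^sub>R l) - heat t f x\<bar> \<le> B * norm (x + t *\<^sub>R l - x)"
      by (rule heat_lipschitz[OF _ fm N B]) (use t in simp)
    ultimately show "heat t f (x + t *\<^sub>R l) - t * cost l \<le> heat t f x + t * K"
      using t by (simp add: mult_ac abs_le_iff)
  qed
qed

text \<open>
  The one-step bound can be iterated with the same \<open>K\<close> because the operators preserve the Lipschitz
  constant.
\<close>

lemma iterate_upper:
  assumes h: "h > 0" and f: "buc f" and B: "\<And>x y. \<bar>f x - f y\<bar> \<le> B * norm (x - y)"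
    and K: "\<And>l. L l \<noteq> \<top> \<Longrightarrow> B * norm l - cost l \<le> K"
  shows "(control_op M W L h ^^ k) f x \<le> heat (real k * h) f x + (real k * h) * K"
proof (induction k arbitrary: x)
  case 0
  then show ?case using heat_0[OF buc_measurable[OF f]] by simp
next
  case (Suc k)
  let ?g = "(control_op M W L h ^^ k) f"
  obtain N where N: "\<And>x. \<bar>f x\<bar> \<le> N" using buc_bounded[OF f] by blast
  obtain N' where N': "\<And>x. \<bar>?g x\<bar> \<le> N'" using buc_bounded[OF iterate_buc[OF h f]] by blast
  note fm = buc_measurable[OF f] and gm = buc_measurable[OF iterate_buc[OF h f, of k]]
  have k: "0 \<le> real k * h" using h by simp
  have s: "real (Suc k) * h = h + real k * h" by (simp add: distrib_right)
  have "(control_op M W L h ^^ Suc k) f x \<le> heat h ?g x + h * K"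
    using control_op_upper_lipschitz[OF h iterate_buc[OF h f] iterate_lipschitz[OF h f B] K] by simp
  also have "heat h ?g x \<le> heat h (heat (real k * h) f) x + real k * h * K"
    by (rule heat_le[OF less_imp_le[OF h] gm N' heat_measurable[OF k fm] heat_bound[OF k fm N]])
      (rule Suc.IH)
  also have "heat h (heat (real k * h) f) x = heat (real (Suc k) * h) f x"
    unfolding s using heat_semigroup[OF less_imp_le[OF h] k fm N] by simp
  finally show ?case by (simp add: distrib_right)
qed

text \<open>
  The two properties that the control operators and the associated semigroup share and from which
  their symmetric Lipschitz sets can be computed: drifted heat flows bound them from below on all of
  \<^const>\<open>C0\<close>, and on Lipschitz functions the heat flow bounds them from above up to an error linear in
  time. Boundedness is added to make \<^const>\<open>supnorm\<close> meaningful.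
\<close>

definition sandwiched :: "(real \<Rightarrow> ('a \<Rightarrow> real) \<Rightarrow> ('a \<Rightarrow> real)) \<Rightarrow> bool" where
  "sandwiched J \<longleftrightarrow>
     (\<forall>f\<in>C0. \<forall>t\<ge>0. \<exists>N. \<forall>x. \<bar>J t f x\<bar> \<le> N) \<and>
     (\<forall>f\<in>C0. \<forall>t\<ge>0. \<forall>l. L l \<noteq> \<top> \<longrightarrow> (\<forall>x. heat t f (x + t *\<^sub>R l) - t * cost l \<le> J t f x)) \<and>
     (\<forall>f\<in>C0. \<forall>B. (\<forall>x y. \<bar>f x - f y\<bar> \<le> B * norm (x - y)) \<longrightarrow>
        (\<exists>K\<ge>0. \<forall>t\<ge>0. \<forall>x. J t f x \<le> heat t f x + t * K))"

context
  fixes J :: "real \<Rightarrow> ('a \<Rightarrow> real) \<Rightarrow> ('a \<Rightarrow> real)"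
  assumes J: "sandwiched J"
begin

lemma sandwiched_bounded:
  assumes "f \<in> C0" "t \<ge> 0" obtains N where "\<And>x. \<bar>J t f x\<bar> \<le> N"
  using J[unfolded sandwiched_def, THEN conjunct1, rule_format, OF assms] by blast

lemma sandwiched_lower:
  assumes "f \<in> C0" "t \<ge> 0" "L l \<noteq> \<top>"
  shows "heat t f (x + t *\<^sub>R l) - t * cost l \<le> J t f x"
  using J[unfolded sandwiched_def, THEN conjunct2, THEN conjunct1, rule_format, OF assms] .

lemma sandwiched_near_heat:
  assumes f: "f \<in> C0" and B: "\<And>x y. \<bar>f x - f y\<bar> \<le> B * norm (x - y)"
  obtains c where "c \<ge> 0" "\<And>t x. t \<ge> 0 \<Longrightarrow> \<bar>J t f x - heat t f x\<bar> \<le> c * t"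
proof -
  obtain N where N: "\<And>x. \<bar>f x\<bar> \<le> N" using C0_bounded[OF f] by blast
  note fm = C0_measurable[OF f]
  obtain l0 where l0: "L l0 = 0" using L_min by blast
  obtain K where K: "K \<ge> 0" "\<forall>t\<ge>0. \<forall>x. J t f x \<le> heat t f x + t * K"
    using J[unfolded sandwiched_def, THEN conjunct2, THEN conjunct2, rule_format, OF f B] by blast
  have "\<bar>J t f x - heat t f x\<bar> \<le> (\<bar>B\<bar> * norm l0 + K) * t" if t: "0 \<le> t" for t x
  proof -
    have "\<bar>heat t f (x + t *\<^sub>R l0) - heat t f x\<bar> \<le> B * norm (x + t *\<^sub>R l0 - x)"
      by (rule heat_lipschitz[OF t fm N B])
    also have "\<dots> \<le> \<bar>B\<bar> * norm l0 * t"
      using t mult_right_mono[of B "\<bar>B\<bar>" "t * norm l0"] by (simp add: mult_ac)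
    finally have "heat t f x \<le> J t f x + \<bar>B\<bar> * norm l0 * t"
      using sandwiched_lower[OF f t, of l0 x] l0 by (simp add: abs_le_iff)
    moreover have "J t f x \<le> heat t f x + t * K" using K(2) t by blast
    moreover have "0 \<le> \<bar>B\<bar> * norm l0 * t" "0 \<le> t * K" using t K(1) by auto
    moreover have "(\<bar>B\<bar> * norm l0 + K) * t = \<bar>B\<bar> * norm l0 * t + t * K" by (simp add: algebra_simps)
    ultimately show ?thesis by linarith
  qed
  moreover have "0 \<le> \<bar>B\<bar> * norm l0 + K" using K(1) by simp
  ultimately show ?thesis using that by blast
qed

lemma lip_set_pointwise:
  assumes "f \<in> lip_set J"
  obtains t0 c where "t0 > 0" "c \<ge> 0" "\<And>t x. 0 \<le> t \<Longrightarrow> t \<le> t0 \<Longrightarrow> \<bar>J t f x - f x\<bar> \<le> c * t"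
proof -
  obtain t0 c where f: "f \<in> C0" and t0: "t0 > 0" "c \<ge> 0"
    and c: "\<And>t. 0 \<le> t \<Longrightarrow> t \<le> t0 \<Longrightarrow> supnorm (\<lambda>x. J t f x - f x) \<le> c * t"
    using assms unfolding lip_set_def by auto
  obtain N where N: "\<And>x. \<bar>f x\<bar> \<le> N" using C0_bounded[OF f] by blast
  have "\<bar>J t f x - f x\<bar> \<le> c * t" if t: "0 \<le> t" "t \<le> t0" for t x
  proof -
    obtain N' where N': "\<And>x. \<bar>J t f x\<bar> \<le> N'" using sandwiched_bounded[OF f t(1)] by blast
    have "\<bar>J t f x - f x\<bar> \<le> N' + N" for x using N[of x] N'[of x] by linarith
    from abs_le_supnorm[of "\<lambda>x. J t f x - f x", OF this] c[OF t] show ?thesis by (rule order_trans)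
  qed
  with t0 show ?thesis by (rule that)
qed

lemma lipschitz_lip_set_subset:
  assumes f: "f \<in> lip_set J" and B: "\<And>x y. \<bar>f x - f y\<bar> \<le> B * norm (x - y)"
  shows "f \<in> heat_lip_set"
proof -
  obtain t0 c where t0: "t0 > 0" "c \<ge> 0" and c: "\<And>t x. 0 \<le> t \<Longrightarrow> t \<le> t0 \<Longrightarrow> \<bar>J t f x - f x\<bar> \<le> c * t"
    using lip_set_pointwise[OF f] by blast
  have fC: "f \<in> C0" using f by (simp add: lip_set_def)
  obtain c' where c': "c' \<ge> 0" "\<And>t x. t \<ge> 0 \<Longrightarrow> \<bar>J t f x - heat t f x\<bar> \<le> c' * t"
    using that by (rule sandwiched_near_heat[OF fC B])
  have "\<bar>heat t f x - f x\<bar> \<le> (c + c') * t" if t: "0 \<le> t" "t \<le> t0" for t x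
    using c[OF t, of x] c'(2)[OF t(1), of x] by (simp add: distrib_right)
  then have "\<forall>t\<in>{0..t0}. \<forall>x. \<bar>heat t f x - f x\<bar> \<le> (c + c') * t" by auto
  then show ?thesis unfolding heat_lip_set_def using fC B t0(1) by blast
qed

lemma heat_lip_set_subset_lip_set:
  assumes f: "f \<in> heat_lip_set" shows "f \<in> lip_set J"
proof -
  obtain B t0 c where fC: "f \<in> C0" and B: "\<And>x y. \<bar>f x - f y\<bar> \<le> B * norm (x - y)"
    and t0: "t0 > 0" and c: "\<And>t x. 0 \<le> t \<Longrightarrow> t \<le> t0 \<Longrightarrow> \<bar>heat t f x - f x\<bar> \<le> c * t"
    using f unfolding heat_lip_set_def by fastforce
  obtain c' where c': "c' \<ge> 0" "\<And>t x. t \<ge> 0 \<Longrightarrow> \<bar>J t f x - heat t f x\<bar> \<le> c' * t"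
    using that by (rule sandwiched_near_heat[OF fC B])
  have "\<bar>J t f x - f x\<bar> \<le> (\<bar>c\<bar> + c') * t" if t: "0 \<le> t" "t \<le> t0" for t x
  proof -
    have "c * t \<le> \<bar>c\<bar> * t" using t(1) by (simp add: mult_right_mono)
    then show ?thesis using c[OF t, of x] c'(2)[OF t(1), of x] unfolding distrib_right by linarith
  qed
  then have "\<forall>t\<in>{0..t0}. supnorm (\<lambda>x. J t f x - f x) \<le> (\<bar>c\<bar> + c') * t" by (auto intro!: supnorm_le)
  moreover have "0 \<le> \<bar>c\<bar> + c'" using c'(1) by simp
  ultimately show ?thesis using fC t0 unfolding lip_set_def by blast
qed

text \<open>
  This is where the symmetry enters. If \<open>f\<close> and \<open>-f\<close> are both in the Lipschitz set, the lower bounds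
  for both of them say that \<open>heat t f (x + t *\<^sub>R l)\<close> and \<open>f x\<close> differ by at most \<open>C * t\<close>, for every \<open>x\<close>
  and every \<open>l\<close> on the sphere on which \<open>L\<close> is bounded. Reaching the same midpoint from two
  points along \<open>l\<close> and \<open>-l\<close> compares the values of \<open>f\<close> at distance \<open>2 * t * \<epsilon>\<close>.
\<close>

lemma lip_set_sym_lipschitz:
  assumes "f \<in> lip_set_sym J"
  obtains B where "\<And>x y. \<bar>f x - f y\<bar> \<le> B * norm (x - y)"
proof -
  have f: "f \<in> lip_set J" and mf: "(\<lambda>x. - f x) \<in> lip_set J" using assms by (auto simp: lip_set_sym_def)
  have fC: "f \<in> C0" using f by (simp add: lip_set_def)
  obtain t1 c1 where 1: "t1 > 0" "c1 \<ge> 0" "\<And>t x. 0 \<le> t \<Longrightarrow> t \<le> t1 \<Longrightarrow> \<bar>J t f x - f x\<bar> \<le> c1 * t"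
    using lip_set_pointwise[OF f] by blast
  obtain t2 c2 where 2: "t2 > 0" "c2 \<ge> 0" "\<And>t x. 0 \<le> t \<Longrightarrow> t \<le> t2 \<Longrightarrow> \<bar>J t (\<lambda>x. - f x) x - - f x\<bar> \<le> c2 * t"
    using lip_set_pointwise[OF mf] by blast
  obtain N where N: "\<And>x. \<bar>f x\<bar> \<le> N" using C0_bounded[OF fC] by blast
  have N0: "0 \<le> N" using N[of 0] by linarith
  obtain \<epsilon> :: real where \<epsilon>: "\<epsilon> > 0" and sup: "(SUP l\<in>{l. norm l = \<epsilon>}. L l) < \<infinity>" using L_sphere by blast
  define A where "A = enn2real (SUP l\<in>{l. norm l = \<epsilon>}. L l)"
  have A: "L l \<noteq> \<top> \<and> cost l \<le> A" if "norm l = \<epsilon>" for l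
  proof -
    have le: "L l \<le> (SUP l\<in>{l. norm l = \<epsilon>}. L l)" using that by (intro SUP_upper) simp
    have "L l < \<top>" using le_less_trans[OF le sup] by simp
    moreover have "cost l \<le> A" unfolding A_def using enn2real_mono[OF le] sup by simp
    ultimately show ?thesis by simp
  qed
  define C where "C = c1 + c2 + A"
  define t0 where "t0 = min t1 t2"
  have t0: "t0 > 0" using 1 2 by (simp add: t0_def)
  have shift: "\<bar>heat t f (x + t *\<^sub>R l) - f x\<bar> \<le> C * t" if t: "0 \<le> t" "t \<le> t0" and l: "norm l = \<epsilon>" for t l x
  proof -
    have "heat t f (x + t *\<^sub>R l) - t * cost l \<le> J t f x"
      using sandwiched_lower[OF fC t(1)] A[OF l] by blast
    moreover have "- heat t f (x + t *\<^sub>R l) - t * cost l \<le> J t (\<lambda>x. - f x) x"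
    proof -
      have "heat t (\<lambda>x. - f x) (x + t *\<^sub>R l) - t * cost l \<le> J t (\<lambda>x. - f x) x"
        using sandwiched_lower[OF C0_uminus[OF fC] t(1)] A[OF l] by blast
      then show ?thesis by (simp add: heat_uminus)
    qed
    moreover have "t * cost l \<le> t * A" using A[OF l] t by (simp add: mult_left_mono)
    moreover have "C * t = c1 * t + c2 * t + t * A" by (simp add: C_def algebra_simps)
    moreover have "0 \<le> c1 * t" "0 \<le> c2 * t" using 1 2 t by auto
    ultimately show ?thesis using 1(3)[of t x] 2(3)[of t x] t unfolding t0_def by (auto simp: abs_le_iff)
  qed
  \<comment> \<open>distances up to \<open>2 * t0 * \<epsilon>\<close> are handled by the midpoint argument, larger ones by boundedness\<close>
  define B where "B = max (C / \<epsilon>) (N / (t0 * \<epsilon>))"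
  have "\<bar>f x - f y\<bar> \<le> B * norm (x - y)" for x y
  proof -
    define r where "r = norm (x - y)"
    show ?thesis
    proof (cases "r = 0 \<or> r > 2 * t0 * \<epsilon>")
      case True
      then show ?thesis
      proof
        assume "r > 2 * t0 * \<epsilon>"
        then have "2 * N \<le> N / (t0 * \<epsilon>) * r"
          using N0 t0 \<epsilon> mult_left_mono[of "2 * t0 * \<epsilon>" r "N / (t0 * \<epsilon>)"] by simp
        also have "\<dots> \<le> B * r" by (intro mult_right_mono) (auto simp: B_def r_def)
        finally show ?thesis using N[of x] N[of y] unfolding r_def by linarith
      qed (simp add: r_def)
    next
      case False
      then have r: "r > 0" "r \<le> 2 * t0 * \<epsilon>" by (auto simp: r_def)
      define t where "t = r / (2 * \<epsilon>)"
      define l where "l = (\<epsilon> / r) *\<^sub>R (x - y)"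
      have t: "0 \<le> t" "t \<le> t0" using r \<epsilon> by (auto simp: t_def field_simps)
      have l: "norm l = \<epsilon>" "norm (- l) = \<epsilon>" using r \<epsilon> by (auto simp: l_def r_def)
      have tl: "t *\<^sub>R l = (1 / 2) *\<^sub>R (x - y)" using r \<epsilon> by (simp add: t_def l_def)
      have mid: "y + t *\<^sub>R l = x + t *\<^sub>R (- l)"
        unfolding scaleR_minus_right tl by (simp add: algebra_simps flip: scaleR_add_left)
      have "\<bar>f x - f y\<bar> \<le> 2 * (C * t)"
        using shift[OF t l(1), of y] shift[OF t l(2), of x] unfolding mid by linarith
      also have "\<dots> = C / \<epsilon> * r" by (simp add: t_def)
      also have "\<dots> \<le> B * r" using r by (intro mult_right_mono) (auto simp: B_def)
      finally show ?thesis by (simp add: r_def)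
    qed
  qed
  then show ?thesis by (rule that)
qed

lemma heat_lip_set_uminus: "f \<in> heat_lip_set \<Longrightarrow> (\<lambda>x. - f x) \<in> heat_lip_set"
  unfolding heat_lip_set_def by (simp add: C0_uminus heat_uminus abs_minus_commute)

text \<open>
  Functions in the symmetric Lipschitz set are Lipschitz, and on Lipschitz functions \<open>J\<close> and the heat
  semigroup differ by a term linear in time. Since the right-hand side does not involve \<open>J\<close>, all
  sandwiched families have the same symmetric Lipschitz set.
\<close>

theorem lip_set_sym_eq_heat_lip_set: "lip_set_sym J = heat_lip_set"
proof (intro equalityI subsetI)
  fix f assume f: "f \<in> lip_set_sym J"
  obtain B where "\<And>x y. \<bar>f x - f y\<bar> \<le> B * norm (x - y)" using lip_set_sym_lipschitz[OF f] by blast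
  moreover have "f \<in> lip_set J" using f by (simp add: lip_set_sym_def)
  ultimately show "f \<in> heat_lip_set" by (intro lipschitz_lip_set_subset)
next
  fix f assume "f \<in> heat_lip_set"
  then show "f \<in> lip_set_sym J"
    unfolding lip_set_sym_def using heat_lip_set_subset_lip_set heat_lip_set_uminus by blast
qed

end

lemma control_op_sandwiched: "sandwiched (control_op M W L)"
  unfolding sandwiched_def
proof (intro conjI ballI allI impI)
  fix f :: "'a \<Rightarrow> real" assume fC: "f \<in> C0"
  obtain N where N: "\<And>x. \<bar>f x\<bar> \<le> N" using C0_bounded[OF fC] by blast
  note fm = C0_measurable[OF fC]
  show "\<exists>N. \<forall>x. \<bar>control_op M W L t f x\<bar> \<le> N" if "t \<ge> 0" for t
    using that control_op_bound[OF _ fm N] N control_op_0[OF fm] by (cases "t = 0") (auto intro!: exI[of _ N])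
  show "heat t f (x + t *\<^sub>R l) - t * cost l \<le> control_op M W L t f x" if "t \<ge> 0" "L l \<noteq> \<top>" for t l x
    using that control_op_lower[OF _ fm N] control_op_0[OF fm] heat_0[OF fm] by (cases "t = 0") auto
  fix B assume B: "\<forall>x y. \<bar>f x - f y\<bar> \<le> B * norm (x - y)"
  obtain K where K: "K \<ge> 0" "\<And>l. L l \<noteq> \<top> \<Longrightarrow> B * norm l - cost l \<le> K"
    using that by (rule legendre_bound)
  have "control_op M W L t f x \<le> heat t f x + t * K" if "t \<ge> 0" for t x
  proof (cases "t = 0")
    case True
    then show ?thesis using control_op_0[OF fm] heat_0[OF fm] by simp
  next
    case False
    with that have "t > 0" by simp
    then show ?thesis by (rule control_op_upper_lipschitz[OF _ C0_buc[OF fC] B[rule_format] K(2)])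
  qed
  then show "\<exists>K\<ge>0. \<forall>t\<ge>0. \<forall>x. control_op M W L t f x \<le> heat t f x + t * K" using K(1) by blast
qed

section \<open>The associated semigroup\<close>

context
  fixes S :: "real \<Rightarrow> ('a \<Rightarrow> real) \<Rightarrow> ('a \<Rightarrow> real)"
  assumes S: "associated_semigroup (control_op M W L) S"
begin

lemma semigroup_properties:
  shows S_C0: "\<And>t f. 0 \<le> t \<Longrightarrow> f \<in> C0 \<Longrightarrow> S t f \<in> C0"
    and S_limit: "\<exists>n :: nat \<Rightarrow> nat. strict_mono n \<and> (\<forall>l. 1 \<le> n l) \<and>
        (\<forall>f\<in>C0. \<forall>t\<in>dyadics.
           (\<lambda>l. supnorm (\<lambda>x. dyadic_iterate (control_op M W L) (n l) t f x - S t f x)) \<longlonglongrightarrow> 0)"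
    and S_add: "\<And>s t f. 0 \<le> s \<Longrightarrow> 0 \<le> t \<Longrightarrow> f \<in> C0 \<Longrightarrow> S (s + t) f = S s (S t f)"
    and S_contraction: "\<And>t f g. 0 \<le> t \<Longrightarrow> f \<in> C0 \<Longrightarrow> g \<in> C0 \<Longrightarrow>
        supnorm (\<lambda>x. S t f x - S t g x) \<le> supnorm (\<lambda>x. f x - g x)"
    and S_continuous: "\<And>f t. f \<in> C0 \<Longrightarrow> 0 \<le> t \<Longrightarrow>
        ((\<lambda>s. supnorm (\<lambda>x. S s f x - S t f x)) \<longlongrightarrow> 0) (at t within {0..})"
  using S[unfolded associated_semigroup_def] by (elim conjE, simp)+

text \<open>
  At a dyadic time all sufficiently fine dyadic partitions reach the time exactly, so no rounding is
  left after finitely many members of the sequence have been dropped.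
\<close>

lemma S_dyadic_limit:
  assumes t: "t \<in> dyadics" and f: "f \<in> C0"
  obtains h k where "\<And>i. h i > 0" "\<And>i. real (k i) * h i = t"
    "\<And>x. (\<lambda>i. (control_op M W L (h i) ^^ k i) f x) \<longlonglongrightarrow> S t f x"
proof -
  obtain j m :: nat where jm: "t = real j / 2 ^ m" using t unfolding dyadics_def by auto
  then have t0: "0 \<le> t" by simp
  obtain n :: "nat \<Rightarrow> nat" where n: "strict_mono n"
    and lim: "(\<lambda>i. supnorm (\<lambda>x. dyadic_iterate (control_op M W L) (n i) t f x - S t f x)) \<longlonglongrightarrow> 0"
    using S_limit t f by blast
  define h where "h = (\<lambda>i. 1 / 2 ^ n (i + m) :: real)"
  define k where "k = (\<lambda>i. nat \<lfloor>2 ^ n (i + m) * t\<rfloor>)"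
  have h: "h i > 0" for i by (simp add: h_def)
  have kh: "real (k i) * h i = t" for i
  proof -
    have "m \<le> n (i + m)" using seq_suble[OF n, of "i + m"] by simp
    then have "(2::real) ^ n (i + m) = 2 ^ (n (i + m) - m) * 2 ^ m" by (simp flip: power_add)
    then have e: "2 ^ n (i + m) * t = real (2 ^ (n (i + m) - m) * j)" by (simp add: jm)
    then have "real (k i) = 2 ^ n (i + m) * t" unfolding k_def e by simp
    then show ?thesis by (simp add: h_def)
  qed
  have it: "dyadic_iterate (control_op M W L) (n (i + m)) t f = (control_op M W L (h i) ^^ k i) f" for i
    by (simp add: dyadic_iterate_def h_def k_def)
  have "(\<lambda>i. (control_op M W L (h i) ^^ k i) f x) \<longlonglongrightarrow> S t f x" for x
  proof (rule tendsto_of_supnorm[where h="\<lambda>i. (control_op M W L (h i) ^^ k i) f" and g="S t f"])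
    show "(\<lambda>i. supnorm (\<lambda>x. (control_op M W L (h i) ^^ k i) f x - S t f x)) \<longlonglongrightarrow> 0"
      using LIMSEQ_ignore_initial_segment[OF lim, of m] by (simp add: it)
    fix i
    obtain N where N: "\<And>x. \<bar>(control_op M W L (h i) ^^ k i) f x\<bar> \<le> N"
      using buc_bounded[OF iterate_buc[OF h C0_buc[OF f]]] by blast
    obtain N' where N': "\<And>x. \<bar>S t f x\<bar> \<le> N'" using C0_bounded[OF S_C0[OF t0 f]] by blast
    have "\<bar>(control_op M W L (h i) ^^ k i) f x - S t f x\<bar> \<le> N + N'" for x
      using N[of x] N'[of x] by linarith
    then show "\<exists>N. \<forall>x. \<bar>(control_op M W L (h i) ^^ k i) f x - S t f x\<bar> \<le> N" by blast
  qed
  with h kh show ?thesis by (rule that)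
qed

lemma S_tendsto:
  assumes s: "\<And>n. 0 \<le> s n" "s \<longlonglongrightarrow> t" and f: "f \<in> C0"
  shows "(\<lambda>n. S (s n) f x) \<longlonglongrightarrow> S t f x"
proof (rule tendsto_of_supnorm[where h="\<lambda>n. S (s n) f" and g="S t f"])
  have t: "0 \<le> t" using LIMSEQ_le_const[OF s(2)] s(1) by blast
  let ?F = "\<lambda>r. supnorm (\<lambda>x. S r f x - S t f x)"
  have "(?F \<longlongrightarrow> 0) (at t within {0..})"
    by (rule S_continuous[OF f t])
  moreover have "?F t = 0" by (simp add: supnorm_def)
  ultimately have "continuous (at t within {0..}) ?F" by (simp add: continuous_within)
  from continuous_within_tendsto_compose[OF this _ s(2)] s(1)
  show "(\<lambda>n. ?F (s n)) \<longlonglongrightarrow> 0" using \<open>?F t = 0\<close> by simp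
  fix n
  obtain N where N: "\<And>x. \<bar>S (s n) f x\<bar> \<le> N" using C0_bounded[OF S_C0[OF s(1) f]] by blast
  obtain N' where N': "\<And>x. \<bar>S t f x\<bar> \<le> N'" using C0_bounded[OF S_C0[OF t f]] by blast
  have "\<bar>S (s n) f x - S t f x\<bar> \<le> N + N'" for x
    using N[of x] N'[of x] by linarith
  then show "\<exists>N. \<forall>x. \<bar>S (s n) f x - S t f x\<bar> \<le> N" by blast
qed

lemma S_lipschitz:
  assumes t: "0 \<le> t" and f: "f \<in> C0" and B: "\<And>x y. \<bar>f x - f y\<bar> \<le> B * norm (x - y)"
  shows "\<bar>S t f x - S t f y\<bar> \<le> B * norm (x - y)"
proof -
  have dyadic: "\<bar>S s f x - S s f y\<bar> \<le> B * norm (x - y)" if s: "s \<in> dyadics" for s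
  proof -
    obtain h k where hk: "\<And>i. h i > 0" "\<And>i. real (k i) * h i = s"
      "\<And>x. (\<lambda>i. (control_op M W L (h i) ^^ k i) f x) \<longlonglongrightarrow> S s f x"
      using S_dyadic_limit[OF s f] by blast
    show ?thesis
      by (rule LIMSEQ_le_const2[OF tendsto_rabs[OF tendsto_diff[OF hk(3) hk(3)]]])
        (use iterate_lipschitz[OF hk(1) C0_buc[OF f] B] in blast)
  qed
  obtain s where s: "\<And>n. s n \<in> dyadics" "\<And>n. 0 \<le> s n" "s \<longlonglongrightarrow> t" using dyadic_approximation[OF t] by blast
  show ?thesis
    by (rule LIMSEQ_le_const2[OF tendsto_rabs[OF tendsto_diff[OF S_tendsto[OF s(2,3) f] S_tendsto[OF s(2,3) f]]]])
      (use dyadic[OF s(1)] in blast)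
qed

lemma S_sandwiched: "sandwiched S"
  unfolding sandwiched_def
proof (intro conjI ballI allI impI)
  fix f :: "'a \<Rightarrow> real" assume fC: "f \<in> C0"
  show "\<exists>N. \<forall>x. \<bar>S t f x\<bar> \<le> N" if "t \<ge> 0" for t
    using C0_bounded[OF S_C0[OF that fC]] by blast
  show "heat t f (x + t *\<^sub>R l) - t * cost l \<le> S t f x" if t: "t \<ge> 0" and l: "L l \<noteq> \<top>" for t l x
  proof -
    have dyadic: "heat s f (x + s *\<^sub>R l) - s * cost l \<le> S s f x" if s: "s \<in> dyadics" for s
    proof -
      obtain h k where hk: "\<And>i. h i > 0" "\<And>i. real (k i) * h i = s"
        "\<And>x. (\<lambda>i. (control_op M W L (h i) ^^ k i) f x) \<longlonglongrightarrow> S s f x"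
        using S_dyadic_limit[OF s fC] by blast
      have "heat s f (x + s *\<^sub>R l) - s * cost l \<le> (control_op M W L (h i) ^^ k i) f x" for i
        using iterate_lower[OF hk(1)[of i] C0_buc[OF fC] l, of "k i" x] unfolding hk(2) .
      then show ?thesis by (intro LIMSEQ_le_const[OF hk(3)]) blast
    qed
    obtain s where s: "\<And>n. s n \<in> dyadics" "\<And>n. 0 \<le> s n" "s \<longlonglongrightarrow> t" using dyadic_approximation[OF t] by blast
    have "(\<lambda>n. heat (s n) f (x + s n *\<^sub>R l) - s n * cost l) \<longlonglongrightarrow> heat t f (x + t *\<^sub>R l) - t * cost l"
      by (intro tendsto_intros heat_tendsto[OF fC s(2,3)] s(3))
    then show ?thesis
      by (rule LIMSEQ_le[OF _ S_tendsto[OF s(2,3) fC]]) (use dyadic[OF s(1)] in blast)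
  qed
  fix B assume B: "\<forall>x y. \<bar>f x - f y\<bar> \<le> B * norm (x - y)"
  obtain K where K: "K \<ge> 0" "\<And>l. L l \<noteq> \<top> \<Longrightarrow> B * norm l - cost l \<le> K"
    using that by (rule legendre_bound)
  have "S t f x \<le> heat t f x + t * K" if t: "t \<ge> 0" for t x
  proof -
    have dyadic: "S s f x \<le> heat s f x + s * K" if s: "s \<in> dyadics" for s
    proof -
      obtain h k where hk: "\<And>i. h i > 0" "\<And>i. real (k i) * h i = s"
        "\<And>x. (\<lambda>i. (control_op M W L (h i) ^^ k i) f x) \<longlonglongrightarrow> S s f x"
        using S_dyadic_limit[OF s fC] by blast
      have "(control_op M W L (h i) ^^ k i) f x \<le> heat s f x + s * K" for i
        using iterate_upper[OF hk(1)[of i] C0_buc[OF fC] B[rule_format] K(2), of "k i" x] unfolding hk(2) .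
      then show ?thesis by (intro LIMSEQ_le_const2[OF hk(3)]) blast
    qed
    obtain s where s: "\<And>n. s n \<in> dyadics" "\<And>n. 0 \<le> s n" "s \<longlonglongrightarrow> t" using dyadic_approximation[OF t] by blast
    have "(\<lambda>n. heat (s n) f x + s n * K) \<longlonglongrightarrow> heat t f x + t * K"
      by (intro tendsto_intros heat_tendsto[OF fC s(2,3)] s(3))
    then show ?thesis
      by (rule LIMSEQ_le[OF S_tendsto[OF s(2,3) fC]]) (use dyadic[OF s(1)] in blast)
  qed
  then show "\<exists>K\<ge>0. \<forall>t\<ge>0. \<forall>x. S t f x \<le> heat t f x + t * K" using K(1) by blast
qed

lemma lip_set_invariant:
  assumes t: "0 \<le> t" and f: "f \<in> lip_set S" shows "S t f \<in> lip_set S"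
proof -
  obtain t0 c where fC: "f \<in> C0" and t0: "t0 > 0" "c \<ge> 0"
    and c: "\<And>s. 0 \<le> s \<Longrightarrow> s \<le> t0 \<Longrightarrow> supnorm (\<lambda>x. S s f x - f x) \<le> c * s"
    using f unfolding lip_set_def by auto
  have "supnorm (\<lambda>x. S s (S t f) x - S t f x) \<le> c * s" if s: "0 \<le> s" "s \<le> t0" for s
  proof -
    have "S s (S t f) = S t (S s f)"
      using S_add[OF s(1) t fC] S_add[OF t s(1) fC] by (simp add: add.commute)
    then show ?thesis
      using S_contraction[OF t S_C0[OF s(1) fC] fC] c[OF s] by simp
  qed
  then have "\<forall>s\<in>{0..t0}. supnorm (\<lambda>x. S s (S t f) x - S t f x) \<le> c * s" by simp
  then show ?thesis unfolding lip_set_def using S_C0[OF t fC] t0 by blast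
qed

text \<open>
  Invariance of the one-sided Lipschitz set is immediate from the semigroup property, but it says
  nothing about \<open>- S t f\<close>. However, \<open>S t f\<close> is again Lipschitz continuous, and for Lipschitz functions
  membership in the one-sided set implies membership in \<^const>\<open>heat_lip_set\<close>, which is symmetric.
\<close>

lemma lip_set_sym_invariant:
  assumes t: "0 \<le> t" and f: "f \<in> lip_set_sym S" shows "S t f \<in> lip_set_sym S"
proof -
  have "f \<in> lip_set S" using f by (simp add: lip_set_sym_def)
  moreover from this have "f \<in> C0" by (simp add: lip_set_def)
  moreover obtain B where "\<And>x y. \<bar>f x - f y\<bar> \<le> B * norm (x - y)"
    using lip_set_sym_lipschitz[OF S_sandwiched f] by blast
  ultimately have "S t f \<in> heat_lip_set"
    using lipschitz_lip_set_subset[OF S_sandwiched lip_set_invariant[OF t]] S_lipschitz[OF t] by blast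
  then show ?thesis by (simp add: lip_set_sym_eq_heat_lip_set[OF S_sandwiched])
qed

end

end

section \<open>The symmetric Lipschitz set\<close>

theorem theorem6p3:
  fixes L :: "'a::euclidean_space \<Rightarrow> ennreal"
    and M :: "'w measure"
    and W :: "real \<Rightarrow> 'w \<Rightarrow> 'a"
    and S :: "real \<Rightarrow> ('a \<Rightarrow> real) \<Rightarrow> ('a \<Rightarrow> real)"
  assumes L_min: "\<exists>l. L l = 0"
    and L_growth: "((\<lambda>l. L l / ennreal (norm l)) \<longlongrightarrow> \<infinity>) at_infinity"
    and L_bdd: "\<And>r::real. r > 0 \<Longrightarrow> (SUP l\<in>cball 0 r \<inter> {l. L l < \<infinity>}. L l) < \<infinity>"
    and L_sphere: "\<exists>\<epsilon>::real. \<epsilon> > 0 \<and> (SUP l\<in>{l. norm l = \<epsilon>}. L l) < \<infinity>"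
    and W: "brownian_motion M W"
    and S: "associated_semigroup (control_op M W L) S"
  shows "(\<forall>t\<ge>0. \<forall>f\<in>lip_set_sym S. S t f \<in> lip_set_sym S) \<and>
         lip_set_sym S = lip_set_sym (control_op M W L) \<and>
         lip_set_sym (control_op M W L) =
           {f \<in> W1inf \<inter> C0. \<exists>g\<in>Linf. weak_laplacian f g}"
proof -
  interpret prob_space M using W by (simp add: brownian_motion_def)
  interpret controlled_brownian M W L
    by unfold_locales (fact W L_min L_growth L_sphere)+
  show ?thesis
    using lip_set_sym_invariant[OF S] lip_set_sym_eq_heat_lip_set[OF S_sandwiched[OF S]]
      lip_set_sym_eq_heat_lip_set[OF control_op_sandwiched] heat_lip_set_eq_sobolev
    by simp
qed

end
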